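(* Let $n\in\mathbb Z\setminus\{0\}$ and let $a,b,c,f\in\mathbb R$ with $af-bc=1$. On $T^3=\mathbb R^3/\mathbb Z^3$ with coordinates $(x,y,t)$, oriented by $dx\wedge dy\wedge dt$, put $$\theta=\cos(2\pi nt)\,dx-\sin(2\pi nt)\,dy,\quad \theta^1=-2\pi n\,dt,\quad \theta^2=\sin(2\pi nt)\,dx+\cos(2\pi nt)\,dy,$$ $$\theta'^1=a\,\theta^1+b\,\theta^2,\qquad \theta'^2=c\,\theta^1+f\,\theta^2 .$$ Then the global invariant of the path structure on $T^3$ defined by $\theta,\theta'^1,\theta'^2$ is $$\mu=\frac{3n}{8\pi}(bf)^2 .$$
   Context: A path structure on a smooth 3-manifold $M$: line subbundles $T^1,T^2\subset TM$ with $T^1\cap T^2=\{0\}$ and $D=T^1\oplus T^2$ a contact distribution. Forms $\theta,\theta'^1,\theta'^2$ with $d\theta=\theta'^1\wedge\theta'^2$ define a path structure by $T^1=\ker\theta\cap\ker\theta'^2$, $T^2=\ker\theta\cap\ker\theta'^1$. Let $E\to M$ be the bundle of covectors with kernel $D$, with tautological form $\omega$. The bundle $Y\to E$ has fibre over $\varepsilon\in E$ the set of coframes $(\omega,\omega^1,\omega^2,\phi)$ of $T_\varepsilon^*E$ with $\omega$ tautological, $\omega^1,\omega^2$ pulled back from covectors $\eta^1,\eta^2$ on $M$ with $\eta^1|_{T^2}=0$, $\eta^1|_{T^1}\neq0$, $\eta^2|_{T^1}=0$, $\eta^2|_{T^2}\ne0$, and $d\omega=2\phi\wedge\omega+\omega^1\wedge\omega^2$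 at $\varepsilon$. $Y\to M$ is a principal bundle for the Borel group $B\subset SL(3,\mathbb R)$ of upper triangular matrices, where $h\in B$ replaces $(\omega,\omega^1,\omega^2,\phi)$ by the entries in positions $(3,1),(2,1),(3,2)$ and half the difference of the $(1,1)$ and $(3,3)$ entries of $h^{-1}Xh$, $X$ being any matrix of the shape of $\pi$ below. (Cartan) There is a unique $\mathfrak{sl}(3,\mathbb R)$-valued Cartan connection on $Y$ $$\pi=\begin{pmatrix}\phi+w&\phi^2&\psi\\ \omega^1&-2w&\phi^1\\ \omega&\omega^2&-\phi+w\end{pmatrix}$$ with $\omega,\omega^1,\omega^2,\phi$ the tautological forms and curvature $\Pi=d\pi+\pi\wedge\pi=\begin{pmatrix}0&\Phi^2&\Psi\\0&0&\Phi^1\\0&0&0\end{pmatrix}$, $\Phi^1=Q^1\omega\wedge\omega^2$, $\Phi^2=Q^2\omega\wedge\omega^1$, $\Psi=(U_1\omega^1+U_2\omega^2)\wedge\omega$ for functions $Q^1,Q^2,U_1,U_2$. For $M$ closed oriented and $s:M\to Y$ a global section, the global invariant is $\mu=\int_Ms^*TC_2(\pi)$ with $TC_2(\pi)=\frac1{24\pi^2}\mathrm{tr}(\pi\wedge\pi\wedge\pi)$; it does not depend on $s$. *)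

theory Defs
  imports "HOL-Analysis.Analysis"
begin

section \<open>Smooth maps, tangent vectors and differential forms\<close>

text \<open>\<open>Ck_on\<close> and \<open>smooth_on\<close> are meant for open \<open>S\<close> only.\<close>

primrec Ck_on :: "nat \<Rightarrow> 'a::euclidean_space set \<Rightarrow> ('a \<Rightarrow> 'b::real_normed_vector) \<Rightarrow> bool" where
  "Ck_on 0 S f \<longleftrightarrow> continuous_on S f"
| "Ck_on (Suc k) S f \<longleftrightarrow> f differentiable_on S \<and>
     (\<forall>v. Ck_on k S (\<lambda>x. frechet_derivative f (at x) v))"

definition smooth_on :: "'a::euclidean_space set \<Rightarrow> ('a \<Rightarrow> 'b::real_normed_vector) \<Rightarrow> bool" where
  "smooth_on S f \<longleftrightarrow> (\<forall>k. Ck_on k S f)"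

definition curve_at :: "'a::euclidean_space set \<Rightarrow> 'a \<Rightarrow> 'a \<Rightarrow> (real \<Rightarrow> 'a) \<Rightarrow> bool" where
  "curve_at S x v \<gamma> \<longleftrightarrow> (\<exists>e>0. smooth_on {-e<..<e} \<gamma> \<and> (\<forall>t\<in>{-e<..<e}. \<gamma> t \<in> S)) \<and>
     \<gamma> 0 = x \<and> (\<gamma> has_vector_derivative v) (at 0)"

text \<open>For an embedded submanifold \<open>S\<close> of a Euclidean space this is the usual tangent space.\<close>

definition tangent_space :: "'a::euclidean_space set \<Rightarrow> 'a \<Rightarrow> 'a set" where
  "tangent_space S x = {v. \<exists>\<gamma>. curve_at S x v \<gamma>}"

text \<open>A 1-form takes a point and a tangent vector. A 1-form on an embedded submanifold \<open>S\<close> is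
  represented by a smooth 1-form on an open neighbourhood of \<open>S\<close>, of which only the restriction
  to tangent vectors of \<open>S\<close> is relevant; since the exterior derivative commutes with restriction,
  it is the restriction of the exterior derivative of the representative.
  All forms follow the convention without factorials:
  \<open>(\<alpha> \<and> \<beta>)(u, v) = \<alpha>(u) \<beta>(v) - \<alpha>(v) \<beta>(u)\<close> for 1-forms.\<close>

definition smooth_form :: "'a::euclidean_space set \<Rightarrow> ('a \<Rightarrow> 'a \<Rightarrow> 'b::real_normed_vector) \<Rightarrow> bool" where
  "smooth_form S \<alpha> \<longleftrightarrow> (\<forall>x\<in>S. linear (\<alpha> x)) \<and> (\<forall>v. smooth_on S (\<lambda>x. \<alpha> x v))"

definition ext_d :: "('a::euclidean_space \<Rightarrow> 'a \<Rightarrow> 'b::real_normed_vector) \<Rightarrow> 'a \<Rightarrow> 'a \<Rightarrow> 'a \<Rightarrow> 'b" where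
  "ext_d \<alpha> x u v = frechet_derivative (\<lambda>y. \<alpha> y v) (at x) u - frechet_derivative (\<lambda>y. \<alpha> y u) (at x) v"

definition wedge :: "('a \<Rightarrow> real) \<Rightarrow> ('a \<Rightarrow> real) \<Rightarrow> 'a \<Rightarrow> 'a \<Rightarrow> real" where
  "wedge \<alpha> \<beta> u v = \<alpha> u * \<beta> v - \<alpha> v * \<beta> u"

definition wedge12 :: "('a \<Rightarrow> real) \<Rightarrow> ('a \<Rightarrow> 'a \<Rightarrow> real) \<Rightarrow> 'a \<Rightarrow> 'a \<Rightarrow> 'a \<Rightarrow> real" where
  "wedge12 \<alpha> \<beta> u v w = \<alpha> u * \<beta> v w - \<alpha> v * \<beta> u w + \<alpha> w * \<beta> u v"

definition mwedge :: "('a \<Rightarrow> real^3^3) \<Rightarrow> ('a \<Rightarrow> real^3^3) \<Rightarrow> 'a \<Rightarrow> 'a \<Rightarrow> real^3^3" where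
  "mwedge \<alpha> \<beta> u v = \<alpha> u ** \<beta> v - \<alpha> v ** \<beta> u"

definition mwedge21 :: "('a \<Rightarrow> 'a \<Rightarrow> real^3^3) \<Rightarrow> ('a \<Rightarrow> real^3^3) \<Rightarrow> 'a \<Rightarrow> 'a \<Rightarrow> 'a \<Rightarrow> real^3^3" where
  "mwedge21 \<alpha> \<beta> u v w = \<alpha> u v ** \<beta> w - \<alpha> u w ** \<beta> v + \<alpha> v w ** \<beta> u"


section \<open>Path structures on the 3-torus\<close>

text \<open>Objects on \<open>T\<^sup>3 = \<real>\<^sup>3/\<int>\<^sup>3\<close> are objects on \<open>\<real>\<^sup>3\<close> invariant under translation by \<open>lattice\<close>; the
  coordinates \<open>(x, y, t)\<close> of a point \<open>p\<close> are \<open>(p$1, p$2, p$3)\<close>.\<close>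

definition lattice :: "(real^3) set" where
  "lattice = {k. \<forall>i. k $ i \<in> \<int>}"

type_synonym line_pair = "(real^3 \<Rightarrow> (real^3) set) \<times> (real^3 \<Rightarrow> (real^3) set)"

definition line_field :: "(real^3 \<Rightarrow> (real^3) set) \<Rightarrow> bool" where
  "line_field T \<longleftrightarrow>
     (\<forall>p. \<exists>U X. open U \<and> p \<in> U \<and> smooth_on U X \<and> (\<forall>q\<in>U. X q \<noteq> 0 \<and> T q = span {X q})) \<and>
     (\<forall>p. \<forall>k\<in>lattice. T (p + k) = T p)"

definition contact_plane :: "line_pair \<Rightarrow> real^3 \<Rightarrow> (real^3) set" where
  "contact_plane P p = {u + v |u v. u \<in> fst P p \<and> v \<in> snd P p}"

definition contact_distribution :: "(real^3 \<Rightarrow> (real^3) set) \<Rightarrow> bool" where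
  "contact_distribution D \<longleftrightarrow>
     (\<forall>p. \<exists>U \<theta>. open U \<and> p \<in> U \<and> smooth_form U \<theta> \<and>
        (\<forall>q\<in>U. D q = {v. \<theta> q v = (0::real)} \<and> (\<exists>u v w. wedge12 (\<theta> q) (ext_d \<theta> q) u v w \<noteq> 0)))"

definition path_structure :: "line_pair \<Rightarrow> bool" where
  "path_structure P \<longleftrightarrow> line_field (fst P) \<and> line_field (snd P) \<and>
     (\<forall>p. fst P p \<inter> snd P p = {0}) \<and> contact_distribution (contact_plane P)"

definition path_structure_of_forms ::
    "(real^3 \<Rightarrow> real^3 \<Rightarrow> real) \<Rightarrow> (real^3 \<Rightarrow> real^3 \<Rightarrow> real) \<Rightarrow> (real^3 \<Rightarrow> real^3 \<Rightarrow> real) \<Rightarrow> line_pair" where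
  "path_structure_of_forms \<theta> \<theta>1 \<theta>2 =
     (\<lambda>p. {v. \<theta> p v = 0 \<and> \<theta>2 p v = 0}, \<lambda>p. {v. \<theta> p v = 0 \<and> \<theta>1 p v = 0})"


section \<open>The bundles E and Y\<close>

text \<open>A covector of \<open>\<real>\<^sup>3\<close> is represented by the vector which gives it through the inner product, so
  that \<open>E\<close> is an embedded 4-dimensional submanifold of \<open>\<real>\<^sup>3 \<times> \<real>\<^sup>3\<close>, with points (base point, covector).
  Its tautological form is the restriction of \<open>tautological\<close>.\<close>

type_synonym epoint = "(real^3) \<times> (real^3)"

definition E_bundle :: "line_pair \<Rightarrow> epoint set" where
  "E_bundle P = {\<epsilon>. {v. snd \<epsilon> \<bullet> v = 0} = contact_plane P (fst \<epsilon>)}"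

definition tautological :: "epoint \<Rightarrow> epoint \<Rightarrow> real" where
  "tautological \<epsilon> z = snd \<epsilon> \<bullet> fst z"

text \<open>A point of \<open>Y\<close> is \<open>(\<epsilon>, \<eta>1, \<eta>2, f)\<close>, standing for the coframe \<open>(\<omega>, \<omega>1, \<omega>2, \<phi>)\<close> of the tangent space
  of \<open>E\<close> at \<open>\<epsilon>\<close> consisting of the four functions \<open>cof\<close> below. The covector \<open>\<phi>\<close> on this tangent space, a
  4-dimensional subspace of \<open>\<real>\<^sup>3 \<times> \<real>\<^sup>3\<close>, is represented by the unique \<open>f\<close> in the subspace with
  \<open>\<phi>(z) = f \<bullet> z\<close> on it. This makes \<open>Y\<close> an embedded 8-dimensional submanifold.\<close>

type_synonym ypoint = "epoint \<times> (real^3) \<times> (real^3) \<times> epoint"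

definition cof_\<omega> :: "ypoint \<Rightarrow> epoint \<Rightarrow> real" where
  "cof_\<omega> y z = tautological (fst y) z"

definition cof_\<omega>1 :: "ypoint \<Rightarrow> epoint \<Rightarrow> real" where
  "cof_\<omega>1 y z = fst (snd y) \<bullet> fst z"

definition cof_\<omega>2 :: "ypoint \<Rightarrow> epoint \<Rightarrow> real" where
  "cof_\<omega>2 y z = fst (snd (snd y)) \<bullet> fst z"

definition cof_\<phi> :: "ypoint \<Rightarrow> epoint \<Rightarrow> real" where
  "cof_\<phi> y z = snd (snd (snd y)) \<bullet> z"

definition Y_bundle :: "line_pair \<Rightarrow> ypoint set" where
  "Y_bundle P = {y. \<exists>p \<xi> \<eta>1 \<eta>2 f. y = ((p, \<xi>), \<eta>1, \<eta>2, f) \<and>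
     (p, \<xi>) \<in> E_bundle P \<and>
     f \<in> tangent_space (E_bundle P) (p, \<xi>) \<and>
     (\<forall>u\<in>snd P p. \<eta>1 \<bullet> u = 0) \<and> (\<exists>u\<in>fst P p. \<eta>1 \<bullet> u \<noteq> 0) \<and>
     (\<forall>u\<in>fst P p. \<eta>2 \<bullet> u = 0) \<and> (\<exists>u\<in>snd P p. \<eta>2 \<bullet> u \<noteq> 0) \<and>
     (\<forall>z\<in>tangent_space (E_bundle P) (p, \<xi>).
        cof_\<omega> y z = 0 \<and> cof_\<omega>1 y z = 0 \<and> cof_\<omega>2 y z = 0 \<and> cof_\<phi> y z = 0 \<longrightarrow> z = 0) \<and>
     (\<forall>z\<in>tangent_space (E_bundle P) (p, \<xi>). \<forall>z'\<in>tangent_space (E_bundle P) (p, \<xi>).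
        ext_d tautological (p, \<xi>) z z' =
          2 * wedge (cof_\<phi> y) (cof_\<omega> y) z z' + wedge (cof_\<omega>1 y) (cof_\<omega>2 y) z z')}"

definition Y_translate :: "real^3 \<Rightarrow> ypoint \<Rightarrow> ypoint" where
  "Y_translate k y = ((fst (fst y) + k, snd (fst y)), snd y)"


section \<open>The action of the Borel group\<close>

definition borel_group :: "(real^3^3) set" where
  "borel_group = {h. det h = 1 \<and> h $ 2 $ 1 = 0 \<and> h $ 3 $ 1 = 0 \<and> h $ 3 $ 2 = 0}"

text \<open>The shape of the matrix \<open>\<pi>\<close>; arguments in the order \<open>\<omega>, \<omega>1, \<omega>2, \<phi>, w, \<phi>1, \<phi>2, \<psi>\<close>.\<close>

definition pi_shape :: "real \<Rightarrow> real \<Rightarrow> real \<Rightarrow> real \<Rightarrow> real \<Rightarrow> real \<Rightarrow> real \<Rightarrow> real \<Rightarrow> real^3^3" where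
  "pi_shape \<omega> \<omega>1 \<omega>2 \<phi> w \<phi>1 \<phi>2 \<psi> =
     vector [vector [\<phi> + w, \<phi>2, \<psi>],
             vector [\<omega>1, - 2 * w, \<phi>1],
             vector [\<omega>, \<omega>2, - \<phi> + w]]"

text \<open>\<open>y'\<close> is the result of the action of \<open>h\<close> on \<open>y\<close>. The new coframe lives at another point \<open>r \<epsilon>\<close> of
  the fibre of \<open>E\<close>, as its first member must be tautological; covectors of \<open>E\<close> at \<open>\<epsilon>\<close> and at \<open>r \<epsilon>\<close>
  are identified through the map \<open>(p, \<xi>) \<mapsto> (p, r \<xi>)\<close> of \<open>E\<close>, whose derivative is \<open>(u, v) \<mapsto> (u, r v)\<close>. The entries used do
  not depend on the unknowns \<open>w, \<phi>1, \<phi>2, \<psi>\<close> of the matrix \<open>X\<close>.\<close>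

definition act_rel :: "line_pair \<Rightarrow> real^3^3 \<Rightarrow> ypoint \<Rightarrow> ypoint \<Rightarrow> bool" where
  "act_rel P h y y' \<longleftrightarrow> y' \<in> Y_bundle P \<and>
     (\<exists>r. fst y' = (fst (fst y), r *\<^sub>R snd (fst y)) \<and>
       (\<forall>u v w \<phi>1 \<phi>2 \<psi>. (u, v) \<in> tangent_space (E_bundle P) (fst y) \<longrightarrow>
         (let X = pi_shape (cof_\<omega> y (u, v)) (cof_\<omega>1 y (u, v)) (cof_\<omega>2 y (u, v)) (cof_\<phi> y (u, v)) w \<phi>1 \<phi>2 \<psi>;
              Z = matrix_inv h ** X ** h
          in cof_\<omega> y' (u, r *\<^sub>R v) = Z $ 3 $ 1 \<and>
             cof_\<omega>1 y' (u, r *\<^sub>R v) = Z $ 2 $ 1 \<and>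
             cof_\<omega>2 y' (u, r *\<^sub>R v) = Z $ 3 $ 2 \<and>
             cof_\<phi> y' (u, r *\<^sub>R v) = (Z $ 1 $ 1 - Z $ 3 $ 3) / 2)))"

definition act :: "line_pair \<Rightarrow> real^3^3 \<Rightarrow> ypoint \<Rightarrow> ypoint" where
  "act P h y = (THE y'. act_rel P h y y')"


section \<open>The Cartan connection\<close>

definition sl3 :: "(real^3^3) set" where
  "sl3 = {X. trace X = 0}"

text \<open>\<open>\<pi>\<close> is a Cartan connection on the principal bundle \<open>Y\<close> over \<open>T\<^sup>3\<close>, with values in \<open>sl3\<close>. In the
  third clause, \<open>c\<close> is a curve in \<open>B\<close> through the identity, so the clause says that \<open>\<pi>\<close> takes the value
  \<open>A\<close> on the fundamental vector field of \<open>A\<close>; the fourth says \<open>R\<^sub>h\<^sup>* \<pi> = h\<^sup>-\<^sup>1 \<pi> h\<close>. The last expresses that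
  \<open>\<pi>\<close> descends to the quotient by the lattice.\<close>

definition cartan_connection :: "line_pair \<Rightarrow> (ypoint \<Rightarrow> ypoint \<Rightarrow> real^3^3) \<Rightarrow> bool" where
  "cartan_connection P \<pi> \<longleftrightarrow>
     (\<exists>U. open U \<and> Y_bundle P \<subseteq> U \<and> smooth_form U \<pi>) \<and>
     (\<forall>y\<in>Y_bundle P. bij_betw (\<pi> y) (tangent_space (Y_bundle P) y) sl3) \<and>
     (\<forall>y\<in>Y_bundle P. \<forall>A c. curve_at borel_group (mat 1) A c \<longrightarrow>
        \<pi> y (vector_derivative (\<lambda>t. act P (c t) y) (at 0)) = A) \<and>
     (\<forall>h\<in>borel_group. \<forall>y v \<gamma>. curve_at (Y_bundle P) y v \<gamma> \<longrightarrow>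
        \<pi> (act P h y) (vector_derivative (\<lambda>t. act P h (\<gamma> t)) (at 0)) = matrix_inv h ** \<pi> y v ** h) \<and>
     (\<forall>k\<in>lattice. \<forall>y\<in>Y_bundle P. \<forall>v\<in>tangent_space (Y_bundle P) y. \<pi> (Y_translate k y) v = \<pi> y v)"

definition curvature :: "(ypoint \<Rightarrow> ypoint \<Rightarrow> real^3^3) \<Rightarrow> ypoint \<Rightarrow> ypoint \<Rightarrow> ypoint \<Rightarrow> real^3^3" where
  "curvature \<pi> y u v = ext_d \<pi> y u v + mwedge (\<pi> y) (\<pi> y) u v"

text \<open>The Cartan connection of the path structure. The tautological forms of \<open>Y\<close> at \<open>y\<close> are the members
  of the coframe \<open>y\<close> composed with the derivative \<open>fst\<close> of the projection \<open>fst\<close> from \<open>Y\<close> to \<open>E\<close>.\<close>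

definition normal_cartan_connection :: "line_pair \<Rightarrow> (ypoint \<Rightarrow> ypoint \<Rightarrow> real^3^3) \<Rightarrow> bool" where
  "normal_cartan_connection P \<pi> \<longleftrightarrow> cartan_connection P \<pi> \<and>
     (\<forall>y\<in>Y_bundle P. \<forall>v\<in>tangent_space (Y_bundle P) y. \<exists>w \<phi>1 \<phi>2 \<psi>.
        \<pi> y v = pi_shape (cof_\<omega> y (fst v)) (cof_\<omega>1 y (fst v)) (cof_\<omega>2 y (fst v)) (cof_\<phi> y (fst v)) w \<phi>1 \<phi>2 \<psi>) \<and>
     (\<exists>Q1 Q2 U1 U2 :: ypoint \<Rightarrow> real. \<forall>y\<in>Y_bundle P.
        \<forall>u\<in>tangent_space (Y_bundle P) y. \<forall>v\<in>tangent_space (Y_bundle P) y.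
        (let \<omega> = (\<lambda>v. cof_\<omega> y (fst v)); \<omega>1 = (\<lambda>v. cof_\<omega>1 y (fst v)); \<omega>2 = (\<lambda>v. cof_\<omega>2 y (fst v))
         in curvature \<pi> y u v =
              vector [vector [0, Q2 y * wedge \<omega> \<omega>1 u v,
                              wedge (\<lambda>v. U1 y * \<omega>1 v + U2 y * \<omega>2 v) \<omega> u v],
                      vector [0, 0, Q1 y * wedge \<omega> \<omega>2 u v],
                      vector [0, 0, 0]]))"


section \<open>The global invariant\<close>

definition global_section :: "line_pair \<Rightarrow> (real^3 \<Rightarrow> ypoint) \<Rightarrow> bool" where
  "global_section P s \<longleftrightarrow> smooth_on UNIV s \<and>
     (\<forall>p. s p \<in> Y_bundle P \<and> fst (fst (s p)) = p) \<and>
     (\<forall>p. \<forall>k\<in>lattice. s (p + k) = Y_translate k (s p))"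

definition pullback :: "('a::euclidean_space \<Rightarrow> 'b::euclidean_space) \<Rightarrow> ('b \<Rightarrow> 'b \<Rightarrow> 'c) \<Rightarrow> 'a \<Rightarrow> 'a \<Rightarrow> 'c" where
  "pullback s \<alpha> p u = \<alpha> (s p) (frechet_derivative s (at p) u)"

text \<open>As \<open>TC\<^sub>2\<close> commutes with pullback, it is applied to the pulled back connection.\<close>

definition TC2 :: "('a \<Rightarrow> 'a \<Rightarrow> real^3^3) \<Rightarrow> 'a \<Rightarrow> 'a \<Rightarrow> 'a \<Rightarrow> 'a \<Rightarrow> real" where
  "TC2 \<alpha> p u v w = 1 / (24 * pi\<^sup>2) * trace (mwedge21 (mwedge (\<alpha> p) (\<alpha> p)) (\<alpha> p) u v w)"

text \<open>The integral of a 3-form over \<open>T\<^sup>3\<close>, oriented by \<open>dx \<and> dy \<and> dt\<close>, through the fundamental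
  domain \<open>[0, 1]\<^sup>3\<close>.\<close>

definition torus_integral :: "(real^3 \<Rightarrow> real^3 \<Rightarrow> real^3 \<Rightarrow> real^3 \<Rightarrow> real) \<Rightarrow> real" where
  "torus_integral \<Omega> = integral (cbox 0 1) (\<lambda>p. \<Omega> p (axis 1 1) (axis 2 1) (axis 3 1))"

text \<open>For a path structure \<open>P\<close> the description is proper: the normal Cartan connection exists and is unique (as a form
  on \<open>Y\<close>) and the integral does not depend on the section or on the representative of the connection.\<close>

definition global_invariant :: "line_pair \<Rightarrow> real" where
  "global_invariant P = (THE \<mu>. \<exists>\<pi> s. normal_cartan_connection P \<pi> \<and> global_section P s \<and>
     \<mu> = torus_integral (TC2 (pullback s \<pi>)))"

end

(* The coframe theta, theta'1, theta'2 has constant structure coefficients, so the structure equations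
   are solved by an sl(3)-valued 1-form A on the torus which is constant in this coframe. Y is trivial,
   Y = T^3 x B with projection k to B, and pi = k^-1 A k + k^-1 dk is a normal Cartan connection.
   Conversely let pi' be any normal Cartan connection and s any section, and put g = k o s. The form
   g (s^* pi') g^-1 - dg g^-1 has the same entries below the diagonal as A, and the normalization of its
   curvature forces it to equal A. Hence s^* pi' is a gauge transform of A by a map into the Borel group.
   Such a transformation changes tr(A^3) by an exact form, so by Stokes mu is the integral of TC2(A),
   whose integrand is constant. *)

theory Submission
  imports Defs
begin

section \<open>Smooth maps\<close>

text \<open>Origin of the constants in \<open>A\<close>: write x, y, z for the adapted coframe, so
  that dx = y \<and> z, dy = b x \<and> (f y - b z), dz = f x \<and> (f y - b z). With \<phi> = 0
  and w = k x, the vanishing of the entries (2,1) and (3,2) of the curvature gives \<phi>1 = (bf -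
  3k) y - b^2 z and \<phi>2 = (bf - 3k) z - f^2 y; entry (2,2) then forces k = bf/4, and removing x
  \<and> z from entry (1,2) takes \<psi> = -(3/4 + 3/16) b^2 f^2 x. The trivialization is explicit
  because the quotient of the scale factors of \<omega>2 and \<omega>1 is the cube of the middle
  diagonal entry of k, and the real cube root is smooth on nonzero reals of either sign. Tangent
  vectors of E and Y are given only as velocities of curves. Every property of the connection on Y
  is therefore read off from curves written in the trivialization, and uniqueness is argued after
  pulling back to the torus, where it becomes linear algebra with three constant matrices. The
  definite descriptions in \<open>act\<close> and \<open>global_invariant\<close> each call for a
  uniqueness proof of their own.\<close>

lemma frechet_derivative_eqI:
  "(f has_derivative f') (at x) \<Longrightarrow> frechet_derivative f (at x) v = f' v"
  using frechet_derivative_at by metis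

text \<open>\<open>Ck_on\<close> uses the unrestricted derivative \<open>at x\<close>, so agreement
  on \<open>S\<close> passes to derivatives because \<open>S\<close> is open.\<close>

lemma Ck_on_cong:
  assumes "open S" and "\<And>x. x \<in> S \<Longrightarrow> f x = g x"
  shows "Ck_on k S f \<longleftrightarrow> Ck_on k S g"
  using assms(2)
proof (induction k arbitrary: f g)
  case 0
  then show ?case by simp
next
  case (Suc k)
  have tr: "(\<phi>' has_derivative D) (at x)"
    if "(\<phi> has_derivative D) (at x)" "x \<in> S" "\<And>x. x \<in> S \<Longrightarrow> \<phi> x = \<phi>' x" for \<phi> \<phi>' :: "'a \<Rightarrow> 'b" and D x
    using that(1) assms(1) that(2,3) by (rule has_derivative_transform_within_open)
  have iff: "(f has_derivative D) (at x) \<longleftrightarrow> (g has_derivative D) (at x)" if "x \<in> S" for D x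
    using tr[of f D x g] tr[of g D x f] that Suc.prems by auto
  have fd: "frechet_derivative f (at x) = frechet_derivative g (at x)" if "x \<in> S" for x
    unfolding frechet_derivative_def using iff[OF that] by simp
  have "f differentiable_on S \<longleftrightarrow> g differentiable_on S"
    by (simp add: differentiable_on_eq_differentiable_at[OF assms(1)] differentiable_def iff)
  moreover have "Ck_on k S (\<lambda>x. frechet_derivative f (at x) v) \<longleftrightarrow> Ck_on k S (\<lambda>x. frechet_derivative g (at x) v)" for v
    by (rule Suc.IH) (simp add: fd)
  ultimately show ?case by auto
qed

text \<open>Trades the choice operator in \<open>frechet_derivative\<close> for any known derivative
  \<open>f'\<close>; the inductive closure rules go through it.\<close>

lemma Ck_on_SucI:
  assumes "open S" and "\<And>x. x \<in> S \<Longrightarrow> (f has_derivative f' x) (at x)"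
    and "\<And>v. Ck_on k S (\<lambda>x. f' x v)"
  shows "Ck_on (Suc k) S f"
proof -
  have "frechet_derivative f (at x) = f' x" if "x \<in> S" for x
    using assms(2)[OF that] frechet_derivative_at by metis
  then have "Ck_on k S (\<lambda>x. frechet_derivative f (at x) v)" for v
    using Ck_on_cong[OF assms(1), of "\<lambda>x. frechet_derivative f (at x) v" "\<lambda>x. f' x v"] assms(3) by simp
  moreover have "f differentiable_on S"
    unfolding differentiable_on_eq_differentiable_at[OF assms(1)] using assms(2) differentiableI by blast
  ultimately show ?thesis by simp
qed

lemma Ck_on_SucD:
  assumes "open S" and "Ck_on (Suc k) S f" and "x \<in> S"
  shows "(f has_derivative frechet_derivative f (at x)) (at x)"
  using assms(2,3) differentiable_on_eq_differentiable_at[OF assms(1), of f]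
  by (simp add: frechet_derivative_works)

lemma Ck_on_mono: "Ck_on (Suc k) S f \<Longrightarrow> Ck_on k S f"
  by (induction k arbitrary: f) (auto intro: differentiable_imp_continuous_on)

lemma Ck_on_const: "Ck_on k S (\<lambda>x. c)"
  by (induction k arbitrary: c) auto

lemma Ck_on_linear_compose:
  assumes "open S" "bounded_linear L" "Ck_on k S f"
  shows "Ck_on k S (\<lambda>x. L (f x))"
  using assms(3)
proof (induction k arbitrary: f)
  case 0
  then show ?case using assms(2) by (simp add: bounded_linear.continuous_on)
next
  case (Suc k)
  show ?case
  proof (rule Ck_on_SucI[OF assms(1)])
    fix x assume "x \<in> S"
    show "((\<lambda>x. L (f x)) has_derivative (\<lambda>v. L (frechet_derivative f (at x) v))) (at x)"
      by (rule bounded_linear.has_derivative[OF assms(2) Ck_on_SucD[OF assms(1) Suc.prems \<open>x \<in> S\<close>]])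
  qed (use Suc in auto)
qed

lemma Ck_on_add:
  assumes "open S" "Ck_on k S f" "Ck_on k S g"
  shows "Ck_on k S (\<lambda>x. f x + g x)"
  using assms(2,3)
proof (induction k arbitrary: f g)
  case 0
  then show ?case by (simp add: continuous_on_add)
next
  case (Suc k)
  show ?case
    by (rule Ck_on_SucI[OF assms(1) has_derivative_add[OF Ck_on_SucD Ck_on_SucD]])
      (use assms(1) Suc in auto)
qed

lemma Ck_on_bilinear:
  assumes "open S" "bounded_bilinear B" "Ck_on k S f" "Ck_on k S g"
  shows "Ck_on k S (\<lambda>x. B (f x) (g x))"
  using assms(3,4)
proof (induction k arbitrary: f g)
  case 0
  then show ?case using bounded_bilinear.continuous_on[OF assms(2)] by simp
next
  case (Suc k)
  show ?case
  proof (rule Ck_on_SucI[OF assms(1)])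
    fix x assume "x \<in> S"
    show "((\<lambda>x. B (f x) (g x)) has_derivative
      (\<lambda>v. B (f x) (frechet_derivative g (at x) v) + B (frechet_derivative f (at x) v) (g x))) (at x)"
      by (rule bounded_bilinear.FDERIV[OF assms(2)]) (use Ck_on_SucD assms(1) Suc.prems \<open>x \<in> S\<close> in blast)+
  next
    fix v
    show "Ck_on k S (\<lambda>x. B (f x) (frechet_derivative g (at x) v) + B (frechet_derivative f (at x) v) (g x))"
      by (intro Ck_on_add assms(1) Suc.IH) (use Suc.prems Ck_on_mono in auto)
  qed
qed

lemma Ck_on_sum:
  assumes "open S" "\<And>i. i \<in> I \<Longrightarrow> Ck_on k S (f i)"
  shows "Ck_on k S (\<lambda>x. \<Sum>i\<in>I. f i x)"
  using assms(2) by (induction I rule: infinite_finite_induct) (auto intro: Ck_on_const Ck_on_add assms(1))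

text \<open>In the chain rule the direction in which \<open>f\<close> is differentiated varies with
  \<open>x\<close>, while \<open>Ck_on\<close> speaks of fixed directions only. Expanding this
  direction in the basis gives a sum of products, to which the induction hypothesis for the partial
  derivatives of \<open>f\<close> applies.\<close>

lemma Ck_on_compose:
  fixes g :: "'a::euclidean_space \<Rightarrow> 'b::euclidean_space" and f :: "'b \<Rightarrow> 'c::real_normed_vector"
  assumes "open S" "open T" "g ` S \<subseteq> T" "Ck_on k T f" "Ck_on k S g"
  shows "Ck_on k S (\<lambda>x. f (g x))"
  using assms(4,5)
proof (induction k arbitrary: f)
  case 0
  then show ?case using assms(3) by (auto intro: continuous_on_compose2)
next
  case (Suc k)
  let ?f' = "\<lambda>y v. frechet_derivative f (at y) v" and ?g' = "\<lambda>x v. frechet_derivative g (at x) v"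
  have df: "(f has_derivative ?f' (g x)) (at (g x))" if "x \<in> S" for x
    using Ck_on_SucD[OF assms(2) Suc.prems(1)] that assms(3) by blast
  show ?case
  proof (rule Ck_on_SucI[OF assms(1)])
    fix x assume "x \<in> S"
    have chain: "((\<lambda>x. f (g x)) has_derivative (\<lambda>v. ?f' (g x) (?g' x v))) (at x)"
      using diff_chain_at[OF Ck_on_SucD[OF assms(1) Suc.prems(2) \<open>x \<in> S\<close>] df[OF \<open>x \<in> S\<close>]]
      by (simp add: o_def)
    have rep: "?f' (g x) w = (\<Sum>i\<in>Basis. (w \<bullet> i) *\<^sub>R ?f' (g x) i)" for w
    proof -
      have "linear (?f' (g x))" using df[OF \<open>x \<in> S\<close>] has_derivative_linear by blast
      then have "?f' (g x) (\<Sum>i\<in>Basis. (w \<bullet> i) *\<^sub>R i) = (\<Sum>i\<in>Basis. (w \<bullet> i) *\<^sub>R ?f' (g x) i)"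
        by (simp add: linear_sum linear_scale)
      then show ?thesis by (simp add: euclidean_representation)
    qed
    show "((\<lambda>x. f (g x)) has_derivative (\<lambda>v. \<Sum>i\<in>Basis. (?g' x v \<bullet> i) *\<^sub>R ?f' (g x) i)) (at x)"
      using chain unfolding rep[of "?g' x _"] .
  next
    fix v
    show "Ck_on k S (\<lambda>x. \<Sum>i\<in>Basis. (?g' x v \<bullet> i) *\<^sub>R ?f' (g x) i)"
      using Suc.prems Ck_on_mono
      by (intro Ck_on_sum Ck_on_bilinear[OF assms(1) bounded_bilinear_scaleR]
        Ck_on_linear_compose[OF assms(1) bounded_linear_inner_left] assms(1) Suc.IH) auto
  qed
qed

section \<open>Closure rules for smooth maps\<close>

lemma smooth_on_cong:
  assumes "open S" and "\<And>x. x \<in> S \<Longrightarrow> f x = g x"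
  shows "smooth_on S f \<longleftrightarrow> smooth_on S g"
  using Ck_on_cong[OF assms] by (simp add: smooth_on_def)

lemma smooth_on_has_derivative:
  "open S \<Longrightarrow> smooth_on S f \<Longrightarrow> x \<in> S \<Longrightarrow> (f has_derivative frechet_derivative f (at x)) (at x)"
  using Ck_on_SucD smooth_on_def by metis

lemma smooth_on_differentiable:
  "open S \<Longrightarrow> smooth_on S f \<Longrightarrow> x \<in> S \<Longrightarrow> f differentiable (at x)"
  using smooth_on_has_derivative differentiable_def by blast

lemma smooth_on_frechet_derivative:
  "smooth_on S f \<Longrightarrow> smooth_on S (\<lambda>x. frechet_derivative f (at x) v)"
  unfolding smooth_on_def by (metis Ck_on.simps(2))

lemma smooth_on_continuous_on: "smooth_on S f \<Longrightarrow> continuous_on S f"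
  unfolding smooth_on_def by (metis Ck_on.simps(1))

text \<open>Bootstrapping: the derivative may involve \<open>f\<close> itself, as for \<open>exp\<close>, \<open>inverse\<close> and roots.\<close>

lemma smooth_on_derivative_rule:
  assumes "open S" "continuous_on S f" and "\<And>x. x \<in> S \<Longrightarrow> (f has_derivative f' x) (at x)"
    and "\<And>k v. Ck_on k S f \<Longrightarrow> Ck_on k S (\<lambda>x. f' x v)"
  shows "smooth_on S f"
  unfolding smooth_on_def
proof
  fix k show "Ck_on k S f"
    by (induction k) (use assms(2) Ck_on_SucI[OF assms(1,3,4)] in auto)
qed

lemma smooth_on_const: "smooth_on S (\<lambda>x. c)"
  by (simp add: smooth_on_def Ck_on_const)

lemma smooth_on_linear_compose:
  "open S \<Longrightarrow> bounded_linear L \<Longrightarrow> smooth_on S f \<Longrightarrow> smooth_on S (\<lambda>x. L (f x))"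
  by (simp add: smooth_on_def Ck_on_linear_compose)

lemma smooth_on_id: 
  assumes "open S" shows "smooth_on S (\<lambda>x. x)"
proof (rule smooth_on_derivative_rule[OF assms])
  show "((\<lambda>x. x) has_derivative (\<lambda>v. v)) (at x)" for x by simp
qed (auto simp: Ck_on_const)

lemma smooth_on_add: "open S \<Longrightarrow> smooth_on S f \<Longrightarrow> smooth_on S g \<Longrightarrow> smooth_on S (\<lambda>x. f x + g x)"
  by (simp add: smooth_on_def Ck_on_add)

lemma smooth_on_minus: "open S \<Longrightarrow> smooth_on S f \<Longrightarrow> smooth_on S (\<lambda>x. - f x)"
  by (rule smooth_on_linear_compose[OF _ bounded_linear_minus[OF bounded_linear_ident]])

lemma smooth_on_diff: "open S \<Longrightarrow> smooth_on S f \<Longrightarrow> smooth_on S g \<Longrightarrow> smooth_on S (\<lambda>x. f x - g x)"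
  using smooth_on_add[of S f "\<lambda>x. - g x"] smooth_on_minus[of S g] by simp

lemma smooth_on_bilinear:
  "bounded_bilinear B \<Longrightarrow> open S \<Longrightarrow> smooth_on S f \<Longrightarrow> smooth_on S g \<Longrightarrow> smooth_on S (\<lambda>x. B (f x) (g x))"
  by (simp add: smooth_on_def Ck_on_bilinear)

lemmas smooth_on_mult = smooth_on_bilinear[OF bounded_bilinear_mult]
lemmas smooth_on_scaleR = smooth_on_bilinear[OF bounded_bilinear_scaleR]
lemmas smooth_on_inner = smooth_on_bilinear[OF bounded_bilinear_inner]

lemma smooth_on_power:
  fixes f :: "'a::euclidean_space \<Rightarrow> real"
  shows "open S \<Longrightarrow> smooth_on S f \<Longrightarrow> smooth_on S (\<lambda>x. f x ^ m)"
  by (induction m) (simp_all add: smooth_on_const smooth_on_mult)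

lemma smooth_on_sum:
  "open S \<Longrightarrow> (\<And>i. i \<in> I \<Longrightarrow> smooth_on S (f i)) \<Longrightarrow> smooth_on S (\<lambda>x. \<Sum>i\<in>I. f i x)"
  by (simp add: smooth_on_def Ck_on_sum)

lemma smooth_on_compose:
  fixes g :: "'a::euclidean_space \<Rightarrow> 'b::euclidean_space"
  shows "open S \<Longrightarrow> open T \<Longrightarrow> smooth_on T f \<Longrightarrow> smooth_on S g \<Longrightarrow> g ` S \<subseteq> T \<Longrightarrow> smooth_on S (\<lambda>x. f (g x))"
  using Ck_on_compose unfolding smooth_on_def by metis

lemma smooth_on_subset:
  "open S \<Longrightarrow> open T \<Longrightarrow> smooth_on T f \<Longrightarrow> S \<subseteq> T \<Longrightarrow> smooth_on S f"
  using smooth_on_compose[of S T f "\<lambda>x. x"] smooth_on_id[of S] by auto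

lemma smooth_on_fst: "open S \<Longrightarrow> smooth_on S f \<Longrightarrow> smooth_on S (\<lambda>x. fst (f x))"
  by (rule smooth_on_linear_compose[OF _ bounded_linear_fst])

lemma smooth_on_snd: "open S \<Longrightarrow> smooth_on S f \<Longrightarrow> smooth_on S (\<lambda>x. snd (f x))"
  by (rule smooth_on_linear_compose[OF _ bounded_linear_snd])

lemma smooth_on_Pair:
  assumes "open S" "smooth_on S f" "smooth_on S g"
  shows "smooth_on S (\<lambda>x. (f x, g x))"
proof -
  have "smooth_on S (\<lambda>x. (f x, 0) + (0, g x))"
    by (intro smooth_on_add assms(1)
      smooth_on_linear_compose[OF _ bounded_linear_Pair[OF bounded_linear_ident bounded_linear_zero]]
      smooth_on_linear_compose[OF _ bounded_linear_Pair[OF bounded_linear_zero bounded_linear_ident]] assms(2,3))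
  then show ?thesis by simp
qed

lemma smooth_on_nth: "open S \<Longrightarrow> smooth_on S f \<Longrightarrow> smooth_on S (\<lambda>x. f x $ i)"
  by (rule smooth_on_linear_compose[OF _ bounded_linear_vec_nth])

lemma smooth_on_vec:
  fixes f :: "'a::euclidean_space \<Rightarrow> ('b::euclidean_space)^'n"
  assumes "open S" "\<And>i. smooth_on S (\<lambda>x. f x $ i)"
  shows "smooth_on S f"
proof -
  have bl: "bounded_linear (axis i :: 'b \<Rightarrow> 'b^'n)" for i
    by (auto intro!: linearI simp: linear_conv_bounded_linear[symmetric] vec_eq_iff axis_def)
  have "smooth_on S (\<lambda>x. \<Sum>i\<in>UNIV. axis i (f x $ i))"
    by (intro smooth_on_sum smooth_on_linear_compose[OF _ bl] assms)
  moreover have "(\<Sum>i\<in>UNIV. axis i (f x $ i)) = f x" for x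
    by (simp add: vec_eq_iff axis_def if_distrib cong: if_cong)
  ultimately show ?thesis by simp
qed

lemma open_nonzero [simp]: "open (- {0::real})"
  by (simp add: open_Compl)

lemma smooth_on_inverse:
  assumes "open S" "smooth_on S f" and "\<And>x. x \<in> S \<Longrightarrow> f x \<noteq> (0::real)"
  shows "smooth_on S (\<lambda>x. inverse (f x))"
proof (rule smooth_on_compose[of S "- {0}" inverse f])
  show "smooth_on (- {0::real}) inverse"
  proof (rule smooth_on_derivative_rule)
    show "(inverse has_derivative (\<lambda>v. - (v *\<^sub>R (inverse x * inverse x)))) (at x)" if "x \<in> - {0::real}" for x
      using has_derivative_inverse'[of x UNIV] that by (simp add: ac_simps)
    show "Ck_on k (- {0::real}) (\<lambda>x. - (v *\<^sub>R (inverse x * inverse x)))" if "Ck_on k (- {0::real}) inverse" for k v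
    proof -
      have "Ck_on k (- {0}) (\<lambda>x::real. inverse x * inverse x)"
        by (rule Ck_on_bilinear[OF _ bounded_bilinear_mult that that]) simp
      then show ?thesis
        by (intro Ck_on_linear_compose[OF _ bounded_linear_minus[OF bounded_linear_ident]]
          Ck_on_linear_compose[OF _ bounded_linear_scaleR_right]) auto
    qed
  qed (auto intro!: continuous_intros)
qed (use assms in auto)

lemma smooth_on_divide:
  fixes f g :: "'a::euclidean_space \<Rightarrow> real"
  shows "open S \<Longrightarrow> smooth_on S f \<Longrightarrow> smooth_on S g \<Longrightarrow> (\<And>x. x \<in> S \<Longrightarrow> g x \<noteq> 0) \<Longrightarrow> smooth_on S (\<lambda>x. f x / g x)"
  unfolding divide_inverse by (intro smooth_on_mult smooth_on_inverse)

lemma smooth_on_root3: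
  assumes "open S" "smooth_on S f" and "\<And>x. x \<in> S \<Longrightarrow> f x \<noteq> (0::real)"
  shows "smooth_on S (\<lambda>x. root 3 (f x))"
proof (rule smooth_on_compose[of S "- {0}" "root 3" f])
  show "smooth_on (- {0::real}) (root 3)"
  proof (rule smooth_on_derivative_rule)
    \<comment> \<open>Written with \<open>root 3 x / x\<close>, the derivative is a product of
      \<open>root 3\<close> itself and \<open>inverse\<close>, which suits the bootstrapping rule
      and holds for negative \<open>x\<close> as well.\<close>
    show "(root 3 has_derivative (\<lambda>v. v * (inverse 3 * (root 3 x / x)))) (at x)" if "x \<in> - {0::real}" for x
    proof -
      have "root 3 x ^ 3 = x" by (simp add: odd_real_root_pow)
      then have "inverse (3 * root 3 x ^ 2) = inverse 3 * (root 3 x / x)"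
        using that by (simp add: field_simps power2_eq_square power3_eq_cube)
      then have "(root 3 has_real_derivative inverse 3 * (root 3 x / x)) (at x)"
        using DERIV_odd_real_root[of 3 x] that by simp
      then show ?thesis
        unfolding has_field_derivative_def by (simp only: mult_commute_abs)
    qed
    show "Ck_on k (- {0}) (\<lambda>x. v * (inverse 3 * (root 3 x / x)))" if "Ck_on k (- {0::real}) (root 3)" for k v
    proof -
      have "Ck_on k (- {0}) (\<lambda>x::real. inverse x)"
        using smooth_on_inverse[of "- {0::real}" "\<lambda>x. x"] smooth_on_id[of "- {0::real}"]
        by (simp add: smooth_on_def)
      then show ?thesis
        unfolding divide_inverse using that by (intro
         Ck_on_linear_compose[OF _ bounded_linear_mult_right] Ck_on_bilinear[OF _ bounded_bilinear_mult]) auto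
    qed
  qed (auto intro!: continuous_intros)
qed (use assms in auto)

lemma smooth_on_exp:
  assumes "open S" "smooth_on S f"
  shows "smooth_on S (\<lambda>x. exp (f x :: real))"
proof (rule smooth_on_compose[of S UNIV exp f])
  show "smooth_on UNIV (exp :: real \<Rightarrow> real)"
    by (rule smooth_on_derivative_rule[where f' = "\<lambda>x v. v * exp x"])
      (auto intro!: continuous_intros derivative_eq_intros Ck_on_linear_compose[OF _ bounded_linear_mult_right])
qed (use assms in auto)

text \<open>Each function is, up to sign, the derivative of the other, so the induction on the order
  runs over both at once.\<close>

lemma smooth_on_sin_cos_UNIV: "smooth_on UNIV (sin :: real \<Rightarrow> real)" "smooth_on UNIV (cos :: real \<Rightarrow> real)"
proof -
  have "Ck_on k UNIV (sin :: real \<Rightarrow> real) \<and> Ck_on k UNIV (cos :: real \<Rightarrow> real)" for k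
  proof (induction k)
    case 0
    then show ?case by (simp add: continuous_intros)
  next
    case (Suc k)
    have "Ck_on (Suc k) UNIV (sin :: real \<Rightarrow> real)"
      by (rule Ck_on_SucI[where f' = "\<lambda>x v. v * cos x"])
        (use Suc in \<open>auto intro!: derivative_eq_intros Ck_on_linear_compose[OF _ bounded_linear_mult_right]\<close>)
    moreover have "Ck_on (Suc k) UNIV (cos :: real \<Rightarrow> real)"
      by (rule Ck_on_SucI[where f' = "\<lambda>x v. (- v) * sin x"], simp, force intro!: derivative_eq_intros,
        intro Ck_on_linear_compose[OF _ bounded_linear_mult_right]) (use Suc in auto)
    ultimately show ?case by blast
  qed
  then show "smooth_on UNIV (sin :: real \<Rightarrow> real)" "smooth_on UNIV (cos :: real \<Rightarrow> real)"
    by (auto simp: smooth_on_def)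
qed

lemma smooth_on_sin: "open S \<Longrightarrow> smooth_on S f \<Longrightarrow> smooth_on S (\<lambda>x. sin (f x :: real))"
  using smooth_on_compose[OF _ _ smooth_on_sin_cos_UNIV(1)] by simp

lemma smooth_on_cos: "open S \<Longrightarrow> smooth_on S f \<Longrightarrow> smooth_on S (\<lambda>x. cos (f x :: real))"
  using smooth_on_compose[OF _ _ smooth_on_sin_cos_UNIV(2)] by simp

lemma bounded_bilinear_matrix_matrix_mult:
  "bounded_bilinear ((**) :: real^'n^'m \<Rightarrow> real^'p^'n \<Rightarrow> real^'p^'m)"
  unfolding bilinear_conv_bounded_bilinear[symmetric] bilinear_def
  by (auto intro!: linearI simp: vec_eq_iff matrix_matrix_mult_def sum.distrib algebra_simps sum_distrib_left)

lemmas smooth_on_matrix_mult = smooth_on_bilinear[OF bounded_bilinear_matrix_matrix_mult]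

lemmas smooth_on_intros = smooth_on_const smooth_on_id smooth_on_add smooth_on_minus smooth_on_diff smooth_on_mult
  smooth_on_scaleR smooth_on_inner smooth_on_power smooth_on_fst smooth_on_snd smooth_on_Pair smooth_on_nth
  smooth_on_inverse smooth_on_divide smooth_on_root3 smooth_on_exp smooth_on_sin smooth_on_cos smooth_on_matrix_mult

section \<open>Exterior calculus\<close>

lemma frechet_derivative_linear:
  assumes "open S" "smooth_on S f" "x \<in> S"
  shows "linear (frechet_derivative f (at x))"
  using smooth_on_has_derivative[OF assms] has_derivative_linear by blast

lemma smooth_on_line_derivative:
  assumes "open S" "smooth_on S f" "x + t *\<^sub>R u \<in> S"
  shows "((\<lambda>t. f (x + t *\<^sub>R u)) has_vector_derivative frechet_derivative f (at (x + t *\<^sub>R u)) u) (at t)"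
proof -
  have "((\<lambda>t. x + t *\<^sub>R u) has_derivative (\<lambda>h. h *\<^sub>R u)) (at t)"
    by (auto intro!: derivative_eq_intros)
  from diff_chain_at[OF this smooth_on_has_derivative[OF assms]]
  have "((\<lambda>t. f (x + t *\<^sub>R u)) has_derivative (\<lambda>h. frechet_derivative f (at (x + t *\<^sub>R u)) (h *\<^sub>R u))) (at t)"
    by (simp add: o_def)
  then show ?thesis
    unfolding has_vector_derivative_def
    by (simp add: linear_scale[OF frechet_derivative_linear[OF assms]])
qed

text \<open>Two applications of the mean value theorem to the second difference of \<open>f\<close> along \<open>u\<close> and \<open>v\<close>.\<close>

lemma second_difference_mean_value:
  fixes f :: "'a::euclidean_space \<Rightarrow> real"
  assumes "open S" "smooth_on S f" "h > 0"
    and in_S: "\<And>s t. 0 \<le> s \<Longrightarrow> s \<le> h \<Longrightarrow> 0 \<le> t \<Longrightarrow> t \<le> h \<Longrightarrow> p + s *\<^sub>R u + t *\<^sub>R v \<in> S"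
  shows "\<exists>s t. 0 < s \<and> s < h \<and> 0 < t \<and> t < h \<and>
    f (p + h *\<^sub>R u + h *\<^sub>R v) - f (p + h *\<^sub>R u) - f (p + h *\<^sub>R v) + f p =
    h * h * frechet_derivative (\<lambda>x. frechet_derivative f (at x) u) (at (p + s *\<^sub>R u + t *\<^sub>R v)) v"
proof -
  let ?D = "\<lambda>x. frechet_derivative f (at x) u"
  define \<phi> where "\<phi> s = f ((p + h *\<^sub>R v) + s *\<^sub>R u) - f (p + s *\<^sub>R u)" for s
  have d\<phi>: "(\<phi> has_real_derivative ?D (p + h *\<^sub>R v + s *\<^sub>R u) - ?D (p + s *\<^sub>R u)) (at s)"
    if "0 \<le> s" "s \<le> h" for s
    unfolding \<phi>_def has_real_derivative_iff_has_vector_derivative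
    using in_S[of s h] in_S[of s 0] that \<open>h > 0\<close>
    by (intro has_vector_derivative_diff smooth_on_line_derivative[OF assms(1,2)]) (simp_all add: algebra_simps)
  then obtain s where s: "0 < s" "s < h"
    "\<phi> h - \<phi> 0 = (h - 0) * (?D (p + h *\<^sub>R v + s *\<^sub>R u) - ?D (p + s *\<^sub>R u))"
    using MVT2[OF \<open>h > 0\<close> d\<phi>] by blast
  define \<psi> where "\<psi> t = ?D ((p + s *\<^sub>R u) + t *\<^sub>R v)" for t
  have d\<psi>: "(\<psi> has_real_derivative frechet_derivative ?D (at ((p + s *\<^sub>R u) + t *\<^sub>R v)) v) (at t)"
    if "0 \<le> t" "t \<le> h" for t
    unfolding \<psi>_def has_real_derivative_iff_has_vector_derivative
    using in_S[of s t] that s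
    by (intro smooth_on_line_derivative[OF assms(1) smooth_on_frechet_derivative[OF assms(2)]]) auto
  then obtain t where t: "0 < t" "t < h"
    "\<psi> h - \<psi> 0 = (h - 0) * frechet_derivative ?D (at ((p + s *\<^sub>R u) + t *\<^sub>R v)) v"
    using MVT2[OF \<open>h > 0\<close> d\<psi>] by blast
  have "f (p + h *\<^sub>R u + h *\<^sub>R v) - f (p + h *\<^sub>R u) - f (p + h *\<^sub>R v) + f p = \<phi> h - \<phi> 0"
    by (simp add: \<phi>_def algebra_simps)
  also have "\<dots> = h * (\<psi> h - \<psi> 0)"
    by (simp add: s(3) \<psi>_def algebra_simps)
  also have "\<dots> = h * h * frechet_derivative ?D (at (p + s *\<^sub>R u + t *\<^sub>R v)) v"
    by (simp add: t(3))
  finally show ?thesis using s(1,2) t(1,2) by blast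
qed

text \<open>The second difference of \<open>f\<close> over a small parallelogram is symmetric in
  \<open>u\<close> and \<open>v\<close>. Its mean value form in the two orders equates the two mixed
  derivatives at two points near \<open>p\<close>, and their continuity moves both points to
  \<open>p\<close>.\<close>

lemma symmetric_second_derivative_real:
  fixes f :: "'a::euclidean_space \<Rightarrow> real"
  assumes "open S" "smooth_on S f" "p \<in> S"
  shows "frechet_derivative (\<lambda>x. frechet_derivative f (at x) u) (at p) v =
    frechet_derivative (\<lambda>x. frechet_derivative f (at x) v) (at p) u"
proof -
  define A where "A x = frechet_derivative (\<lambda>x. frechet_derivative f (at x) u) (at x) v" for x
  define B where "B x = frechet_derivative (\<lambda>x. frechet_derivative f (at x) v) (at x) u" for x
  have cont: "continuous_on S A" "continuous_on S B"
    unfolding A_def B_def by (intro smooth_on_continuous_on smooth_on_frechet_derivative assms(2))+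
  have "\<bar>A p - B p\<bar> \<le> e" if "e > 0" for e
  proof -
    obtain dA where dA: "dA > 0" "\<And>x. x \<in> S \<Longrightarrow> dist x p < dA \<Longrightarrow> dist (A x) (A p) < e / 2"
      using cont(1) assms(3) \<open>e > 0\<close> unfolding continuous_on_iff by (metis half_gt_zero)
    obtain dB where dB: "dB > 0" "\<And>x. x \<in> S \<Longrightarrow> dist x p < dB \<Longrightarrow> dist (B x) (B p) < e / 2"
      using cont(2) assms(3) \<open>e > 0\<close> unfolding continuous_on_iff by (metis half_gt_zero)
    obtain r where r: "r > 0" "ball p r \<subseteq> S"
      using assms(1,3) open_contains_ball by blast
    define d where "d = min (min dA dB) r"
    define m where "m = norm u + norm v + 1"
    have "m > 0" unfolding m_def using norm_ge_zero[of u] norm_ge_zero[of v] by linarith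
    \<comment> \<open>With this size the whole parallelogram stays within \<open>d / 2\<close> of
      \<open>p\<close>, hence in \<open>S\<close> and in both continuity neighbourhoods.\<close>
    define h where "h = d / (2 * m)"
    have "d > 0" using dA dB r by (simp add: d_def)
    then have "h > 0" using \<open>m > 0\<close> by (simp add: h_def)
    have close: "dist (p + s *\<^sub>R u + t *\<^sub>R v) p < d" if "0 \<le> s" "s \<le> h" "0 \<le> t" "t \<le> h" for s t
    proof -
      have "dist (p + s *\<^sub>R u + t *\<^sub>R v) p \<le> s * norm u + t * norm v"
        using norm_triangle_ineq[of "s *\<^sub>R u" "t *\<^sub>R v"] that by (simp add: dist_norm add.assoc)
      also have "\<dots> \<le> h * norm u + h * norm v"
        using that by (intro add_mono mult_right_mono) auto
      also have "\<dots> \<le> h * m" using \<open>h > 0\<close> by (simp add: m_def algebra_simps)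
      also have "\<dots> = d / 2" using \<open>m > 0\<close> by (simp add: h_def)
      also have "\<dots> < d" using \<open>d > 0\<close> by simp
      finally show ?thesis .
    qed
    then have in_S: "p + s *\<^sub>R u + t *\<^sub>R v \<in> S" "p + s *\<^sub>R v + t *\<^sub>R u \<in> S"
      if "0 \<le> s" "s \<le> h" "0 \<le> t" "t \<le> h" for s t
      using close[of s t] close[of t s] that r(2)
      by (auto simp: d_def dist_commute subset_iff algebra_simps)
    obtain s t where st: "0 < s" "s < h" "0 < t" "t < h"
      "f (p + h *\<^sub>R u + h *\<^sub>R v) - f (p + h *\<^sub>R u) - f (p + h *\<^sub>R v) + f p = h * h * A (p + s *\<^sub>R u + t *\<^sub>R v)"
      using second_difference_mean_value[OF assms(1,2) \<open>h > 0\<close> in_S(1)] unfolding A_def by blast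
    obtain s' t' where st': "0 < s'" "s' < h" "0 < t'" "t' < h"
      "f (p + h *\<^sub>R v + h *\<^sub>R u) - f (p + h *\<^sub>R v) - f (p + h *\<^sub>R u) + f p = h * h * B (p + s' *\<^sub>R v + t' *\<^sub>R u)"
      using second_difference_mean_value[OF assms(1,2) \<open>h > 0\<close> in_S(2)] unfolding B_def by blast
    have comm: "p + h *\<^sub>R v + h *\<^sub>R u = p + h *\<^sub>R u + h *\<^sub>R v" "p + s' *\<^sub>R v + t' *\<^sub>R u = p + t' *\<^sub>R u + s' *\<^sub>R v"
      by (simp_all add: algebra_simps)
    have "h * h * A (p + s *\<^sub>R u + t *\<^sub>R v) = h * h * B (p + t' *\<^sub>R u + s' *\<^sub>R v)"
      using st(5) st'(5) unfolding comm by linarith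
    then have "A (p + s *\<^sub>R u + t *\<^sub>R v) = B (p + t' *\<^sub>R u + s' *\<^sub>R v)" using \<open>h > 0\<close> by simp
    moreover have "dist (A (p + s *\<^sub>R u + t *\<^sub>R v)) (A p) < e / 2"
      using st close[of s t] in_S(1)[of s t] by (intro dA) (auto simp: d_def)
    moreover have "dist (B (p + t' *\<^sub>R u + s' *\<^sub>R v)) (B p) < e / 2"
      using st' close[of t' s'] in_S(1)[of t' s'] by (intro dB) (auto simp: d_def)
    ultimately show ?thesis unfolding dist_real_def by linarith
  qed
  then have "A p = B p" using field_le_epsilon[of "\<bar>A p - B p\<bar>" 0] by simp
  then show ?thesis by (simp add: A_def B_def)
qed

lemma frechet_derivative_bounded_linear:
  assumes "open S" "smooth_on S f" "x \<in> S" "bounded_linear L"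
  shows "frechet_derivative (\<lambda>x. L (f x)) (at x) u = L (frechet_derivative f (at x) u)"
  by (rule frechet_derivative_eqI[OF bounded_linear.has_derivative[OF assms(4) smooth_on_has_derivative[OF assms(1-3)]]])

lemma symmetric_second_derivative:
  fixes f :: "'a::euclidean_space \<Rightarrow> 'b::euclidean_space"
  assumes "open S" "smooth_on S f" "p \<in> S"
  shows "frechet_derivative (\<lambda>x. frechet_derivative f (at x) u) (at p) v =
    frechet_derivative (\<lambda>x. frechet_derivative f (at x) v) (at p) u"
proof (rule euclidean_eqI)
  fix b :: 'b
  have bl: "bounded_linear (\<lambda>y. y \<bullet> b)" by (rule bounded_linear_inner_left)
  have "frechet_derivative (\<lambda>x. frechet_derivative (\<lambda>x. f x \<bullet> b) (at x) u) (at p) v =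
      frechet_derivative (\<lambda>x. frechet_derivative f (at x) u) (at p) v \<bullet> b" for u v
  proof -
    have "((\<lambda>x. frechet_derivative f (at x) u \<bullet> b) has_derivative
        (\<lambda>v. frechet_derivative (\<lambda>x. frechet_derivative f (at x) u) (at p) v \<bullet> b)) (at p)"
      by (rule bounded_linear.has_derivative[OF bl smooth_on_has_derivative[OF assms(1) smooth_on_frechet_derivative[OF assms(2)] assms(3)]])
    then have "((\<lambda>x. frechet_derivative (\<lambda>x. f x \<bullet> b) (at x) u) has_derivative
        (\<lambda>v. frechet_derivative (\<lambda>x. frechet_derivative f (at x) u) (at p) v \<bullet> b)) (at p)"
      by (rule has_derivative_transform_within_open[OF _ assms(1,3)])
        (simp add: frechet_derivative_bounded_linear[OF assms(1,2) _ bl])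
    then show ?thesis by (rule frechet_derivative_eqI)
  qed
  moreover have "smooth_on S (\<lambda>x. f x \<bullet> b)"
    by (rule smooth_on_linear_compose[OF assms(1) bl assms(2)])
  ultimately show "frechet_derivative (\<lambda>x. frechet_derivative f (at x) u) (at p) v \<bullet> b =
      frechet_derivative (\<lambda>x. frechet_derivative f (at x) v) (at p) u \<bullet> b"
    using symmetric_second_derivative_real[OF assms(1) _ assms(3)] by metis
qed

section \<open>Pullback and exterior derivative of 1-forms\<close>

lemma smooth_form_linear: "smooth_form S \<alpha> \<Longrightarrow> x \<in> S \<Longrightarrow> linear (\<alpha> x)"
  by (simp add: smooth_form_def)

lemma smooth_form_smooth_on: "smooth_form S \<alpha> \<Longrightarrow> smooth_on S (\<lambda>x. \<alpha> x v)"
  by (simp add: smooth_form_def)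

lemma linear_basis_expansion:
  fixes L :: "'a::euclidean_space \<Rightarrow> 'b::real_vector"
  assumes "linear L"
  shows "L v = (\<Sum>i\<in>Basis. (v \<bullet> i) *\<^sub>R L i)"
proof -
  have "L (\<Sum>i\<in>Basis. (v \<bullet> i) *\<^sub>R i) = (\<Sum>i\<in>Basis. (v \<bullet> i) *\<^sub>R L i)"
    using assms by (simp add: linear_sum linear_scale)
  then show ?thesis by (simp add: euclidean_representation)
qed

text \<open>\<open>smooth_form\<close> controls a form on constant vectors only. The product rule
  for a moving argument comes from expanding that argument in the basis.\<close>

lemma smooth_form_apply_has_derivative:
  fixes \<alpha> :: "'b::euclidean_space \<Rightarrow> 'b \<Rightarrow> 'c::real_normed_vector"
    and f w :: "'a::euclidean_space \<Rightarrow> 'b"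
  assumes "open T" "smooth_form T \<alpha>" "f x \<in> T"
    and "(f has_derivative f') (at x)" "(w has_derivative w') (at x)"
    and "eventually (\<lambda>y. f y \<in> T) (nhds x)"
  shows "((\<lambda>y. \<alpha> (f y) (w y)) has_derivative
    (\<lambda>u. frechet_derivative (\<lambda>y. \<alpha> y (w x)) (at (f x)) (f' u) + \<alpha> (f x) (w' u))) (at x)"
proof -
  let ?D = "\<lambda>i. frechet_derivative (\<lambda>y. \<alpha> y i) (at (f x))"
  have D: "((\<lambda>y. \<alpha> y i) has_derivative ?D i) (at (f x))" for i
    by (rule smooth_on_has_derivative[OF assms(1) smooth_form_smooth_on[OF assms(2)] assms(3)])
  have comp: "((\<lambda>y. \<alpha> (f y) i) has_derivative (\<lambda>u. ?D i (f' u))) (at x)" for i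
    using diff_chain_at[OF assms(4) D] by (simp add: o_def)
  have sum: "((\<lambda>y. \<Sum>i\<in>Basis. (w y \<bullet> i) *\<^sub>R \<alpha> (f y) i) has_derivative
      (\<lambda>u. \<Sum>i\<in>Basis. (w x \<bullet> i) *\<^sub>R ?D i (f' u) + (w' u \<bullet> i) *\<^sub>R \<alpha> (f x) i)) (at x)"
    by (intro has_derivative_sum has_derivative_scaleR comp has_derivative_inner_left assms(5))
  have D_w: "?D (w x) z = (\<Sum>i\<in>Basis. (w x \<bullet> i) *\<^sub>R ?D i z)" for z
  proof -
    have "((\<lambda>y. \<Sum>i\<in>Basis. (w x \<bullet> i) *\<^sub>R \<alpha> y i) has_derivative (\<lambda>z. \<Sum>i\<in>Basis. (w x \<bullet> i) *\<^sub>R ?D i z)) (at (f x))"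
      by (intro has_derivative_sum has_derivative_scaleR_right D)
    then have "((\<lambda>y. \<alpha> y (w x)) has_derivative (\<lambda>z. \<Sum>i\<in>Basis. (w x \<bullet> i) *\<^sub>R ?D i z)) (at (f x))"
      by (rule has_derivative_transform_within_open[OF _ assms(1,3)])
        (rule linear_basis_expansion[OF smooth_form_linear[OF assms(2)], symmetric])
    then show ?thesis by (rule frechet_derivative_eqI)
  qed
  obtain S where S: "open S" "x \<in> S" "\<And>y. y \<in> S \<Longrightarrow> f y \<in> T"
    using assms(6) unfolding eventually_nhds by blast
  have "((\<lambda>y. \<alpha> (f y) (w y)) has_derivative
      (\<lambda>u. \<Sum>i\<in>Basis. (w x \<bullet> i) *\<^sub>R ?D i (f' u) + (w' u \<bullet> i) *\<^sub>R \<alpha> (f x) i)) (at x)"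
    by (rule has_derivative_transform_within_open[OF sum S(1,2)])
      (rule linear_basis_expansion[OF smooth_form_linear[OF assms(2)], symmetric], rule S(3))
  moreover have "(\<Sum>i\<in>Basis. (w x \<bullet> i) *\<^sub>R ?D i z + (z' \<bullet> i) *\<^sub>R \<alpha> (f x) i) = ?D (w x) z + \<alpha> (f x) z'" for z z'
    unfolding D_w sum.distrib linear_basis_expansion[OF smooth_form_linear[OF assms(2,3)], of z'] ..
  ultimately show ?thesis by simp
qed

lemma has_derivative_pullback:
  fixes f :: "'a::euclidean_space \<Rightarrow> 'b::euclidean_space"
  assumes "open S" "smooth_on S f" "open T" "smooth_form T \<alpha>" "f ` S \<subseteq> T" "x \<in> S"
  shows "((\<lambda>y. pullback f \<alpha> y v) has_derivative
    (\<lambda>u. frechet_derivative (\<lambda>y. \<alpha> y (frechet_derivative f (at x) v)) (at (f x)) (frechet_derivative f (at x) u)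
      + \<alpha> (f x) (frechet_derivative (\<lambda>y. frechet_derivative f (at y) v) (at x) u))) (at x)"
  unfolding pullback_def
proof (rule smooth_form_apply_has_derivative[OF assms(3,4)])
  show "eventually (\<lambda>y. f y \<in> T) (nhds x)"
    using assms(1,5,6) unfolding eventually_nhds by blast
qed (use assms smooth_on_has_derivative smooth_on_frechet_derivative in blast)+

text \<open>Differentiating a pullback also produces a term with the second derivative of
  \<open>f\<close>; being symmetric in \<open>u\<close> and \<open>v\<close>, it cancels in the
  alternation.\<close>

lemma ext_d_pullback:
  fixes f :: "'a::euclidean_space \<Rightarrow> 'b::euclidean_space"
  assumes "open S" "smooth_on S f" "open T" "smooth_form T \<alpha>" "f ` S \<subseteq> T" "x \<in> S"
  shows "ext_d (pullback f \<alpha>) x u v = ext_d \<alpha> (f x) (frechet_derivative f (at x) u) (frechet_derivative f (at x) v)"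
proof -
  note * = frechet_derivative_at[OF has_derivative_pullback[OF assms], symmetric]
  show ?thesis
    unfolding ext_d_def * symmetric_second_derivative[OF assms(1,2,6), of u v] by simp
qed

lemma smooth_form_pullback:
  fixes f :: "'a::euclidean_space \<Rightarrow> 'b::euclidean_space" and \<alpha> :: "'b \<Rightarrow> 'b \<Rightarrow> 'c::euclidean_space"
  assumes "open S" "smooth_on S f" "open T" "smooth_form T \<alpha>" "f ` S \<subseteq> T"
  shows "smooth_form S (pullback f \<alpha>)"
  unfolding smooth_form_def
proof (intro conjI ballI allI)
  fix x assume x: "x \<in> S"
  have "linear (\<alpha> (f x) \<circ> frechet_derivative f (at x))"
    using smooth_form_linear[OF assms(4)] frechet_derivative_linear[OF assms(1,2) x] assms(5) x
    by (intro linear_compose) auto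
  moreover have "pullback f \<alpha> x = \<alpha> (f x) \<circ> frechet_derivative f (at x)"
    by (rule ext) (simp add: pullback_def)
  ultimately show "linear (pullback f \<alpha> x)" by simp
next
  fix v
  have "pullback f \<alpha> x v = (\<Sum>i\<in>Basis. (frechet_derivative f (at x) v \<bullet> i) *\<^sub>R \<alpha> (f x) i)" if "x \<in> S" for x
    using linear_basis_expansion[OF smooth_form_linear[OF assms(4)]] assms(5) that by (auto simp: pullback_def)
  then have "smooth_on S (\<lambda>x. pullback f \<alpha> x v) =
      smooth_on S (\<lambda>x. \<Sum>i\<in>Basis. (frechet_derivative f (at x) v \<bullet> i) *\<^sub>R \<alpha> (f x) i)"
    by (intro smooth_on_cong assms(1))
  moreover have "smooth_on S (\<lambda>x. \<Sum>i\<in>Basis. (frechet_derivative f (at x) v \<bullet> i) *\<^sub>R \<alpha> (f x) i)"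
    by (intro smooth_on_sum smooth_on_scaleR smooth_on_inner smooth_on_const assms(1,2)
      smooth_on_frechet_derivative smooth_on_compose[OF assms(1,3) smooth_form_smooth_on[OF assms(4)] assms(2,5)])
  ultimately show "smooth_on S (\<lambda>x. pullback f \<alpha> x v)" by simp
qed

text \<open>The expression of \<open>curvature\<close> on an arbitrary Euclidean space, so that it
  applies to forms on the torus as well as on Y.\<close>

definition curv :: "('a::euclidean_space \<Rightarrow> 'a \<Rightarrow> real^3^3) \<Rightarrow> 'a \<Rightarrow> 'a \<Rightarrow> 'a \<Rightarrow> real^3^3" where
  "curv \<alpha> x u v = ext_d \<alpha> x u v + mwedge (\<alpha> x) (\<alpha> x) u v"

lemma curv_pullback:
  fixes f :: "'a::euclidean_space \<Rightarrow> 'b::euclidean_space"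
  assumes "open S" "smooth_on S f" "open T" "smooth_form T \<alpha>" "f ` S \<subseteq> T" "x \<in> S"
  shows "curv (pullback f \<alpha>) x u v = curv \<alpha> (f x) (frechet_derivative f (at x) u) (frechet_derivative f (at x) v)"
  unfolding curv_def ext_d_pullback[OF assms] by (simp add: mwedge_def pullback_def)

lemma matrix_diff_distrib: "(A :: real^'n^'m) ** (B - C) = A ** B - A ** C" "(D - E) ** (F :: real^'k^'n) = (D :: real^'n^'m) ** F - E ** F"
  by (simp_all add: bounded_bilinear.diff_right[OF bounded_bilinear_matrix_matrix_mult]
    bounded_bilinear.diff_left[OF bounded_bilinear_matrix_matrix_mult])

lemma matrix_add_distrib: "(A :: real^'n^'m) ** (B + C) = A ** B + A ** C" "(D + E) ** (F :: real^'k^'n) = (D :: real^'n^'m) ** F + E ** F"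
  by (simp_all add: bounded_bilinear.add_right[OF bounded_bilinear_matrix_matrix_mult]
    bounded_bilinear.add_left[OF bounded_bilinear_matrix_matrix_mult])

text \<open>The gauge hypothesis is \<open>\<alpha> = g\<^sup>-\<^sup>1 A g + g\<^sup>-\<^sup>1 dg\<close> without inverses.\<close>

lemma curv_gauge:
  fixes g :: "'a::euclidean_space \<Rightarrow> real^3^3"
  assumes "open S" "smooth_on S g" "smooth_form S \<alpha>" "smooth_form S A"
    and gauge: "\<And>x v. x \<in> S \<Longrightarrow> g x ** \<alpha> x v = A x v ** g x + frechet_derivative g (at x) v"
    and "x \<in> S"
  shows "g x ** curv \<alpha> x u v = curv A x u v ** g x"
proof -
  let ?G = "\<lambda>x v. frechet_derivative g (at x) v"
  have bb: "bounded_bilinear ((**) :: real^3^3 \<Rightarrow> real^3^3 \<Rightarrow> real^3^3)"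
    by (rule bounded_bilinear_matrix_matrix_mult)
  have dg: "(g has_derivative ?G x) (at x)"
    by (rule smooth_on_has_derivative[OF assms(1,2,6)])
  \<comment> \<open>Both sides of the gauge identity for the vector \<open>v\<close>, differentiated
    along \<open>u\<close>.\<close>
  have D: "g x ** frechet_derivative (\<lambda>y. \<alpha> y v) (at x) u + ?G x u ** \<alpha> x v =
      (A x v ** ?G x u + frechet_derivative (\<lambda>y. A y v) (at x) u ** g x) + frechet_derivative (\<lambda>y. ?G y v) (at x) u" for u v
  proof -
    have 1: "((\<lambda>y. g y ** \<alpha> y v) has_derivative
        (\<lambda>u. g x ** frechet_derivative (\<lambda>y. \<alpha> y v) (at x) u + ?G x u ** \<alpha> x v)) (at x)"
      by (intro bounded_bilinear.FDERIV[OF bb] dg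
        smooth_on_has_derivative[OF assms(1) smooth_form_smooth_on[OF assms(3)] assms(6)])
    have 2: "((\<lambda>y. A y v ** g y + ?G y v) has_derivative
        (\<lambda>u. (A x v ** ?G x u + frechet_derivative (\<lambda>y. A y v) (at x) u ** g x) + frechet_derivative (\<lambda>y. ?G y v) (at x) u)) (at x)"
      by (intro has_derivative_add bounded_bilinear.FDERIV[OF bb] dg
        smooth_on_has_derivative[OF assms(1) smooth_form_smooth_on[OF assms(4)] assms(6)]
        smooth_on_has_derivative[OF assms(1) smooth_on_frechet_derivative[OF assms(2)] assms(6)])
    have "((\<lambda>y. g y ** \<alpha> y v) has_derivative
        (\<lambda>u. (A x v ** ?G x u + frechet_derivative (\<lambda>y. A y v) (at x) u ** g x) + frechet_derivative (\<lambda>y. ?G y v) (at x) u)) (at x)"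
      by (rule has_derivative_transform_within_open[OF 2 assms(1,6)]) (simp add: gauge)
    from has_derivative_unique[OF 1 this] show ?thesis by metis
  qed
  have G: "?G x w = g x ** \<alpha> x w - A x w ** g x" for w
    using gauge[OF assms(6), of w] by simp
  have D': "g x ** frechet_derivative (\<lambda>y. \<alpha> y v) (at x) u = A x v ** ?G x u
      + frechet_derivative (\<lambda>y. A y v) (at x) u ** g x + frechet_derivative (\<lambda>y. ?G y v) (at x) u - ?G x u ** \<alpha> x v" for u v
    unfolding eq_diff_eq by (rule D)
  \<comment> \<open>The alternation removes the second derivative of \<open>g\<close>; substituting
    \<open>G\<close> afterwards turns the mixed terms into the two wedge squares.\<close>
  have "g x ** ext_d \<alpha> x u v = ext_d A x u v ** g x + A x v ** ?G x u - A x u ** ?G x v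
      - ?G x u ** \<alpha> x v + ?G x v ** \<alpha> x u"
    unfolding ext_d_def matrix_diff_distrib D' symmetric_second_derivative[OF assms(1,2,6), of u v]
    by (simp add: algebra_simps)
  then show ?thesis
    unfolding curv_def mwedge_def G
    by (simp add: matrix_diff_distrib matrix_add_distrib matrix_mul_assoc)
qed

section \<open>Periodic functions and the Chern--Simons integrand\<close>

text \<open>The unit cube stretched by \<open>t\<close> along axis \<open>i\<close> is cut in two
  ways: at height \<open>t\<close> into the slab \<open>?L\<close> and the shifted cube, and at
  height 1 into the unit cube and a unit translate of \<open>?L\<close>. By periodicity both slabs
  contribute the same.\<close>

lemma integral_cbox_shift_periodic:
  fixes h :: "real^'n \<Rightarrow> real"
  assumes cont: "continuous_on UNIV h" and per: "\<And>p. h (p + axis i 1) = h p" and t: "0 \<le> t" "t \<le> 1"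
  shows "integral (cbox 0 1) (\<lambda>p. h (p + t *\<^sub>R axis i 1)) = integral (cbox 0 1) h"
proof -
  let ?e = "axis i 1 :: real^'n"
  have e: "?e \<in> Basis" by (simp add: axis_in_Basis_iff)
  have nth: "x \<bullet> ?e = x $ i" for x by (simp add: inner_axis)
  have int: "h integrable_on cbox a b" for a b
    by (intro integrable_continuous continuous_on_subset[OF cont]) auto
  let ?B = "cbox 0 (1 + t *\<^sub>R ?e)" and ?L = "cbox 0 (1 + (t - 1) *\<^sub>R ?e)"
  have mem: "x \<in> cbox (r *\<^sub>R ?e) (1 + s *\<^sub>R ?e) \<longleftrightarrow> (\<forall>j. j \<noteq> i \<longrightarrow> 0 \<le> x $ j \<and> x $ j \<le> 1) \<and> r \<le> x $ i \<and> x $ i \<le> 1 + s"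
    for x r s
  proof -
    have "(\<forall>j. Q j) \<longleftrightarrow> (\<forall>j. j \<noteq> i \<longrightarrow> Q j) \<and> Q i" for Q :: "'n \<Rightarrow> bool"
      by (rule iffI, simp, rule allI, rename_tac j, case_tac "j = i") auto
    from this[of "\<lambda>j. (r *\<^sub>R ?e) $ j \<le> x $ j \<and> x $ j \<le> (1 + s *\<^sub>R ?e) $ j"]
    show ?thesis unfolding mem_box_cart by (simp only:) (simp add: axis_def)
  qed
  note mem0 = mem[of _ 0, simplified] mem[of _ 0 0, simplified] mem[of _ 1, simplified] mem
  have split: "?B \<inter> {x. x \<bullet> ?e \<le> t} = ?L" "?B \<inter> {x. x \<bullet> ?e \<ge> t} = cbox (t *\<^sub>R ?e) (1 + t *\<^sub>R ?e)"
    "?B \<inter> {x. x \<bullet> ?e \<le> 1} = cbox 0 1" "?B \<inter> {x. x \<bullet> ?e \<ge> 1} = cbox ?e (1 + t *\<^sub>R ?e)"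
    using t unfolding nth by (auto simp: mem0)
  have "integral ?B h = integral ?L h + integral (cbox (t *\<^sub>R ?e) (1 + t *\<^sub>R ?e)) h"
    using integral_split[OF int e, of _ _ t] unfolding split(1,2)[symmetric] .
  moreover have "integral ?B h = integral (cbox 0 1) h + integral (cbox ?e (1 + t *\<^sub>R ?e)) h"
    using integral_split[OF int e, of _ _ 1] unfolding split(3,4)[symmetric] .
  moreover have "integral (cbox ?e (1 + t *\<^sub>R ?e)) h = integral ?L h"
  proof -
    have shift: "1 + (t - 1) *\<^sub>R ?e + ?e = 1 + t *\<^sub>R ?e" by (simp add: scaleR_left_diff_distrib)
    have "h \<circ> (+) ?e = h" using per by (simp add: fun_eq_iff add.commute[of ?e])
    then show ?thesis
      using integral_shift_cbox_plus[of 0 "1 + (t - 1) *\<^sub>R ?e" h ?e, unfolded shift] by simp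
  qed
  moreover have "integral (cbox (t *\<^sub>R ?e) (1 + t *\<^sub>R ?e)) h = integral (cbox 0 1) (\<lambda>p. h (p + t *\<^sub>R ?e))"
    using integral_shift_cbox_plus[of 0 1 h "t *\<^sub>R ?e"] by (simp add: o_def add.commute[of "t *\<^sub>R ?e"])
  ultimately show ?thesis by linarith
qed

text \<open>The integral over the shifted cube is constant in the shift; differentiating under the
  integral sign at shift 0 gives the claim. The derivative is one-sided, as the shift lemma covers
  shifts in [0, 1].\<close>

lemma integral_derivative_periodic:
  fixes h :: "real^'n \<Rightarrow> real"
  assumes sm: "smooth_on UNIV h" and per: "\<And>p. h (p + axis i 1) = h p"
  shows "integral (cbox 0 1) (\<lambda>p. frechet_derivative h (at p) (axis i 1)) = 0"
proof -
  let ?e = "axis i 1 :: real^'n"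
  define F where "F t = integral (cbox 0 1) (\<lambda>p. h (p + t *\<^sub>R ?e))" for t
  have cont: "continuous_on UNIV h" "continuous_on UNIV (\<lambda>p. frechet_derivative h (at p) ?e)"
    using smooth_on_continuous_on sm smooth_on_frechet_derivative by blast+
  have "(F has_vector_derivative integral (cbox 0 1) (\<lambda>p. frechet_derivative h (at (p + 0 *\<^sub>R ?e)) ?e)) (at 0 within {0..1})"
    unfolding F_def
  proof (rule leibniz_rule_vector_derivative)
    show "((\<lambda>t. h (p + t *\<^sub>R ?e)) has_vector_derivative frechet_derivative h (at (p + t *\<^sub>R ?e)) ?e) (at t within {0..1})" for p t
      by (rule has_vector_derivative_at_within, rule smooth_on_line_derivative[OF open_UNIV sm]) simp
    show "(\<lambda>p. h (p + t *\<^sub>R ?e)) integrable_on cbox 0 1" for t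
      by (intro integrable_continuous continuous_on_compose2[OF cont(1)] continuous_intros) auto
    show "continuous_on ({0..1} \<times> cbox 0 1) (\<lambda>(t, p). frechet_derivative h (at (p + t *\<^sub>R ?e)) ?e)"
      unfolding split_beta by (rule continuous_on_compose2[OF cont(2)]) (auto intro!: continuous_intros)
  qed auto
  moreover have "(F has_vector_derivative 0) (at 0 within {0..1})"
  proof (rule has_vector_derivative_transform[where f = "\<lambda>_. integral (cbox 0 1) h"])
    show "F t = integral (cbox 0 1) h" if "t \<in> {0..1}" for t
      unfolding F_def using integral_cbox_shift_periodic[OF cont(1) per] that by auto
  qed (auto intro!: derivative_eq_intros)
  ultimately show ?thesis
    using vector_derivative_unique_within_closed_interval[of 0 1 0 F] by auto
qed

section \<open>Triangular matrices and the trace form\<close>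

definition upper_triangular :: "real^3^3 \<Rightarrow> bool" where
  "upper_triangular M \<longleftrightarrow> M $ 2 $ 1 = 0 \<and> M $ 3 $ 1 = 0 \<and> M $ 3 $ 2 = 0"

definition strictly_upper :: "real^3^3 \<Rightarrow> bool" where
  "strictly_upper M \<longleftrightarrow> upper_triangular M \<and> M $ 1 $ 1 = 0 \<and> M $ 2 $ 2 = 0 \<and> M $ 3 $ 3 = 0"

lemma upper_triangular_mult: "upper_triangular M \<Longrightarrow> upper_triangular N \<Longrightarrow> upper_triangular (M ** N)"
  by (simp add: upper_triangular_def matrix_matrix_mult_def sum_3)

lemma trace_strictly_upper_mult: "strictly_upper M \<Longrightarrow> upper_triangular N \<Longrightarrow> trace (M ** N) = 0"
  by (simp add: strictly_upper_def upper_triangular_def trace_def matrix_matrix_mult_def sum_3)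

text \<open>The commutator of upper triangular matrices is strictly upper triangular.\<close>

lemma trace_commutator_upper:
  "upper_triangular L \<Longrightarrow> upper_triangular M \<Longrightarrow> upper_triangular N \<Longrightarrow> trace ((L ** M - M ** L) ** N) = 0"
  by (simp add: upper_triangular_def trace_def matrix_matrix_mult_def sum_3)

lemma bounded_linear_trace: "bounded_linear (trace :: real^'n^'n \<Rightarrow> real)"
  unfolding linear_conv_bounded_linear[symmetric]
  by (auto intro!: linearI simp: trace_def sum.distrib sum_distrib_left)

text \<open>The alternating, conjugation-invariant trilinear form tr([A, B] C). It evaluates
  tr(\<alpha> \<and> \<alpha> \<and> \<alpha>) on three vectors up to the factor 3.\<close>

definition cs :: "real^3^3 \<Rightarrow> real^3^3 \<Rightarrow> real^3^3 \<Rightarrow> real" where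
  "cs A B C = trace ((A ** B - B ** A) ** C)"

lemma cs_add: "cs (A + A') B C = cs A B C + cs A' B C" "cs A (B + B') C = cs A B C + cs A B' C"
  "cs A B (C + C') = cs A B C + cs A B C'"
  by (simp_all add: cs_def matrix_diff_distrib matrix_add_distrib trace_add trace_sub)

lemma cs_scaleR: "cs (r *\<^sub>R A) B C = r * cs A B C" "cs A (r *\<^sub>R B) C = r * cs A B C" "cs A B (r *\<^sub>R C) = r * cs A B C"
  by (simp_all add: cs_def trace_def matrix_matrix_mult_def sum_3 algebra_simps)

lemma cs_cyclic: "cs A B C = cs B C A"
proof -
  have "trace (A ** B ** C) = trace (B ** C ** A)" "trace (B ** A ** C) = trace (C ** B ** A)"
    using trace_mul_sym[of A "B ** C"] trace_mul_sym[of "B ** A" C] by (simp_all add: matrix_mul_assoc)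
  then show ?thesis by (simp add: cs_def matrix_diff_distrib trace_sub)
qed

lemma cs_swap: "cs A B C = - cs B A C"
  by (simp add: cs_def matrix_diff_distrib trace_sub)

lemma cs_same: "cs A A C = 0" "cs A B A = 0" "cs A B B = 0"
proof -
  show "cs A A C = 0" for A C by (simp add: cs_def trace_0[unfolded mat_0])
  then show "cs A B A = 0" "cs A B B = 0" using cs_cyclic by metis+
qed

text \<open>Cyclicity makes the three terms of the wedge product equal, whence the factor 3/24 =
  1/8.\<close>

lemma TC2_eq_cs: "TC2 \<alpha> p u v w = 1 / (8 * pi\<^sup>2) * cs (\<alpha> p u) (\<alpha> p v) (\<alpha> p w)"
proof -
  have "trace (mwedge21 (mwedge (\<alpha> p) (\<alpha> p)) (\<alpha> p) u v w) =
      cs (\<alpha> p u) (\<alpha> p v) (\<alpha> p w) - cs (\<alpha> p u) (\<alpha> p w) (\<alpha> p v) + cs (\<alpha> p v) (\<alpha> p w) (\<alpha> p u)"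
    by (simp add: mwedge21_def mwedge_def cs_def trace_add trace_sub)
  also have "\<dots> = 3 * cs (\<alpha> p u) (\<alpha> p v) (\<alpha> p w)"
    using cs_cyclic[of "\<alpha> p u" "\<alpha> p v" "\<alpha> p w"] cs_cyclic[of "\<alpha> p w" "\<alpha> p u" "\<alpha> p v"]
      cs_swap[of "\<alpha> p u" "\<alpha> p w" "\<alpha> p v"] by simp
  finally show ?thesis by (simp add: TC2_def)
qed

lemma cs_conj:
  assumes "g ** gi = mat 1" "gi ** g = mat 1"
  shows "cs (gi ** A ** g) (gi ** B ** g) (gi ** C ** g) = cs A B C"
proof -
  have c: "g ** (gi ** M) = M" for M :: "real^3^3"
    using assms(1) by (simp add: matrix_mul_assoc)
  have "(gi ** A ** g ** (gi ** B ** g) - gi ** B ** g ** (gi ** A ** g)) ** (gi ** C ** g) = gi ** (((A ** B - B ** A) ** C) ** g)"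
    by (simp add: matrix_diff_distrib c matrix_mul_assoc[symmetric])
  then show ?thesis
    using trace_mul_sym[of gi "((A ** B - B ** A) ** C) ** g"] assms(1)
    by (simp add: cs_def matrix_mul_assoc[symmetric])
qed

lemma smooth_on_trace: "open S \<Longrightarrow> smooth_on S f \<Longrightarrow> smooth_on S (\<lambda>x. trace (f x :: real^'n^'n))"
  by (rule smooth_on_linear_compose[OF _ bounded_linear_trace])

lemma frechet_derivative_periodic:
  assumes "f differentiable (at (p + k))" "\<And>p. f (p + k) = f p"
  shows "frechet_derivative f (at (p + k)) v = frechet_derivative f (at p) v"
proof -
  have "(f has_derivative frechet_derivative f (at (p + k))) (at (p + k))"
    using assms(1) by (simp add: frechet_derivative_works)
  moreover have "((\<lambda>p. p + k) has_derivative (\<lambda>v. v)) (at p)" by (auto intro!: derivative_eq_intros)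
  ultimately have "((\<lambda>p. f (p + k)) has_derivative frechet_derivative f (at (p + k))) (at p)"
    using diff_chain_at[of "\<lambda>p. p + k" "\<lambda>v. v" p f] by (simp add: o_def)
  then show ?thesis using frechet_derivative_eqI[of f] by (simp add: assms(2))
qed

text \<open>With \<open>\<beta> = dg g\<^sup>-\<^sup>1\<close>, the integrands differ by the exact form \<open>d tr(\<beta> \<and> A)\<close>: the cubic term in \<open>\<beta>\<close>
  vanishes since \<open>\<beta>\<close> is upper triangular, and \<open>tr(\<beta> \<and> (dA + A \<and> A)) = 0\<close> since the curvature is strictly upper triangular.\<close>

lemma torus_integral_TC2_gauge:
  fixes \<alpha> A :: "real^3 \<Rightarrow> real^3 \<Rightarrow> real^3^3"
  assumes A: "smooth_form UNIV A" and g: "smooth_on UNIV g" and gi: "smooth_on UNIV gi"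
    and inv: "\<And>p. g p ** gi p = mat 1" "\<And>p. gi p ** g p = mat 1"
    and upper: "\<And>p. upper_triangular (g p)" "\<And>p. upper_triangular (gi p)"
    and gauge: "\<And>p v. \<alpha> p v = gi p ** (A p v ** g p + frechet_derivative g (at p) v)"
    and curv: "\<And>p u v. strictly_upper (curv A p u v)"
    and per: "\<And>p k. k \<in> lattice \<Longrightarrow> g (p + k) = g p" "\<And>p k. k \<in> lattice \<Longrightarrow> gi (p + k) = gi p"
      "\<And>p k v. k \<in> lattice \<Longrightarrow> A (p + k) v = A p v"
  shows "torus_integral (TC2 \<alpha>) = torus_integral (TC2 A)"
proof -
  let ?e = "\<lambda>i::3. axis i 1 :: real^3"
  let ?G = "\<lambda>p v. frechet_derivative g (at p) v"
  have bb: "bounded_bilinear ((**) :: real^3^3 \<Rightarrow> real^3^3 \<Rightarrow> real^3^3)"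
    by (rule bounded_bilinear_matrix_matrix_mult)
  have e_lat: "?e i \<in> lattice" for i
    by (simp add: lattice_def axis_def)
  define b where "b p v = ?G p v ** gi p" for p v
  have sA: "smooth_on UNIV (\<lambda>p. A p v)" for v
    by (rule smooth_form_smooth_on[OF A])
  have sb: "smooth_on UNIV (\<lambda>p. b p v)" for v
    unfolding b_def by (intro smooth_on_matrix_mult smooth_on_frechet_derivative g gi open_UNIV)
  have upG: "upper_triangular (?G p v)" for p v
  proof -
    have "?G p v $ i $ j = 0" if "\<And>p. g p $ i $ j = 0" for i j
    proof -
      have "bounded_linear (\<lambda>M :: real^3^3. M $ i $ j)"
        using bounded_linear_compose[OF bounded_linear_vec_nth bounded_linear_vec_nth] .
      from frechet_derivative_bounded_linear[OF open_UNIV g UNIV_I this, of p v]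
      show ?thesis by (simp add: that)
    qed
    then show ?thesis using upper(1) by (simp add: upper_triangular_def)
  qed
  have upb: "upper_triangular (b p v)" for p v
    unfolding b_def by (intro upper_triangular_mult upG upper)
  define DA where "DA p i j = frechet_derivative (\<lambda>p. A p (?e j)) (at p) (?e i)" for p i j
  define Db where "Db p i j = frechet_derivative (\<lambda>p. b p (?e j)) (at p) (?e i)" for p i j
  \<comment> \<open>The Maurer-Cartan equation db = b \<and> b for b = dg g^-1, from the derivative
    of g^-1 and the symmetry of second derivatives of \<open>g\<close>.\<close>
  have db: "Db p i j - Db p j i = b p (?e i) ** b p (?e j) - b p (?e j) ** b p (?e i)" for p i j
  proof -
    have dgi: "frechet_derivative gi (at p) u = - (gi p ** ?G p u ** gi p)" for u
    proof -
      have "((\<lambda>p. g p ** gi p) has_derivative (\<lambda>u. g p ** frechet_derivative gi (at p) u + ?G p u ** gi p)) (at p)"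
        by (intro bounded_bilinear.FDERIV[OF bb] smooth_on_has_derivative[OF open_UNIV] g gi UNIV_I)
      from frechet_derivative_eqI[OF this, of u]
      have "g p ** frechet_derivative gi (at p) u = - (?G p u ** gi p)"
        by (simp add: inv eq_neg_iff_add_eq_0)
      then have "gi p ** (g p ** frechet_derivative gi (at p) u) = gi p ** (- (?G p u ** gi p))" by simp
      then show ?thesis
        by (simp add: matrix_mul_assoc inv bounded_bilinear.minus_right[OF bb])
    qed
    have "Db p i j = frechet_derivative (\<lambda>p. ?G p (?e j)) (at p) (?e i) ** gi p - b p (?e j) ** b p (?e i)" for i j
    proof -
      have "((\<lambda>p. b p (?e j)) has_derivative (\<lambda>u. ?G p (?e j) ** frechet_derivative gi (at p) u
          + frechet_derivative (\<lambda>p. ?G p (?e j)) (at p) u ** gi p)) (at p)"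
        unfolding b_def
        by (intro bounded_bilinear.FDERIV[OF bb] smooth_on_has_derivative[OF open_UNIV] g gi smooth_on_frechet_derivative UNIV_I)
      from frechet_derivative_eqI[OF this, of "?e i"] show ?thesis
        by (simp add: Db_def dgi b_def matrix_mul_assoc bounded_bilinear.minus_right[OF bb])
    qed
    then show ?thesis
      using symmetric_second_derivative[OF open_UNIV g UNIV_I, of "?e i" p "?e j"] by (simp add: algebra_simps)
  qed
  have dA: "DA p i j - DA p j i = curv A p (?e i) (?e j) - (A p (?e i) ** A p (?e j) - A p (?e j) ** A p (?e i))" for p i j
    by (simp add: DA_def curv_def ext_d_def mwedge_def)
  \<comment> \<open>The components of the 2-form tr(b \<and> A); the cyclic sum of their derivatives
    in \<open>key\<close> is its exterior derivative.\<close>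
  define \<eta> where "\<eta> i j p = trace (b p (?e i) ** A p (?e j)) - trace (b p (?e j) ** A p (?e i))" for i j p
  have s\<eta>: "smooth_on UNIV (\<eta> i j)" for i j
    unfolding \<eta>_def by (intro smooth_on_diff smooth_on_trace smooth_on_matrix_mult sA sb open_UNIV)
  have d\<eta>: "frechet_derivative (\<eta> i j) (at p) (?e k) =
      trace (b p (?e i) ** DA p k j) + trace (Db p k i ** A p (?e j))
      - (trace (b p (?e j) ** DA p k i) + trace (Db p k j ** A p (?e i)))" for i j k p
  proof -
    have "(\<eta> i j has_derivative (\<lambda>u. trace (b p (?e i) ** frechet_derivative (\<lambda>p. A p (?e j)) (at p) u
          + frechet_derivative (\<lambda>p. b p (?e i)) (at p) u ** A p (?e j))
        - trace (b p (?e j) ** frechet_derivative (\<lambda>p. A p (?e i)) (at p) u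
          + frechet_derivative (\<lambda>p. b p (?e j)) (at p) u ** A p (?e i)))) (at p)"
      unfolding \<eta>_def by (intro has_derivative_diff bounded_linear.has_derivative[OF bounded_linear_trace]
        bounded_bilinear.FDERIV[OF bb] smooth_on_has_derivative[OF open_UNIV] sA sb UNIV_I)
    from frechet_derivative_eqI[OF this, of "?e k"] show ?thesis
      by (simp add: DA_def Db_def trace_add)
  qed
  have int\<eta>: "integral (cbox 0 1) (\<lambda>p. frechet_derivative (\<eta> i j) (at p) (?e k)) = 0" for i j k
  proof (rule integral_derivative_periodic[OF s\<eta>])
    show "\<eta> i j (p + ?e k) = \<eta> i j p" for p
      using frechet_derivative_periodic[OF smooth_on_differentiable[OF open_UNIV g UNIV_I] per(1)[OF e_lat]] by (simp add: \<eta>_def b_def per e_lat)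
  qed
  have key: "cs (\<alpha> p (?e 1)) (\<alpha> p (?e 2)) (\<alpha> p (?e 3)) = cs (A p (?e 1)) (A p (?e 2)) (A p (?e 3)) +
      (frechet_derivative (\<eta> 2 3) (at p) (?e 1) + frechet_derivative (\<eta> 3 1) (at p) (?e 2) + frechet_derivative (\<eta> 1 2) (at p) (?e 3))"
    for p
  proof -
    define a where "a i = A p (?e i)" for i
    define c where "c i = b p (?e i)" for i
    have "\<alpha> p (?e i) = gi p ** (a i + c i) ** g p" for i
      by (simp add: gauge a_def c_def b_def matrix_add_distrib matrix_mul_assoc[symmetric] inv)
    then have "cs (\<alpha> p (?e 1)) (\<alpha> p (?e 2)) (\<alpha> p (?e 3)) = cs (a 1 + c 1) (a 2 + c 2) (a 3 + c 3)"
      by (simp add: cs_conj[OF inv])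
    \<comment> \<open>Sorted by degree in \<open>c\<close>. The mixed terms are rotated so that the
      odd factor comes last, which leaves in front a commutator that \<open>db\<close> or
      \<open>dA\<close> can replace.\<close>
    also have "\<dots> = cs (a 1) (a 2) (a 3) + (cs (a 1) (a 2) (c 3) + cs (a 3) (a 1) (c 2) + cs (a 2) (a 3) (c 1))
        + (cs (c 1) (c 2) (a 3) + cs (c 3) (c 1) (a 2) + cs (c 2) (c 3) (a 1)) + cs (c 1) (c 2) (c 3)"
      using cs_cyclic[of "a 3" "a 1" "c 2"] cs_cyclic[of "c 1" "a 2" "a 3"] cs_cyclic[of "a 1" "c 2" "c 3"]
        cs_cyclic[of "c 3" "c 1" "a 2"] by (simp add: cs_add)
    also have "cs (c 1) (c 2) (c 3) = 0"
      unfolding cs_def c_def by (intro trace_commutator_upper upb)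
    finally have expand: "cs (\<alpha> p (?e 1)) (\<alpha> p (?e 2)) (\<alpha> p (?e 3)) =
        cs (a 1) (a 2) (a 3) + (cs (a 1) (a 2) (c 3) + cs (a 3) (a 1) (c 2) + cs (a 2) (a 3) (c 1))
        + (cs (c 1) (c 2) (a 3) + cs (c 3) (c 1) (a 2) + cs (c 2) (c 3) (a 1))" by simp
    have cca: "cs (c i) (c j) (a k) = trace (Db p i j ** a k) - trace (Db p j i ** a k)" for i j k
      by (simp add: cs_def c_def db[symmetric] matrix_diff_distrib trace_sub)
    \<comment> \<open>The commutator is the curvature minus dA, and the strictly upper triangular
      curvature has trace zero against the upper triangular \<open>c k\<close>.\<close>
    have aac: "cs (a i) (a j) (c k) = trace (c k ** DA p j i) - trace (c k ** DA p i j)" for i j k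
    proof -
      have "a i ** a j - a j ** a i = curv A p (?e i) (?e j) - (DA p i j - DA p j i)"
        using dA[of p i j] by (simp add: a_def)
      moreover have "trace (curv A p (?e i) (?e j) ** c k) = 0"
        unfolding c_def by (intro trace_strictly_upper_mult curv upb)
      ultimately show ?thesis
        by (simp add: cs_def matrix_diff_distrib trace_sub trace_mul_sym[of "c k"])
    qed
    show ?thesis unfolding expand cca aac by (simp add: d\<eta> a_def c_def)
  qed
  have contA: "continuous_on X (\<lambda>p. A p v)" for X v
    using smooth_on_continuous_on[OF sA] continuous_on_subset by blast
  have int1: "(\<lambda>p. cs (A p (?e 1)) (A p (?e 2)) (A p (?e 3))) integrable_on cbox 0 1"
    unfolding cs_def
    by (intro integrable_continuous bounded_linear.continuous_on[OF bounded_linear_trace]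
        bounded_bilinear.continuous_on[OF bb] continuous_on_diff contA)
  have int2: "(\<lambda>p. frechet_derivative (\<eta> i j) (at p) (?e k)) integrable_on cbox 0 1" for i j k
    using smooth_on_continuous_on[OF smooth_on_frechet_derivative[OF s\<eta>]] continuous_on_subset
    by (intro integrable_continuous) blast
  have "integral (cbox 0 1) (\<lambda>p. cs (\<alpha> p (?e 1)) (\<alpha> p (?e 2)) (\<alpha> p (?e 3))) =
      integral (cbox 0 1) (\<lambda>p. cs (A p (?e 1)) (A p (?e 2)) (A p (?e 3)))"
    unfolding key by (simp add: integral_add integrable_add int1 int2 int\<eta>)
  then show ?thesis
    by (simp add: torus_integral_def TC2_eq_cs)
qed

section \<open>The adapted frame on the torus\<close>

lemma pi_shape_nth [simp]:
  "pi_shape x y z \<phi> w \<phi>1 \<phi>2 \<psi> $ 1 $ 1 = \<phi> + w" "pi_shape x y z \<phi> w \<phi>1 \<phi>2 \<psi> $ 1 $ 2 = \<phi>2"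
  "pi_shape x y z \<phi> w \<phi>1 \<phi>2 \<psi> $ 1 $ 3 = \<psi>" "pi_shape x y z \<phi> w \<phi>1 \<phi>2 \<psi> $ 2 $ 1 = y"
  "pi_shape x y z \<phi> w \<phi>1 \<phi>2 \<psi> $ 2 $ 2 = - 2 * w" "pi_shape x y z \<phi> w \<phi>1 \<phi>2 \<psi> $ 2 $ 3 = \<phi>1"
  "pi_shape x y z \<phi> w \<phi>1 \<phi>2 \<psi> $ 3 $ 1 = x" "pi_shape x y z \<phi> w \<phi>1 \<phi>2 \<psi> $ 3 $ 2 = z"
  "pi_shape x y z \<phi> w \<phi>1 \<phi>2 \<psi> $ 3 $ 3 = - \<phi> + w"
  by (simp_all add: pi_shape_def)

lemma mat3_eq_iff: "(M :: real^3^3) = M' \<longleftrightarrow> (\<forall>i j. M $ i $ j = M' $ i $ j)"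
  by (simp add: vec_eq_iff)

locale torus_path =
  fixes n :: int and a b c f :: real
  assumes n_nonzero: "n \<noteq> 0" and det_one: "a * f - b * c = 1"
begin

definition N :: real where "N = 2 * pi * of_int n"

lemma N_nonzero: "N \<noteq> 0"
  using n_nonzero by (simp add: N_def)

definition th :: "real^3 \<Rightarrow> real^3" where
  "th p = vector [cos (N * p $ 3), - sin (N * p $ 3), 0]"

definition t1 :: "real^3" where
  "t1 = vector [0, 0, - N]"

definition t2 :: "real^3 \<Rightarrow> real^3" where
  "t2 p = vector [sin (N * p $ 3), cos (N * p $ 3), 0]"

definition u1 :: "real^3 \<Rightarrow> real^3" where
  "u1 p = a *\<^sub>R t1 + b *\<^sub>R t2 p"

definition u2 :: "real^3 \<Rightarrow> real^3" where
  "u2 p = c *\<^sub>R t1 + f *\<^sub>R t2 p"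

text \<open>\<open>e1\<close> and \<open>e2\<close> complete \<open>th\<close> to the frame dual to
  \<open>th\<close>, \<open>u1\<close>, \<open>u2\<close>. The coefficients come from inverting the
  matrix with rows (a, b), (c, f) and determinant 1; \<open>N\<^sup>2\<close> is the squared length
  of \<open>t1\<close>.\<close>

definition e1 :: "real^3 \<Rightarrow> real^3" where
  "e1 p = (f / N\<^sup>2) *\<^sub>R t1 - c *\<^sub>R t2 p"

definition e2 :: "real^3 \<Rightarrow> real^3" where
  "e2 p = a *\<^sub>R t2 p - (b / N\<^sup>2) *\<^sub>R t1"

definition P :: line_pair where
  "P = (\<lambda>p. {v. th p \<bullet> v = 0 \<and> u2 p \<bullet> v = 0}, \<lambda>p. {v. th p \<bullet> v = 0 \<and> u1 p \<bullet> v = 0})"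

lemma inner_frame:
  "th p \<bullet> th p = 1" "t2 p \<bullet> t2 p = 1" "th p \<bullet> t2 p = 0" "t2 p \<bullet> th p = 0"
  "th p \<bullet> t1 = 0" "t1 \<bullet> th p = 0" "t2 p \<bullet> t1 = 0" "t1 \<bullet> t2 p = 0" "t1 \<bullet> t1 = N\<^sup>2"
  by (simp_all add: th_def t1_def t2_def inner_vec_def sum_3 power2_eq_square
    flip: sin_squared_eq cos_squared_eq) (simp_all flip: power2_eq_square)

lemma dual_frame [simp]:
  "th p \<bullet> th p = 1" "th p \<bullet> e1 p = 0" "th p \<bullet> e2 p = 0"
  "u1 p \<bullet> th p = 0" "u1 p \<bullet> e1 p = 1" "u1 p \<bullet> e2 p = 0"
  "u2 p \<bullet> th p = 0" "u2 p \<bullet> e1 p = 0" "u2 p \<bullet> e2 p = 1"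
  "th p \<bullet> u1 p = 0" "th p \<bullet> u2 p = 0"
  using N_nonzero det_one
  by (simp_all add: u1_def u2_def e1_def e2_def inner_frame inner_add inner_diff algebra_simps)

lemma t_eq: "t1 = f *\<^sub>R u1 p - b *\<^sub>R u2 p" "t2 p = a *\<^sub>R u2 p - c *\<^sub>R u1 p"
proof -
  have "f *\<^sub>R u1 p - b *\<^sub>R u2 p = (a * f - b * c) *\<^sub>R t1" "a *\<^sub>R u2 p - c *\<^sub>R u1 p = (a * f - b * c) *\<^sub>R t2 p"
    by (simp_all add: u1_def u2_def algebra_simps)
  then show "t1 = f *\<^sub>R u1 p - b *\<^sub>R u2 p" "t2 p = a *\<^sub>R u2 p - c *\<^sub>R u1 p" using det_one by simp_all
qed

lemma inner_t: "t1 \<bullet> v = f * (u1 p \<bullet> v) - b * (u2 p \<bullet> v)" "t2 p \<bullet> v = a * (u2 p \<bullet> v) - c * (u1 p \<bullet> v)"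
  by (subst t_eq[of p], simp add: inner_diff)+

lemma orthogonal_expansion: "v = (th p \<bullet> v) *\<^sub>R th p + (t2 p \<bullet> v) *\<^sub>R t2 p + ((t1 \<bullet> v) / N\<^sup>2) *\<^sub>R t1"
proof -
  let ?C = "cos (N * p $ 3)" and ?S = "sin (N * p $ 3)"
  have *: "?C * ?C * x + ?S * ?S * x = x" for x
    using sin_cos_squared_add[of "N * p $ 3"] by (simp add: power2_eq_square flip: distrib_right)
  have "(?C * x - ?S * y) * ?C + (?S * x + ?C * y) * ?S = x" "- ((?C * x - ?S * y) * ?S) + (?S * x + ?C * y) * ?C = y" for x y
    using *[of x] *[of y] by (simp_all add: algebra_simps)
  then show ?thesis
    using N_nonzero by (simp add: vec_eq_iff forall_3 inner_vec_def sum_3 th_def t1_def t2_def power2_eq_square)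
qed

lemma frame_expansion: "v = (th p \<bullet> v) *\<^sub>R th p + (u1 p \<bullet> v) *\<^sub>R e1 p + (u2 p \<bullet> v) *\<^sub>R e2 p"
proof -
  let ?y = "u1 p \<bullet> v" and ?z = "u2 p \<bullet> v"
  have "?y *\<^sub>R e1 p + ?z *\<^sub>R e2 p = (a * ?z - c * ?y) *\<^sub>R t2 p + ((f * ?y - b * ?z) / N\<^sup>2) *\<^sub>R t1"
    by (simp add: e1_def e2_def scaleR_right_diff_distrib scaleR_left_diff_distrib diff_divide_distrib mult.commute)
  then show ?thesis
    using orthogonal_expansion[of v p] unfolding inner_t(1)[of v p] inner_t(2)[of p v] by (simp add: add.assoc)
qed

lemma frame_eq_iff: "v = w \<longleftrightarrow> th p \<bullet> v = th p \<bullet> w \<and> u1 p \<bullet> v = u1 p \<bullet> w \<and> u2 p \<bullet> v = u2 p \<bullet> w"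
  using frame_expansion[of v p] frame_expansion[of w p] by metis

lemma coframe_expansion: "v = (th p \<bullet> v) *\<^sub>R th p + (v \<bullet> e1 p) *\<^sub>R u1 p + (v \<bullet> e2 p) *\<^sub>R u2 p"
proof -
  have "(v - ((th p \<bullet> v) *\<^sub>R th p + (v \<bullet> e1 p) *\<^sub>R u1 p + (v \<bullet> e2 p) *\<^sub>R u2 p)) \<bullet> w = 0" (is "?d \<bullet> w = 0") for w
  proof -
    have "?d \<bullet> th p = 0" "?d \<bullet> e1 p = 0" "?d \<bullet> e2 p = 0"
      by (simp_all add: inner_diff inner_add inner_commute[of v "th p"])
    then show ?thesis by (subst frame_expansion[of w p]) (simp add: inner_add)
  qed
  from this[of "v - ((th p \<bullet> v) *\<^sub>R th p + (v \<bullet> e1 p) *\<^sub>R u1 p + (v \<bullet> e2 p) *\<^sub>R u2 p)"] show ?thesis by simp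
qed

lemma periodic_trig:
  assumes "k \<in> lattice"
  shows "sin (N * (p + k) $ 3) = sin (N * p $ 3)" "cos (N * (p + k) $ 3) = cos (N * p $ 3)"
proof -
  obtain m :: int where "k $ 3 = of_int m" using assms by (auto simp: lattice_def Ints_def)
  then have "N * (p + k) $ 3 = N * p $ 3 + 2 * pi * of_int (n * m)" by (simp add: N_def algebra_simps)
  then show "sin (N * (p + k) $ 3) = sin (N * p $ 3)" "cos (N * (p + k) $ 3) = cos (N * p $ 3)"
    using sin_int_2pin[of "n * m"] cos_int_2pin[of "n * m"] by (simp_all only: sin_add cos_add)
qed

lemma periodic_frame:
  assumes "k \<in> lattice"
  shows "th (p + k) = th p" "t2 (p + k) = t2 p" "u1 (p + k) = u1 p" "u2 (p + k) = u2 p" "e1 (p + k) = e1 p" "e2 (p + k) = e2 p"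
  by (simp_all add: th_def t2_def u1_def u2_def e1_def e2_def periodic_trig[OF assms, simplified])

lemma smooth_on_frame:
  assumes "open S" "smooth_on S g"
  shows "smooth_on S (\<lambda>x. th (g x))" "smooth_on S (\<lambda>x. t2 (g x))" "smooth_on S (\<lambda>x. u1 (g x))"
    "smooth_on S (\<lambda>x. u2 (g x))" "smooth_on S (\<lambda>x. e1 (g x))" "smooth_on S (\<lambda>x. e2 (g x))"
proof -
  show th: "smooth_on S (\<lambda>x. th (g x))" 
  proof (rule smooth_on_vec[OF assms(1)])
    have "\<forall>i. smooth_on S (\<lambda>x. th (g x) $ i)"
      unfolding forall_3 by (simp add: th_def smooth_on_intros assms)
    then show "smooth_on S (\<lambda>x. th (g x) $ i)" for i by blast
  qed
  show t2: "smooth_on S (\<lambda>x. t2 (g x))"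
  proof (rule smooth_on_vec[OF assms(1)])
    have "\<forall>i. smooth_on S (\<lambda>x. t2 (g x) $ i)"
      unfolding forall_3 by (simp add: t2_def smooth_on_intros assms)
    then show "smooth_on S (\<lambda>x. t2 (g x) $ i)" for i by blast
  qed
  show "smooth_on S (\<lambda>x. u1 (g x))" "smooth_on S (\<lambda>x. u2 (g x))" "smooth_on S (\<lambda>x. e1 (g x))" "smooth_on S (\<lambda>x. e2 (g x))"
    unfolding u1_def u2_def e1_def e2_def by (intro smooth_on_add smooth_on_diff smooth_on_scaleR smooth_on_const t2 assms(1))+
qed

lemma th_has_derivative: "(th has_derivative (\<lambda>u. (t1 \<bullet> u) *\<^sub>R t2 p)) (at p)"
  and t2_has_derivative: "(t2 has_derivative (\<lambda>u. - (t1 \<bullet> u) *\<^sub>R th p)) (at p)"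
proof -
  have nth: "((\<lambda>p. p $ 3) has_derivative (\<lambda>u. u $ 3)) (at p)"
    by (rule bounded_linear.has_derivative[OF bounded_linear_vec_nth has_derivative_ident])
  have th: "th = (\<lambda>p. cos (N * p $ 3) *\<^sub>R axis 1 1 - sin (N * p $ 3) *\<^sub>R axis 2 1)"
    by (simp add: fun_eq_iff vec_eq_iff forall_3 th_def axis_def)
  have t2: "t2 = (\<lambda>p. sin (N * p $ 3) *\<^sub>R axis 1 1 + cos (N * p $ 3) *\<^sub>R axis 2 1)"
    by (simp add: fun_eq_iff vec_eq_iff forall_3 t2_def axis_def)
  have t1: "t1 \<bullet> u = - N * u $ 3" for u by (simp add: t1_def inner_vec_def sum_3)
  show "(th has_derivative (\<lambda>u. (t1 \<bullet> u) *\<^sub>R t2 p)) (at p)"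
    unfolding th t2 t1 by (rule derivative_eq_intros nth refl | simp add: algebra_simps)+
  show "(t2 has_derivative (\<lambda>u. - (t1 \<bullet> u) *\<^sub>R th p)) (at p)"
    unfolding th t2 t1 by (rule derivative_eq_intros nth refl | simp add: algebra_simps)+
qed

text \<open>The frame varies only in the direction measured by \<open>t1\<close>, and
  \<open>th\<close> and \<open>t2\<close> rotate into each other. Expressing \<open>t1\<close> and
  \<open>t2\<close> through \<open>u1\<close> and \<open>u2\<close> leaves coefficients that are
  constant on the torus.\<close>

lemma coframe_has_derivative:
  "((\<lambda>p. th p \<bullet> v) has_derivative (\<lambda>u. (f * (u1 p \<bullet> u) - b * (u2 p \<bullet> u)) * (a * (u2 p \<bullet> v) - c * (u1 p \<bullet> v)))) (at p)"
  "((\<lambda>p. u1 p \<bullet> v) has_derivative (\<lambda>u. - b * (f * (u1 p \<bullet> u) - b * (u2 p \<bullet> u)) * (th p \<bullet> v))) (at p)"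
  "((\<lambda>p. u2 p \<bullet> v) has_derivative (\<lambda>u. - f * (f * (u1 p \<bullet> u) - b * (u2 p \<bullet> u)) * (th p \<bullet> v))) (at p)"
proof -
  have 1: "((\<lambda>p. th p \<bullet> v) has_derivative (\<lambda>u. ((t1 \<bullet> u) *\<^sub>R t2 p) \<bullet> v)) (at p)"
    by (rule has_derivative_inner_left[OF th_has_derivative])
  have 2: "((\<lambda>p. t2 p \<bullet> v) has_derivative (\<lambda>u. (- (t1 \<bullet> u) *\<^sub>R th p) \<bullet> v)) (at p)"
    by (rule has_derivative_inner_left[OF t2_has_derivative])
  have 3: "((\<lambda>p. k * (t1 \<bullet> v) + l * (t2 p \<bullet> v)) has_derivative (\<lambda>u. 0 + l * ((- (t1 \<bullet> u) *\<^sub>R th p) \<bullet> v))) (at p)" for k l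
    by (intro has_derivative_add has_derivative_const has_derivative_mult_right 2)
  show "((\<lambda>p. th p \<bullet> v) has_derivative (\<lambda>u. (f * (u1 p \<bullet> u) - b * (u2 p \<bullet> u)) * (a * (u2 p \<bullet> v) - c * (u1 p \<bullet> v)))) (at p)"
    using 1 by (simp add: inner_t(1)[of _ p] inner_t(2))
  show "((\<lambda>p. u1 p \<bullet> v) has_derivative (\<lambda>u. - b * (f * (u1 p \<bullet> u) - b * (u2 p \<bullet> u)) * (th p \<bullet> v))) (at p)"
  proof -
    have eq: "(\<lambda>p. u1 p \<bullet> v) = (\<lambda>p. a * (t1 \<bullet> v) + b * (t2 p \<bullet> v))"
      by (simp add: fun_eq_iff u1_def inner_add)
    show ?thesis
      unfolding eq by (rule has_derivative_eq_rhs[OF 3]) (simp add: fun_eq_iff inner_t(1)[of _ p] algebra_simps)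
  qed
  show "((\<lambda>p. u2 p \<bullet> v) has_derivative (\<lambda>u. - f * (f * (u1 p \<bullet> u) - b * (u2 p \<bullet> u)) * (th p \<bullet> v))) (at p)"
  proof -
    have eq: "(\<lambda>p. u2 p \<bullet> v) = (\<lambda>p. c * (t1 \<bullet> v) + f * (t2 p \<bullet> v))"
      by (simp add: fun_eq_iff u2_def inner_add)
    show ?thesis
      unfolding eq by (rule has_derivative_eq_rhs[OF 3]) (simp add: fun_eq_iff inner_t(1)[of _ p] algebra_simps)
  qed
qed

section \<open>The line fields and the contact plane\<close>

lemma fst_P: "fst P p = span {e1 p}" and snd_P: "snd P p = span {e2 p}"
proof -
  have "v \<in> fst P p \<longleftrightarrow> v \<in> span {e1 p}" for v
  proof
    assume "v \<in> fst P p"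
    then have "v = (u1 p \<bullet> v) *\<^sub>R e1 p" using frame_expansion[of v p] by (simp add: P_def)
    then show "v \<in> span {e1 p}" by (metis span_base span_scale singletonI)
  qed (auto simp: span_singleton P_def)
  then show "fst P p = span {e1 p}" by blast
  have "v \<in> snd P p \<longleftrightarrow> v \<in> span {e2 p}" for v
  proof
    assume "v \<in> snd P p"
    then have "v = (u2 p \<bullet> v) *\<^sub>R e2 p" using frame_expansion[of v p] by (simp add: P_def)
    then show "v \<in> span {e2 p}" by (metis span_base span_scale singletonI)
  qed (auto simp: span_singleton P_def)
  then show "snd P p = span {e2 p}" by blast
qed

lemma contact_plane_P: "contact_plane P p = {v. th p \<bullet> v = 0}"
proof -
  have "v \<in> contact_plane P p" if "th p \<bullet> v = 0" for v
    unfolding contact_plane_def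
  proof (intro CollectI exI conjI)
    show "v = (u1 p \<bullet> v) *\<^sub>R e1 p + (u2 p \<bullet> v) *\<^sub>R e2 p"
      using frame_expansion[of v p] that by simp
  qed (simp_all add: P_def)
  then show ?thesis by (auto simp: contact_plane_def P_def inner_add)
qed

lemma path_structure_P: "path_structure P"
  unfolding path_structure_def
proof (intro conjI allI)
  show "line_field (fst P)"
    unfolding line_field_def fst_P
  proof (intro conjI allI ballI)
    have "e1 q \<noteq> 0" for q using dual_frame(5)[of q] by (metis inner_zero_right zero_neq_one)
    then show "\<exists>U X. open U \<and> p \<in> U \<and> smooth_on U X \<and> (\<forall>q\<in>U. X q \<noteq> 0 \<and> span {e1 q} = span {X q})" for p
      by (intro exI[of _ UNIV] exI[of _ e1]) (auto intro: smooth_on_frame[OF _ smooth_on_id])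
  qed (simp add: periodic_frame)
  show "line_field (snd P)"
    unfolding line_field_def snd_P
  proof (intro conjI allI ballI)
    have "e2 q \<noteq> 0" for q using dual_frame(9)[of q] by (metis inner_zero_right zero_neq_one)
    then show "\<exists>U X. open U \<and> p \<in> U \<and> smooth_on U X \<and> (\<forall>q\<in>U. X q \<noteq> 0 \<and> span {e2 q} = span {X q})" for p
      by (intro exI[of _ UNIV] exI[of _ e2]) (auto intro: smooth_on_frame[OF _ smooth_on_id])
  qed (simp add: periodic_frame)
  show "fst P p \<inter> snd P p = {0}" for p
    using frame_eq_iff[of _ 0 p] by (auto simp: P_def)
  show "contact_distribution (contact_plane P)"
    unfolding contact_distribution_def contact_plane_P
  proof (intro allI exI[of _ UNIV] exI[of _ "\<lambda>p v. th p \<bullet> v"] conjI ballI)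
    show "smooth_form UNIV (\<lambda>p v. th p \<bullet> v)"
      unfolding smooth_form_def
      by (auto intro!: smooth_on_intros smooth_on_frame bounded_linear.linear bounded_linear_inner_right)
    fix q
    \<comment> \<open>On the dual frame \<theta> \<and> d\<theta> takes the value
      \<open>a * f - b * c\<close>.\<close>
    have "wedge12 (\<lambda>v. th q \<bullet> v) (ext_d (\<lambda>p v. th p \<bullet> v) q) (th q) (e1 q) (e2 q) \<noteq> 0"
      using det_one by (simp add: wedge12_def ext_d_def frechet_derivative_eqI[OF coframe_has_derivative(1)] algebra_simps)
    then show "\<exists>u v w. wedge12 ((\<bullet>) (th q)) (ext_d (\<lambda>p. (\<bullet>) (th p)) q) u v w \<noteq> 0" by blast
  qed auto
qed

section \<open>The gauge potential\<close>

text \<open>The coefficients solve the structure equations with the ansatz \<open>\<phi> = 0\<close> and \<open>w, \<phi>1, \<phi>2, \<psi>\<close> constant in the coframe.\<close>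

definition A :: "real^3 \<Rightarrow> real^3 \<Rightarrow> real^3^3" where
  "A p v = (let x = th p \<bullet> v; y = u1 p \<bullet> v; z = u2 p \<bullet> v in
    pi_shape x y z 0 (b * f / 4 * x) (b * f / 4 * y - b\<^sup>2 * z) (b * f / 4 * z - f\<^sup>2 * y) (- 15 / 16 * b\<^sup>2 * f\<^sup>2 * x))"

text \<open>\<open>A0\<close>, \<open>A1\<close>, \<open>A2\<close> are the values of
  \<open>A\<close> on the dual frame; they reduce identities for \<open>A\<close> to identities
  between constant matrices.\<close>

definition A0 :: "real^3^3" where "A0 = pi_shape 1 0 0 0 (b * f / 4) 0 0 (- 15 / 16 * b\<^sup>2 * f\<^sup>2)"
definition A1 :: "real^3^3" where "A1 = pi_shape 0 1 0 0 0 (b * f / 4) (- f\<^sup>2) 0"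
definition A2 :: "real^3^3" where "A2 = pi_shape 0 0 1 0 0 (- b\<^sup>2) (b * f / 4) 0"

lemma A_eq: "A p v = (th p \<bullet> v) *\<^sub>R A0 + (u1 p \<bullet> v) *\<^sub>R A1 + (u2 p \<bullet> v) *\<^sub>R A2"
  by (simp add: mat3_eq_iff forall_3 A_def A0_def A1_def A2_def Let_def)

lemma smooth_form_A: "smooth_form S A" if "open S"
  unfolding smooth_form_def A_eq[abs_def]
  by (auto intro!: linearI smooth_on_add smooth_on_scaleR smooth_on_inner smooth_on_frame smooth_on_const smooth_on_id that
    simp: inner_add algebra_simps)

lemma A_periodic: "k \<in> lattice \<Longrightarrow> A (p + k) v = A p v"
  by (simp add: A_eq periodic_frame)

definition Q1 :: real where "Q1 = 3 / 2 * b ^ 3 * f"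
definition Q2 :: real where "Q2 = - 3 / 2 * b * f ^ 3"

text \<open>The structure equations turn dA into a combination of \<open>A0\<close>,
  \<open>A1\<close>, \<open>A2\<close>. The coefficients of \<open>A\<close> make all entries on and
  below the diagonal cancel, as well as \<theta> \<and> \<theta>'2 in entry (1,2) and \<theta>
  \<and> \<theta>'1 in entry (2,3).\<close>

lemma curv_A:
  "curv A p u v = vector [vector [0, Q2 * wedge ((\<bullet>) (th p)) ((\<bullet>) (u1 p)) u v, 0],
    vector [0, 0, Q1 * wedge ((\<bullet>) (th p)) ((\<bullet>) (u2 p)) u v], vector [0, 0, 0]]"
proof -
  have D: "frechet_derivative (\<lambda>p. A p v) (at p) u =
      ((f * (u1 p \<bullet> u) - b * (u2 p \<bullet> u)) * (a * (u2 p \<bullet> v) - c * (u1 p \<bullet> v))) *\<^sub>R A0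
      + (- b * (f * (u1 p \<bullet> u) - b * (u2 p \<bullet> u)) * (th p \<bullet> v)) *\<^sub>R A1
      + (- f * (f * (u1 p \<bullet> u) - b * (u2 p \<bullet> u)) * (th p \<bullet> v)) *\<^sub>R A2" for u v
    unfolding A_eq
    by (rule frechet_derivative_eqI) (intro has_derivative_add has_derivative_scaleR_left coframe_has_derivative)
  define xu yu zu xv yv zv where "xu = th p \<bullet> u" "yu = u1 p \<bullet> u" "zu = u2 p \<bullet> u" "xv = th p \<bullet> v" "yv = u1 p \<bullet> v" "zv = u2 p \<bullet> v"
  have d0: "(f * yu - b * zu) * (a * zv - c * yv) - (f * yv - b * zv) * (a * zu - c * yu) = yu * zv - yv * zu"
  proof -
    have "(f * yu - b * zu) * (a * zv - c * yv) - (f * yv - b * zv) * (a * zu - c * yu) = (a * f - b * c) * (yu * zv - yv * zu)"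
      by (simp add: algebra_simps)
    then show ?thesis using det_one by simp
  qed
  have d: "ext_d A p u v = (yu * zv - yv * zu) *\<^sub>R A0
      + (b * (f * (xu * yv - xv * yu) - b * (xu * zv - xv * zu))) *\<^sub>R A1
      + (f * (f * (xu * yv - xv * yu) - b * (xu * zv - xv * zu))) *\<^sub>R A2"
    unfolding ext_d_def D xu_yu_zu_xv_yv_zv_def[symmetric] d0[symmetric] by (simp add: algebra_simps)
  have uv: "A p u = xu *\<^sub>R A0 + yu *\<^sub>R A1 + zu *\<^sub>R A2" "A p v = xv *\<^sub>R A0 + yv *\<^sub>R A1 + zv *\<^sub>R A2"
    by (simp_all add: A_eq xu_yu_zu_xv_yv_zv_def)
  show ?thesis
    unfolding curv_def mwedge_def wedge_def d uv xu_yu_zu_xv_yv_zv_def[symmetric]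
    by (simp add: mat3_eq_iff forall_3 matrix_matrix_mult_def sum_3 A0_def A1_def A2_def Q1_def Q2_def)
      (simp add: field_simps power2_eq_square power3_eq_cube)
qed

lemma strictly_upper_curv_A: "strictly_upper (curv A p u v)"
  by (simp add: curv_A strictly_upper_def upper_triangular_def)

lemma torus_integral_TC2_A: "torus_integral (TC2 A) = 3 * of_int n / (8 * pi) * (b * f)\<^sup>2"
proof -
  have "cs A0 A1 A2 = 3 / 2 * (b * f)\<^sup>2"
    by (simp add: cs_def trace_def matrix_matrix_mult_def sum_3 A0_def A1_def A2_def power2_eq_square algebra_simps)
  moreover have perm: "cs A0 A2 A1 = - cs A0 A1 A2" "cs A1 A0 A2 = - cs A0 A1 A2" "cs A1 A2 A0 = cs A0 A1 A2"
    "cs A2 A0 A1 = cs A0 A1 A2" "cs A2 A1 A0 = - cs A0 A1 A2"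
    using cs_cyclic[of A0 A1 A2] cs_cyclic[of A1 A2 A0] cs_cyclic[of A0 A2 A1] cs_cyclic[of A2 A1 A0]
      cs_swap[of A0 A1 A2] by auto
  moreover have "cs (A p (axis 1 1)) (A p (axis 2 1)) (A p (axis 3 1)) = N * cs A0 A1 A2" for p
  proof -
    define C S where "C = cos (N * p $ 3)" and "S = sin (N * p $ 3)"
    have CS: "C * C + S * S = 1" by (simp add: C_def S_def)
    have A: "A p (axis 1 1) = C *\<^sub>R A0 + (b * S) *\<^sub>R A1 + (f * S) *\<^sub>R A2"
      "A p (axis 2 1) = (- S) *\<^sub>R A0 + (b * C) *\<^sub>R A1 + (f * C) *\<^sub>R A2"
      "A p (axis 3 1) = (- a * N) *\<^sub>R A1 + (- c * N) *\<^sub>R A2"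
      by (simp_all add: A_eq u1_def u2_def C_def S_def th_def t1_def t2_def inner_axis)
    \<comment> \<open>The factor in front is the determinant of the coefficients in
      \<open>A\<close>, that is, \<theta> \<and> \<theta>'1 \<and> \<theta>'2 on the coordinate
      vectors.\<close>
    have "cs (A p (axis 1 1)) (A p (axis 2 1)) (A p (axis 3 1)) = N * (a * f - b * c) * (C * C + S * S) * cs A0 A1 A2"
      unfolding A cs_add cs_scaleR cs_same perm by (simp add: algebra_simps)
    then show ?thesis by (simp add: det_one CS)
  qed
  moreover have "Henstock_Kurzweil_Integration.content (cbox 0 1 :: (real^3) set) = 1"
    by (simp add: content_cbox_if_cart interval_eq_empty_cart)
  ultimately show ?thesis
    by (simp add: torus_integral_def TC2_eq_cs N_def power2_eq_square field_simps)
qed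

end

section \<open>Curves and tangent vectors\<close>

lemma has_vector_derivative_compose:
  assumes "(\<gamma> has_vector_derivative v) (at t)" "(F has_derivative F') (at (\<gamma> t))"
  shows "((\<lambda>t. F (\<gamma> t)) has_vector_derivative F' v) (at t)"
proof -
  have "((\<lambda>t. F (\<gamma> t)) has_derivative (\<lambda>h. F' (h *\<^sub>R v))) (at t)"
    using diff_chain_at[OF assms(1)[unfolded has_vector_derivative_def] assms(2)] by (simp add: o_def)
  then show ?thesis
    by (simp add: has_vector_derivative_def linear_scale[OF has_derivative_linear[OF assms(2)]])
qed

text \<open>Near 0 the curve stays in \<open>S\<close>, so maps that agree on \<open>S\<close> have
  the same velocity along it. This is how the equations of a submanifold get differentiated.\<close>

lemma curve_at_unique_derivative:
  assumes "curve_at S x v \<gamma>" and "(F has_vector_derivative w) (at 0)" "(G has_vector_derivative w') (at 0)"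
    and "\<And>y. y \<in> S \<Longrightarrow> F' y = G' y" and "\<And>t. F t = F' (\<gamma> t)" "\<And>t. G t = G' (\<gamma> t)"
  shows "w = w'"
proof -
  obtain e where e: "e > 0" "\<And>t. t \<in> {-e<..<e} \<Longrightarrow> \<gamma> t \<in> S"
    using assms(1) unfolding curve_at_def by blast
  have "(G has_vector_derivative w) (at 0)"
    by (rule has_vector_derivative_transform_within_open[OF assms(2), of "{-e<..<e}"])
      (use e assms(4-6) in auto)
  then show ?thesis using vector_derivative_unique_at assms(3) by blast
qed

lemma curve_atI:
  assumes "smooth_on UNIV \<gamma>" "\<gamma> 0 = x" "(\<gamma> has_vector_derivative v) (at 0)"
    and "eventually (\<lambda>t. \<gamma> t \<in> S) (at 0)" "x \<in> S"
  shows "curve_at S x v \<gamma>"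
proof -
  obtain e where e: "e > 0" "\<And>t. t \<noteq> 0 \<Longrightarrow> dist t 0 < e \<Longrightarrow> \<gamma> t \<in> S"
    using assms(4) unfolding eventually_at by blast
  have "\<gamma> t \<in> S" if "t \<in> {-e<..<e}" for t
    using e(2)[of t] that assms(2,5) by (cases "t = 0") (auto simp: dist_real_def)
  then show ?thesis
    unfolding curve_at_def using e(1) assms(2,3) smooth_on_subset[OF open_greaterThanLessThan open_UNIV assms(1)] by blast
qed

lemma tangent_spaceI: "curve_at S x v \<gamma> \<Longrightarrow> v \<in> tangent_space S x"
  unfolding tangent_space_def by blast

lemma section_tangent:
  assumes "smooth_on UNIV s" "\<And>p. s p \<in> S"
  shows "frechet_derivative s (at p) u \<in> tangent_space S (s p)"
proof (rule tangent_spaceI, rule curve_atI)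
  show "smooth_on UNIV (\<lambda>t. s (p + t *\<^sub>R u))"
    by (rule smooth_on_compose[OF open_UNIV open_UNIV assms(1)]) (auto intro!: smooth_on_intros)
  show "((\<lambda>t. s (p + t *\<^sub>R u)) has_vector_derivative frechet_derivative s (at p) u) (at 0)"
    using smooth_on_line_derivative[OF open_UNIV assms(1), of p 0 u] by simp
qed (auto simp: assms(2))

section \<open>The bundle of contact covectors\<close>

context torus_path
begin

lemma E_bundle_P: "\<epsilon> \<in> E_bundle P \<longleftrightarrow> (\<exists>p r. r \<noteq> 0 \<and> \<epsilon> = (p, r *\<^sub>R th p))"
proof
  assume *: "\<epsilon> \<in> E_bundle P"
  obtain p \<xi> where \<epsilon>: "\<epsilon> = (p, \<xi>)" by fastforce
  have ker: "\<xi> \<bullet> v = 0 \<longleftrightarrow> th p \<bullet> v = 0" for v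
    using * unfolding \<epsilon> E_bundle_def contact_plane_P by auto
  have "\<xi> = (th p \<bullet> \<xi>) *\<^sub>R th p"
    using coframe_expansion[of \<xi> p] ker[of "e1 p"] ker[of "e2 p"] by simp
  moreover have "th p \<bullet> \<xi> \<noteq> 0" using ker[of "th p"] by (simp add: inner_commute)
  ultimately show "\<exists>p r. r \<noteq> 0 \<and> \<epsilon> = (p, r *\<^sub>R th p)" unfolding \<epsilon> by blast
qed (auto simp: E_bundle_def contact_plane_P)

text \<open>The velocity of a curve in E with base velocity \<open>u\<close> whose fibre coordinate
  passes through \<open>r\<close> with speed \<rho>: the second component is the product rule for r
  \<open>th\<close>.\<close>

definition tE :: "real^3 \<Rightarrow> real \<Rightarrow> real^3 \<Rightarrow> real \<Rightarrow> epoint" where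
  "tE p r u \<rho> = (u, \<rho> *\<^sub>R th p + (r * (t1 \<bullet> u)) *\<^sub>R t2 p)"

lemma tE_in_tangent_space:
  assumes "r \<noteq> 0"
  shows "tE p r u \<rho> \<in> tangent_space (E_bundle P) (p, r *\<^sub>R th p)"
proof (rule tangent_spaceI, rule curve_atI)
  let ?\<gamma> = "\<lambda>t. (p + t *\<^sub>R u, (r + t * \<rho>) *\<^sub>R th (p + t *\<^sub>R u))"
  show "smooth_on UNIV ?\<gamma>"
    by (intro smooth_on_Pair smooth_on_scaleR smooth_on_frame smooth_on_add smooth_on_mult smooth_on_const smooth_on_id open_UNIV)
  have th: "((\<lambda>t. th (p + t *\<^sub>R u)) has_vector_derivative (t1 \<bullet> u) *\<^sub>R t2 p) (at 0)"
    by (rule has_vector_derivative_compose[where F = th and \<gamma> = "\<lambda>t. p + t *\<^sub>R u"])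
      (auto intro!: derivative_eq_intros th_has_derivative)
  have "((\<lambda>t. (r + t * \<rho>) *\<^sub>R th (p + t *\<^sub>R u)) has_vector_derivative (r + 0 * \<rho>) *\<^sub>R ((t1 \<bullet> u) *\<^sub>R t2 p) + \<rho> *\<^sub>R th (p + 0 *\<^sub>R u)) (at 0)"
    by (rule has_vector_derivative_scaleR[OF _ th]) (auto intro!: derivative_eq_intros)
  then show "(?\<gamma> has_vector_derivative tE p r u \<rho>) (at 0)"
    unfolding tE_def by (intro has_vector_derivative_Pair) (auto intro!: derivative_eq_intros simp: add.commute)
  have "((\<lambda>t. r + t * \<rho>) \<longlongrightarrow> r + 0 * \<rho>) (at 0)" by (intro tendsto_intros)
  then have "eventually (\<lambda>t. r + t * \<rho> \<noteq> 0) (at 0)"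
    using assms by (intro tendsto_imp_eventually_ne) auto
  then show "eventually (\<lambda>t. ?\<gamma> t \<in> E_bundle P) (at 0)"
    by eventually_elim (auto simp: E_bundle_P)
qed (use assms in \<open>auto simp: E_bundle_P\<close>)

text \<open>A point of E satisfies \<xi> = (\<open>th\<close> \<bullet> \<xi>) \<open>th\<close>;
  differentiating this along the curve puts the velocity in the form \<open>tE\<close>. Keeping
  \<rho> as the speed of the fibre coordinate lets it be compared with the Borel coordinate
  later.\<close>

lemma E_curve_derivative:
  assumes "curve_at (E_bundle P) (p, r *\<^sub>R th p) v \<gamma>"
  shows "\<exists>\<rho>. v = tE p r (fst v) \<rho> \<and> ((\<lambda>t. th (fst (\<gamma> t)) \<bullet> snd (\<gamma> t)) has_vector_derivative \<rho>) (at 0)"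
proof -
  have \<gamma>: "\<gamma> 0 = (p, r *\<^sub>R th p)" "(\<gamma> has_vector_derivative v) (at 0)"
    using assms by (auto simp: curve_at_def)
  have d1: "((\<lambda>t. fst (\<gamma> t)) has_vector_derivative fst v) (at 0)" and d2: "((\<lambda>t. snd (\<gamma> t)) has_vector_derivative snd v) (at 0)"
    using has_vector_derivative_compose[OF \<gamma>(2) bounded_linear_imp_has_derivative[OF bounded_linear_fst]]
      has_vector_derivative_compose[OF \<gamma>(2) bounded_linear_imp_has_derivative[OF bounded_linear_snd]] by auto
  have dth: "((\<lambda>t. th (fst (\<gamma> t))) has_vector_derivative (t1 \<bullet> fst v) *\<^sub>R t2 p) (at 0)"
    using has_vector_derivative_compose[OF d1 th_has_derivative] by (simp add: \<gamma>)
  define \<rho> where "\<rho> = th p \<bullet> snd v + ((t1 \<bullet> fst v) *\<^sub>R t2 p) \<bullet> (r *\<^sub>R th p)"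
  have g: "((\<lambda>t. th (fst (\<gamma> t)) \<bullet> snd (\<gamma> t)) has_vector_derivative \<rho>) (at 0)"
    using bounded_bilinear.has_vector_derivative[OF bounded_bilinear_inner dth d2] by (simp add: \<gamma> \<rho>_def)
  have "((\<lambda>t. (th (fst (\<gamma> t)) \<bullet> snd (\<gamma> t)) *\<^sub>R th (fst (\<gamma> t))) has_vector_derivative r *\<^sub>R ((t1 \<bullet> fst v) *\<^sub>R t2 p) + \<rho> *\<^sub>R th p) (at 0)"
    using has_vector_derivative_scaleR[OF g[folded has_real_derivative_iff_has_vector_derivative] dth] by (simp add: \<gamma>)
  then have "snd v = r *\<^sub>R ((t1 \<bullet> fst v) *\<^sub>R t2 p) + \<rho> *\<^sub>R th p"
    by (rule curve_at_unique_derivative[OF assms d2, where F' = snd and G' = "\<lambda>\<epsilon>. (th (fst \<epsilon>) \<bullet> snd \<epsilon>) *\<^sub>R th (fst \<epsilon>)"])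
      (auto simp: E_bundle_P)
  then have "v = tE p r (fst v) \<rho>" by (simp add: tE_def prod_eq_iff add.commute)
  with g show ?thesis by blast
qed

lemma tangent_space_E:
  assumes "r \<noteq> 0"
  shows "z \<in> tangent_space (E_bundle P) (p, r *\<^sub>R th p) \<longleftrightarrow> (\<exists>u \<rho>. z = tE p r u \<rho>)"
  using tE_in_tangent_space[OF assms] E_curve_derivative unfolding tangent_space_def by blast

lemma tautological_has_derivative:
  "((\<lambda>\<epsilon>. tautological \<epsilon> z') has_derivative (\<lambda>z. snd z \<bullet> fst z')) (at \<epsilon>)"
  unfolding tautological_def
  by (intro has_derivative_inner_left bounded_linear_imp_has_derivative bounded_linear_snd)

lemma ext_d_tautological: "ext_d tautological \<epsilon> z z' = snd z \<bullet> fst z' - snd z' \<bullet> fst z"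
  unfolding ext_d_def frechet_derivative_eqI[OF tautological_has_derivative] ..

text \<open>The tautological form is r \<theta>, so this is dr \<and> \<theta> + r d\<theta> with
  d\<theta> = \<theta>'1 \<and> \<theta>'2.\<close>

lemma ext_d_tautological_tE:
  "ext_d tautological (p, r *\<^sub>R th p) (tE p r u \<rho>) (tE p r u' \<rho>') =
    \<rho> * (th p \<bullet> u') - \<rho>' * (th p \<bullet> u) + r * ((u1 p \<bullet> u) * (u2 p \<bullet> u') - (u1 p \<bullet> u') * (u2 p \<bullet> u))"
proof -
  have "(t1 \<bullet> u) * (t2 p \<bullet> u') - (t1 \<bullet> u') * (t2 p \<bullet> u) =
      (a * f - b * c) * ((u1 p \<bullet> u) * (u2 p \<bullet> u') - (u1 p \<bullet> u') * (u2 p \<bullet> u))"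
    unfolding inner_t(1)[of _ p] inner_t(2) by (simp add: algebra_simps)
  moreover have "ext_d tautological (p, r *\<^sub>R th p) (tE p r u \<rho>) (tE p r u' \<rho>') =
      \<rho> * (th p \<bullet> u') - \<rho>' * (th p \<bullet> u) + r * ((t1 \<bullet> u) * (t2 p \<bullet> u') - (t1 \<bullet> u') * (t2 p \<bullet> u))"
    by (simp add: ext_d_tautological tE_def inner_add algebra_simps)
  ultimately show ?thesis by (simp add: det_one)
qed

section \<open>Points of Y\<close>

text \<open>The last component represents the covector \<open>q dr + m \<theta> + x1 \<theta>'\<^sup>1 + x2 \<theta>'\<^sup>2\<close> on the tangent space of \<open>E\<close>,
  expressed in the orthogonal basis \<open>(th, 0), (t2, 0), (0, th), (t1, r N\<^sup>2 t2)\<close>.\<close>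

definition phi_vec :: "real^3 \<Rightarrow> real \<Rightarrow> real \<Rightarrow> real \<Rightarrow> real \<Rightarrow> real \<Rightarrow> epoint" where
  "phi_vec p r q m x1 x2 = (let K = (x1 * a + x2 * c) / (1 + r\<^sup>2 * N\<^sup>2) in
    (m *\<^sub>R th p + (x1 * b + x2 * f) *\<^sub>R t2 p + K *\<^sub>R t1, q *\<^sub>R th p + (K * (r * N\<^sup>2)) *\<^sub>R t2 p))"

text \<open>The basis vector over \<open>t1\<close> has squared length
  \<open>N\<^sup>2 * (1 + r\<^sup>2 * N\<^sup>2)\<close>, for which the denominator of
  \<open>K\<close> compensates; \<open>x1 * a + x2 * c\<close> is the coefficient of
  \<open>t1\<close> in the covector.\<close>

lemma phi_vec_inner_tE:
  "phi_vec p r q m x1 x2 \<bullet> tE p r u \<rho> = q * \<rho> + m * (th p \<bullet> u) + x1 * (u1 p \<bullet> u) + x2 * (u2 p \<bullet> u)"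
proof -
  define K where "K = (x1 * a + x2 * c) / (1 + r\<^sup>2 * N\<^sup>2)"
  have "1 + r\<^sup>2 * N\<^sup>2 > 0" by (intro add_pos_nonneg) auto
  then have K: "K * (1 + r\<^sup>2 * N\<^sup>2) = x1 * a + x2 * c" by (simp add: K_def)
  have "phi_vec p r q m x1 x2 \<bullet> tE p r u \<rho> =
      q * \<rho> + m * (th p \<bullet> u) + (x1 * b + x2 * f) * (t2 p \<bullet> u) + K * (1 + r\<^sup>2 * N\<^sup>2) * (t1 \<bullet> u)"
    unfolding phi_vec_def Let_def K_def[symmetric]
    by (simp add: tE_def inner_add inner_frame algebra_simps power2_eq_square)
  then show ?thesis unfolding K by (simp add: u1_def u2_def inner_add algebra_simps)
qed

text \<open>Tangency of the representing vector: its part with factor \<open>K\<close> is a multiple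
  of the lift of \<open>t1\<close>.\<close>

lemma phi_vec_eq_tE: "phi_vec p r q m x1 x2 = tE p r (fst (phi_vec p r q m x1 x2)) q"
proof -
  have "t1 \<bullet> (m *\<^sub>R th p + s *\<^sub>R t2 p + K *\<^sub>R t1) = K * N\<^sup>2" for s K
    by (simp add: inner_add inner_frame)
  then show ?thesis by (simp add: phi_vec_def tE_def Let_def mult.left_commute[of r])
qed

text \<open>A candidate coframe with free coefficients; only \<open>ypt_in_Y_bundle\<close> imposes
  the relations that place it in Y.\<close>

definition ypt where
  "ypt p r \<alpha>1 \<alpha>2 \<beta>1 \<beta>2 q m x1 x2 =
    ((p, r *\<^sub>R th p), \<alpha>1 *\<^sub>R u1 p + \<beta>1 *\<^sub>R th p, \<alpha>2 *\<^sub>R u2 p + \<beta>2 *\<^sub>R th p, phi_vec p r q m x1 x2)"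

lemma cof_ypt:
  "cof_\<omega> (ypt p r \<alpha>1 \<alpha>2 \<beta>1 \<beta>2 q m x1 x2) (tE p r' u \<rho>) = r * (th p \<bullet> u)"
  "cof_\<omega>1 (ypt p r \<alpha>1 \<alpha>2 \<beta>1 \<beta>2 q m x1 x2) (tE p r' u \<rho>) = \<alpha>1 * (u1 p \<bullet> u) + \<beta>1 * (th p \<bullet> u)"
  "cof_\<omega>2 (ypt p r \<alpha>1 \<alpha>2 \<beta>1 \<beta>2 q m x1 x2) (tE p r' u \<rho>) = \<alpha>2 * (u2 p \<bullet> u) + \<beta>2 * (th p \<bullet> u)"
  "cof_\<phi> (ypt p r \<alpha>1 \<alpha>2 \<beta>1 \<beta>2 q m x1 x2) (tE p r u \<rho>) =
    q * \<rho> + m * (th p \<bullet> u) + x1 * (u1 p \<bullet> u) + x2 * (u2 p \<bullet> u)"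
  unfolding ypt_def cof_\<omega>_def cof_\<omega>1_def cof_\<omega>2_def cof_\<phi>_def fst_conv snd_conv phi_vec_inner_tE
  by (simp_all add: tautological_def tE_def inner_add)

text \<open>The last four hypotheses compare the coefficients of \<theta>'1 \<and> \<theta>'2, dr
  \<and> \<theta>, \<theta>'1 \<and> \<theta> and \<theta>'2 \<and> \<theta> in the equation for
  d\<omega>. The coefficient \<open>m\<close> of \<theta> in \<phi> stays free.\<close>

lemma ypt_in_Y_bundle:
  assumes "\<alpha>1 \<noteq> 0" "\<alpha>2 \<noteq> 0" "r = \<alpha>1 * \<alpha>2" "2 * r * q = 1" "2 * r * x1 = - \<alpha>1 * \<beta>2" "2 * r * x2 = \<beta>1 * \<alpha>2"
  shows "ypt p r \<alpha>1 \<alpha>2 \<beta>1 \<beta>2 q m x1 x2 \<in> Y_bundle P" (is "?y \<in> _")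
proof -
  have r: "r \<noteq> 0" using assms by simp
  have q: "q \<noteq> 0" using assms(4) by auto
  have tE_zero: "tE p r u \<rho> = 0" if "th p \<bullet> u = 0" "u1 p \<bullet> u = 0" "u2 p \<bullet> u = 0" "\<rho> = 0" for u \<rho>
    using frame_expansion[of u p] that by (simp add: tE_def prod_eq_iff)
  show ?thesis
    unfolding Y_bundle_def mem_Collect_eq
  proof (intro exI conjI)
    show "?y = ((p, r *\<^sub>R th p), \<alpha>1 *\<^sub>R u1 p + \<beta>1 *\<^sub>R th p, \<alpha>2 *\<^sub>R u2 p + \<beta>2 *\<^sub>R th p, phi_vec p r q m x1 x2)"
      by (simp add: ypt_def)
    show "(p, r *\<^sub>R th p) \<in> E_bundle P" using r by (auto simp: E_bundle_P)
    show "phi_vec p r q m x1 x2 \<in> tangent_space (E_bundle P) (p, r *\<^sub>R th p)"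
      using phi_vec_eq_tE tangent_space_E[OF r] by blast
    show "\<forall>u\<in>snd P p. (\<alpha>1 *\<^sub>R u1 p + \<beta>1 *\<^sub>R th p) \<bullet> u = 0" "\<forall>u\<in>fst P p. (\<alpha>2 *\<^sub>R u2 p + \<beta>2 *\<^sub>R th p) \<bullet> u = 0"
      by (auto simp: P_def inner_add)
    show "\<exists>u\<in>fst P p. (\<alpha>1 *\<^sub>R u1 p + \<beta>1 *\<^sub>R th p) \<bullet> u \<noteq> 0"
      by (rule bexI[of _ "e1 p"]) (use assms in \<open>auto simp: P_def inner_add\<close>)
    show "\<exists>u\<in>snd P p. (\<alpha>2 *\<^sub>R u2 p + \<beta>2 *\<^sub>R th p) \<bullet> u \<noteq> 0"
      by (rule bexI[of _ "e2 p"]) (use assms in \<open>auto simp: P_def inner_add\<close>)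
    show "\<forall>z\<in>tangent_space (E_bundle P) (p, r *\<^sub>R th p).
        cof_\<omega> ?y z = 0 \<and> cof_\<omega>1 ?y z = 0 \<and> cof_\<omega>2 ?y z = 0 \<and> cof_\<phi> ?y z = 0 \<longrightarrow> z = 0"
    proof (intro ballI impI)
      fix z assume "z \<in> tangent_space (E_bundle P) (p, r *\<^sub>R th p)"
        and "cof_\<omega> ?y z = 0 \<and> cof_\<omega>1 ?y z = 0 \<and> cof_\<omega>2 ?y z = 0 \<and> cof_\<phi> ?y z = 0"
      then show "z = 0"
        unfolding tangent_space_E[OF r] using r q assms(1,2) by (auto simp: cof_ypt intro!: tE_zero)
    qed
    show "\<forall>z\<in>tangent_space (E_bundle P) (p, r *\<^sub>R th p). \<forall>z'\<in>tangent_space (E_bundle P) (p, r *\<^sub>R th p).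
        ext_d tautological (p, r *\<^sub>R th p) z z' =
          2 * wedge (cof_\<phi> ?y) (cof_\<omega> ?y) z z' + wedge (cof_\<omega>1 ?y) (cof_\<omega>2 ?y) z z'"
    proof (intro ballI)
      fix z z' assume "z \<in> tangent_space (E_bundle P) (p, r *\<^sub>R th p)" "z' \<in> tangent_space (E_bundle P) (p, r *\<^sub>R th p)"
      then obtain u \<rho> u' \<rho>' where z: "z = tE p r u \<rho>" "z' = tE p r u' \<rho>'" using tangent_space_E[OF r] by blast
      define x y w where "x = th p \<bullet> u" "y = u1 p \<bullet> u" "w = u2 p \<bullet> u"
      define x' y' w' where "x' = th p \<bullet> u'" "y' = u1 p \<bullet> u'" "w' = u2 p \<bullet> u'"
      have "2 * wedge (cof_\<phi> ?y) (cof_\<omega> ?y) z z' + wedge (cof_\<omega>1 ?y) (cof_\<omega>2 ?y) z z' =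
          (2 * r * q) * (\<rho> * x' - \<rho>' * x) + (2 * r * x1 + \<alpha>1 * \<beta>2) * (y * x' - y' * x)
          + (2 * r * x2 - \<beta>1 * \<alpha>2) * (w * x' - w' * x) + (\<alpha>1 * \<alpha>2) * (y * w' - y' * w)"
        unfolding wedge_def z cof_ypt x_y_w_def[symmetric] x'_y'_w'_def[symmetric] by (simp add: algebra_simps)
      also have "\<dots> = ext_d tautological (p, r *\<^sub>R th p) z z'"
        unfolding z ext_d_tautological_tE x_y_w_def[symmetric] x'_y'_w'_def[symmetric]
        by (simp add: assms(4-6)) (simp add: assms(3))
      finally show "ext_d tautological (p, r *\<^sub>R th p) z z' =
          2 * wedge (cof_\<phi> ?y) (cof_\<omega> ?y) z z' + wedge (cof_\<omega>1 ?y) (cof_\<omega>2 ?y) z z'" ..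
    qed
  qed
qed

text \<open>The difference of the two vectors is tangent to E and orthogonal to every tangent
  vector, itself included.\<close>

lemma tangent_E_inner_eqI:
  assumes "r \<noteq> 0" "F \<in> tangent_space (E_bundle P) (p, r *\<^sub>R th p)" "G \<in> tangent_space (E_bundle P) (p, r *\<^sub>R th p)"
    and "\<And>u \<rho>. F \<bullet> tE p r u \<rho> = G \<bullet> tE p r u \<rho>"
  shows "F = G"
proof -
  obtain u \<rho> u' \<rho>' where FG: "F = tE p r u \<rho>" "G = tE p r u' \<rho>'" using assms(2,3) tangent_space_E[OF assms(1)] by blast
  then have "F - G = tE p r (u - u') (\<rho> - \<rho>')"
    by (simp add: tE_def prod_eq_iff inner_diff algebra_simps)
  moreover have "(F - G) \<bullet> tE p r (u - u') (\<rho> - \<rho>') = 0" using assms(4) by (simp add: inner_diff_left)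
  ultimately have "(F - G) \<bullet> (F - G) = 0" by simp
  then show ?thesis by simp
qed

text \<open>The equation for d\<omega> fixes the fibre coordinate and all of \<phi> except its
  \<theta>-coefficient. Three base coordinates and five parameters remain, in accordance with
  dimension 8.\<close>

lemma Y_bundle_cases:
  assumes "y \<in> Y_bundle P"
  obtains p \<alpha>1 \<alpha>2 \<beta>1 \<beta>2 m where "\<alpha>1 \<noteq> 0" "\<alpha>2 \<noteq> 0"
    "y = ypt p (\<alpha>1 * \<alpha>2) \<alpha>1 \<alpha>2 \<beta>1 \<beta>2 (1 / (2 * \<alpha>1 * \<alpha>2)) m (- \<beta>2 / (2 * \<alpha>2)) (\<beta>1 / (2 * \<alpha>1))"
proof -
  obtain p \<xi> \<eta>1 \<eta>2 F where y: "y = ((p, \<xi>), \<eta>1, \<eta>2, F)" and E: "(p, \<xi>) \<in> E_bundle P"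
    and F: "F \<in> tangent_space (E_bundle P) (p, \<xi>)"
    and \<eta>1: "\<forall>u\<in>snd P p. \<eta>1 \<bullet> u = 0" "\<exists>u\<in>fst P p. \<eta>1 \<bullet> u \<noteq> 0"
    and \<eta>2: "\<forall>u\<in>fst P p. \<eta>2 \<bullet> u = 0" "\<exists>u\<in>snd P p. \<eta>2 \<bullet> u \<noteq> 0"
    and d: "\<forall>z\<in>tangent_space (E_bundle P) (p, \<xi>). \<forall>z'\<in>tangent_space (E_bundle P) (p, \<xi>).
        ext_d tautological (p, \<xi>) z z' = 2 * wedge (cof_\<phi> y) (cof_\<omega> y) z z' + wedge (cof_\<omega>1 y) (cof_\<omega>2 y) z z'"
    using assms unfolding Y_bundle_def by blast
  obtain r where r: "r \<noteq> 0" "\<xi> = r *\<^sub>R th p" using E by (auto simp: E_bundle_P)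
  define \<alpha>1 \<beta>1 \<alpha>2 \<beta>2 m where "\<alpha>1 = \<eta>1 \<bullet> e1 p" "\<beta>1 = th p \<bullet> \<eta>1" "\<alpha>2 = \<eta>2 \<bullet> e2 p" "\<beta>2 = th p \<bullet> \<eta>2" "m = F \<bullet> tE p r (th p) 0"
  have "\<eta>1 \<bullet> e2 p = 0" "\<eta>2 \<bullet> e1 p = 0" using \<eta>1(1) \<eta>2(1) by (auto simp: P_def)
  then have \<eta>: "\<eta>1 = \<alpha>1 *\<^sub>R u1 p + \<beta>1 *\<^sub>R th p" "\<eta>2 = \<alpha>2 *\<^sub>R u2 p + \<beta>2 *\<^sub>R th p"
    using coframe_expansion[of \<eta>1 p] coframe_expansion[of \<eta>2 p]
    by (simp_all add: \<alpha>1_\<beta>1_\<alpha>2_\<beta>2_m_def add.commute)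
  have \<alpha>: "\<alpha>1 \<noteq> 0" "\<alpha>2 \<noteq> 0"
    using \<eta>1(2) \<eta>2(2) unfolding \<eta> by (auto simp: P_def inner_add)
  have cof: "cof_\<omega> y (tE p r u \<rho>) = r * (th p \<bullet> u)" "cof_\<omega>1 y (tE p r u \<rho>) = \<alpha>1 * (u1 p \<bullet> u) + \<beta>1 * (th p \<bullet> u)"
    "cof_\<omega>2 y (tE p r u \<rho>) = \<alpha>2 * (u2 p \<bullet> u) + \<beta>2 * (th p \<bullet> u)" "cof_\<phi> y (tE p r u \<rho>) = F \<bullet> tE p r u \<rho>" for u \<rho>
    unfolding y cof_\<omega>_def cof_\<omega>1_def cof_\<omega>2_def cof_\<phi>_def by (simp_all add: tautological_def tE_def inner_add \<eta> r)
  have d': "\<rho> * (th p \<bullet> u') - \<rho>' * (th p \<bullet> u) + r * ((u1 p \<bullet> u) * (u2 p \<bullet> u') - (u1 p \<bullet> u') * (u2 p \<bullet> u)) =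
      2 * ((F \<bullet> tE p r u \<rho>) * (r * (th p \<bullet> u')) - (F \<bullet> tE p r u' \<rho>') * (r * (th p \<bullet> u)))
      + ((\<alpha>1 * (u1 p \<bullet> u) + \<beta>1 * (th p \<bullet> u)) * (\<alpha>2 * (u2 p \<bullet> u') + \<beta>2 * (th p \<bullet> u'))
       - (\<alpha>1 * (u1 p \<bullet> u') + \<beta>1 * (th p \<bullet> u')) * (\<alpha>2 * (u2 p \<bullet> u) + \<beta>2 * (th p \<bullet> u)))" for u \<rho> u' \<rho>'
    using d[unfolded r(2), rule_format, OF tE_in_tangent_space[OF r(1)] tE_in_tangent_space[OF r(1)], of u \<rho> u' \<rho>']
    unfolding wedge_def cof ext_d_tautological_tE .
  \<comment> \<open>The equation for d\<omega> on the lifts of \<open>e1\<close> and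
    \<open>e2\<close>, where \<omega> vanishes.\<close>
  have r\<alpha>: "r = \<alpha>1 * \<alpha>2" using d'[of 0 "e2 p" 0 "e1 p"] by simp
  have \<phi>: "F \<bullet> tE p r u \<rho> = 1 / (2 * \<alpha>1 * \<alpha>2) * \<rho> + m * (th p \<bullet> u) + (- \<beta>2 / (2 * \<alpha>2)) * (u1 p \<bullet> u) + (\<beta>1 / (2 * \<alpha>1)) * (u2 p \<bullet> u)"
    for u \<rho>
  proof -
    \<comment> \<open>With the lift of \<open>th p\<close> as second vector the equation can be
      solved for \<phi> on the first.\<close>
    have "\<rho> = 2 * ((F \<bullet> tE p r u \<rho>) * r - m * (r * (th p \<bullet> u))) + (\<alpha>1 * (u1 p \<bullet> u) * \<beta>2 - \<beta>1 * \<alpha>2 * (u2 p \<bullet> u))"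
      using d'[of \<rho> "th p" 0 u] by (simp add: \<alpha>1_\<beta>1_\<alpha>2_\<beta>2_m_def(5) algebra_simps)
    then have "F \<bullet> tE p r u \<rho> = (\<rho> + 2 * \<alpha>1 * \<alpha>2 * m * (th p \<bullet> u) - \<alpha>1 * \<beta>2 * (u1 p \<bullet> u) + \<beta>1 * \<alpha>2 * (u2 p \<bullet> u)) / (2 * \<alpha>1 * \<alpha>2)"
      using \<alpha> by (simp add: eq_divide_eq r\<alpha> algebra_simps)
    also have "\<dots> = 1 / (2 * \<alpha>1 * \<alpha>2) * \<rho> + m * (th p \<bullet> u) + (- \<beta>2 / (2 * \<alpha>2)) * (u1 p \<bullet> u) + (\<beta>1 / (2 * \<alpha>1)) * (u2 p \<bullet> u)"
      using \<alpha> by (simp add: add_divide_distrib diff_divide_distrib)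
    finally show ?thesis .
  qed
  let ?G = "phi_vec p r (1 / (2 * \<alpha>1 * \<alpha>2)) m (- \<beta>2 / (2 * \<alpha>2)) (\<beta>1 / (2 * \<alpha>1))"
  have "F = ?G"
  proof (rule tangent_E_inner_eqI[OF r(1)])
    show "?G \<in> tangent_space (E_bundle P) (p, r *\<^sub>R th p)"
      using phi_vec_eq_tE tangent_space_E[OF r(1)] by blast
  qed (use F r(2) \<phi> phi_vec_inner_tE in auto)
  then have "y = ypt p (\<alpha>1 * \<alpha>2) \<alpha>1 \<alpha>2 \<beta>1 \<beta>2 (1 / (2 * \<alpha>1 * \<alpha>2)) m (- \<beta>2 / (2 * \<alpha>2)) (\<beta>1 / (2 * \<alpha>1))"
    unfolding ypt_def y \<eta>[symmetric] r\<alpha>[symmetric] r(2) by simp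
  with \<alpha> that show ?thesis by blast
qed

end

section \<open>The Borel group\<close>

lemma borel_group_iff: "h \<in> borel_group \<longleftrightarrow> upper_triangular h \<and> h $ 1 $ 1 * h $ 2 $ 2 * h $ 3 $ 3 = 1"
  by (auto simp: borel_group_def upper_triangular_def det_3)

lemma borel_group_upper:
  assumes "h \<in> borel_group"
  shows "h $ 2 $ 1 = 0" "h $ 3 $ 1 = 0" "h $ 3 $ 2 = 0"
  using assms by (auto simp: borel_group_def)

lemma borel_group_diag:
  assumes "h \<in> borel_group"
  shows "h $ 1 $ 1 * h $ 2 $ 2 * h $ 3 $ 3 = 1" "h $ 1 $ 1 \<noteq> 0" "h $ 2 $ 2 \<noteq> 0" "h $ 3 $ 3 \<noteq> 0"
  using assms by (auto simp: borel_group_iff)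

text \<open>The adjugate of an upper triangular matrix, which is the inverse when the determinant is
  1. Being polynomial it is smooth on all matrices.\<close>

definition uinv :: "real^3^3 \<Rightarrow> real^3^3" where
  "uinv k = vector [vector [k $ 2 $ 2 * k $ 3 $ 3, - k $ 1 $ 2 * k $ 3 $ 3, k $ 1 $ 2 * k $ 2 $ 3 - k $ 1 $ 3 * k $ 2 $ 2],
    vector [0, k $ 1 $ 1 * k $ 3 $ 3, - k $ 1 $ 1 * k $ 2 $ 3], vector [0, 0, k $ 1 $ 1 * k $ 2 $ 2]]"

lemma upper_triangular_uinv: "upper_triangular (uinv k)"
  by (simp add: uinv_def upper_triangular_def)

lemma uinv_inverse:
  assumes "k \<in> borel_group"
  shows "uinv k ** k = mat 1" "k ** uinv k = mat 1"
proof -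
  have d: "k $ 1 $ 1 * (k $ 2 $ 2 * k $ 3 $ 3) = 1"
    using borel_group_diag(1)[OF assms] by (simp add: mult.assoc)
  show "uinv k ** k = mat 1" "k ** uinv k = mat 1"
    by (simp_all add: mat3_eq_iff forall_3 matrix_matrix_mult_def sum_3 uinv_def mat_def borel_group_upper[OF assms])
      (simp_all add: algebra_simps d)
qed

lemma matrix_inv_borel:
  assumes "k \<in> borel_group"
  shows "matrix_inv k = uinv k"
proof -
  have "k ** matrix_inv k = mat 1 \<and> matrix_inv k ** k = mat 1"
    unfolding matrix_inv_def by (rule someI[of _ "uinv k"]) (simp add: uinv_inverse[OF assms])
  then have "uinv k ** (k ** matrix_inv k) = uinv k" by simp
  then show ?thesis by (simp add: matrix_mul_assoc uinv_inverse[OF assms])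
qed

lemma borel_group_mult:
  assumes "k \<in> borel_group" "h \<in> borel_group"
  shows "k ** h \<in> borel_group"
proof -
  have alt: "h \<in> borel_group \<longleftrightarrow> det h = 1 \<and> upper_triangular h" for h
    by (auto simp: borel_group_def upper_triangular_def)
  show ?thesis using assms upper_triangular_mult[of k h] unfolding alt det_mul by auto
qed

lemma uinv_mult:
  assumes "k \<in> borel_group" "h \<in> borel_group"
  shows "uinv (k ** h) = uinv h ** uinv k"
proof -
  have "(k ** h) ** (uinv h ** uinv k) = mat 1"
  proof -
    have "(k ** h) ** (uinv h ** uinv k) = k ** (h ** uinv h) ** uinv k" by (simp add: matrix_mul_assoc)
    then show ?thesis by (simp add: uinv_inverse assms)
  qed
  then have "uinv (k ** h) ** ((k ** h) ** (uinv h ** uinv k)) = uinv (k ** h)" by simp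
  then show ?thesis
    by (simp add: matrix_mul_assoc uinv_inverse(1)[OF borel_group_mult[OF assms], unfolded matrix_mul_assoc])
qed

lemma mat1_in_borel_group: "mat 1 \<in> borel_group"
  by (simp add: borel_group_iff upper_triangular_def mat_def)

text \<open>The part of a value of the connection that the tautological forms prescribe, in the
  order \<omega>, \<omega>1, \<omega>2, \<phi>.\<close>

definition low :: "real^3^3 \<Rightarrow> real \<times> real \<times> real \<times> real" where
  "low X = (X $ 3 $ 1, X $ 2 $ 1, X $ 3 $ 2, (X $ 1 $ 1 - X $ 3 $ 3) / 2)"

text \<open>The kernel of \<open>low\<close> consists of the upper triangular matrices with equal
  corner diagonal entries and is stable under this conjugation. Hence the action on coframes does
  not see the unknowns w, \<phi>1, \<phi>2, \<psi>.\<close>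

lemma low_conj_cong:
  assumes "upper_triangular h" "low X = low X'"
  shows "low (uinv h ** X ** h) = low (uinv h ** X' ** h)"
proof -
  have X: "X $ 3 $ 1 = X' $ 3 $ 1" "X $ 2 $ 1 = X' $ 2 $ 1" "X $ 3 $ 2 = X' $ 3 $ 2"
    "X $ 1 $ 1 = X' $ 1 $ 1 - X' $ 3 $ 3 + X $ 3 $ 3"
    using assms(2) by (auto simp: low_def)
  show ?thesis
    using assms(1) by (simp add: low_def matrix_matrix_mult_def sum_3 uinv_def upper_triangular_def X) (simp add: algebra_simps)
qed

lemma trace_conj_uinv: "k \<in> borel_group \<Longrightarrow> trace (uinv k ** X ** k) = trace X"
  using trace_mul_sym[of "uinv k ** X" k] by (simp add: matrix_mul_assoc uinv_inverse)

lemma trace_zero_pi_shape: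
  assumes "trace X = 0"
  shows "X = pi_shape (X $ 3 $ 1) (X $ 2 $ 1) (X $ 3 $ 2) ((X $ 1 $ 1 - X $ 3 $ 3) / 2) (- X $ 2 $ 2 / 2) (X $ 2 $ 3) (X $ 1 $ 2) (X $ 1 $ 3)"
  using assms by (simp add: mat3_eq_iff forall_3 trace_def sum_3 field_simps)

lemma has_vector_derivative_nth:
  fixes c :: "real \<Rightarrow> real^3^3"
  assumes "(c has_vector_derivative K) (at t)"
  shows "((\<lambda>t. c t $ i $ j) has_real_derivative K $ i $ j) (at t)"
  unfolding has_real_derivative_iff_has_vector_derivative
  using has_vector_derivative_compose[OF assms bounded_linear_imp_has_derivative[OF
      bounded_linear_compose[OF bounded_linear_vec_nth[of j] bounded_linear_vec_nth[of i]]]] by simp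

text \<open>The equations of the Borel group, differentiated along the curve. For the inverse taken
  at time 0, the second conclusion says that K c(0)^-1 has trace zero.\<close>

lemma borel_curve_derivative:
  fixes c :: "real \<Rightarrow> real^3^3"
  assumes "(c has_vector_derivative K) (at 0)" "e > 0" "\<And>t. t \<in> {-e<..<e} \<Longrightarrow> c t \<in> borel_group"
  shows "upper_triangular K"
    and "K $ 1 $ 1 * (c 0 $ 2 $ 2 * c 0 $ 3 $ 3) + K $ 2 $ 2 * (c 0 $ 1 $ 1 * c 0 $ 3 $ 3) + K $ 3 $ 3 * (c 0 $ 1 $ 1 * c 0 $ 2 $ 2) = 0"
proof -
  note d = has_vector_derivative_nth[OF assms(1)]
  have const: "D = 0" if "(g has_real_derivative D) (at 0)" "\<And>t. t \<in> {-e<..<e} \<Longrightarrow> g t = C" for g :: "real \<Rightarrow> real" and D C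
  proof -
    have "((\<lambda>t. C) has_real_derivative D) (at 0)"
      by (rule has_field_derivative_transform_within_open[OF that(1), of "{-e<..<e}"]) (use assms(2) that(2) in auto)
    then show ?thesis using DERIV_unique DERIV_const by blast
  qed
  show "upper_triangular K"
    unfolding upper_triangular_def
    using const[OF d[of 2 1], of 0] const[OF d[of 3 1], of 0] const[OF d[of 3 2], of 0] assms(3) by (simp add: borel_group_upper)
  have "((\<lambda>t. c t $ 1 $ 1 * c t $ 2 $ 2 * c t $ 3 $ 3) has_real_derivative
      (K $ 1 $ 1 * c 0 $ 2 $ 2 + K $ 2 $ 2 * c 0 $ 1 $ 1) * c 0 $ 3 $ 3 + K $ 3 $ 3 * (c 0 $ 1 $ 1 * c 0 $ 2 $ 2)) (at 0)"
    by (intro DERIV_mult d)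
  from const[OF this, of 1]
  show "K $ 1 $ 1 * (c 0 $ 2 $ 2 * c 0 $ 3 $ 3) + K $ 2 $ 2 * (c 0 $ 1 $ 1 * c 0 $ 3 $ 3) + K $ 3 $ 3 * (c 0 $ 1 $ 1 * c 0 $ 2 $ 2) = 0"
    using borel_group_diag(1)[OF assms(3)] by (simp add: algebra_simps)
qed

lemma smooth_on_matrix3:
  fixes F :: "'a::euclidean_space \<Rightarrow> real^3^3"
  assumes "open S" "\<And>i j. smooth_on S (\<lambda>x. F x $ i $ j)"
  shows "smooth_on S F"
  by (intro smooth_on_vec assms)

lemma smooth_on_uinv:
  assumes "open S" "smooth_on S F"
  shows "smooth_on S (\<lambda>x. uinv (F x))"
proof (rule smooth_on_matrix3[OF assms(1)])
  have "\<forall>i j. smooth_on S (\<lambda>x. uinv (F x) $ i $ j)"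
    unfolding forall_3 uinv_def by (simp, intro conjI smooth_on_intros assms)
  then show "smooth_on S (\<lambda>x. uinv (F x) $ i $ j)" for i j by blast
qed

definition borel_exp :: "real^3^3 \<Rightarrow> real \<Rightarrow> real^3^3" where
  "borel_exp B t = vector [vector [exp (t * B $ 1 $ 1), t * B $ 1 $ 2, t * B $ 1 $ 3],
    vector [0, exp (t * B $ 2 $ 2), t * B $ 2 $ 3], vector [0, 0, exp (t * B $ 3 $ 3)]]"

text \<open>Not a one-parameter group, only a curve in the Borel group with the given initial velocity.\<close>

lemma borel_exp:
  assumes "upper_triangular B" "trace B = 0"
  shows "borel_exp B t \<in> borel_group" "borel_exp B 0 = mat 1" "smooth_on UNIV (borel_exp B)"
    "(borel_exp B has_vector_derivative B) (at 0)"
proof -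
  have "exp (t * B $ 1 $ 1) * exp (t * B $ 2 $ 2) * exp (t * B $ 3 $ 3) = exp (t * trace B)"
    by (simp add: trace_def sum_3 exp_add distrib_left)
  then show "borel_exp B t \<in> borel_group"
    using assms(2) by (simp add: borel_exp_def borel_group_iff upper_triangular_def)
  show "borel_exp B 0 = mat 1"
    by (simp add: borel_exp_def mat3_eq_iff forall_3 mat_def)
  show sm: "smooth_on UNIV (borel_exp B)"
  proof (rule smooth_on_matrix3[OF open_UNIV])
    have "\<forall>i j. smooth_on UNIV (\<lambda>t. borel_exp B t $ i $ j)"
      unfolding forall_3 borel_exp_def by (simp, intro conjI smooth_on_intros open_UNIV)
    then show "smooth_on UNIV (\<lambda>t. borel_exp B t $ i $ j)" for i j by blast
  qed
  define D where "D = vector_derivative (borel_exp B) (at 0)"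
  have D: "(borel_exp B has_vector_derivative D) (at 0)"
    unfolding D_def using smooth_on_differentiable[OF open_UNIV sm UNIV_I]
    by (metis differentiableI_vector smooth_on_line_derivative[OF open_UNIV sm] vector_derivative_works)
  have nth: "((\<lambda>t. borel_exp B t $ i $ j) has_real_derivative D $ i $ j) (at 0)" for i j
    by (rule has_vector_derivative_nth[OF D])
  have e: "((\<lambda>t. exp (t * x)) has_real_derivative x) (at 0)" "((\<lambda>t. t * x) has_real_derivative x) (at 0)"
    "((\<lambda>t. 0) has_real_derivative 0) (at 0)" for x :: real
    by (auto intro!: derivative_eq_intros)
  have "\<forall>i j. ((\<lambda>t. borel_exp B t $ i $ j) has_real_derivative B $ i $ j) (at 0)"
    unfolding forall_3 borel_exp_def using assms(1) by (simp add: e upper_triangular_def)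
  then have "D = B" using nth DERIV_unique unfolding mat3_eq_iff by blast
  with D show "(borel_exp B has_vector_derivative B) (at 0)" by simp
qed

context torus_path
begin

section \<open>A global trivialization of Y\<close>

text \<open>On the Borel group this is k11/k33, the character by which \<open>k\<close> scales
  \<omega> and so the fibre coordinate of E.\<close>

definition rk :: "real^3^3 \<Rightarrow> real" where
  "rk k = (k $ 1 $ 1)\<^sup>2 * k $ 2 $ 2"

text \<open>\<open>sig p k\<close> is the image under \<open>k\<close> of the coframe of the adapted frame at \<open>p\<close>; the entries of \<open>k\<^sup>-\<^sup>1\<close> are
  rewritten with \<open>det k = 1\<close>, which makes the formula smooth in all matrices \<open>k\<close>.\<close>

definition sig :: "real^3 \<Rightarrow> real^3^3 \<Rightarrow> ypoint" where
  "sig p k = ypt p (rk k) ((k $ 1 $ 1)\<^sup>2 * k $ 3 $ 3) (k $ 1 $ 1 * (k $ 2 $ 2)\<^sup>2)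
    (- (k $ 2 $ 3 * (k $ 1 $ 1)\<^sup>2)) (k $ 1 $ 2 * k $ 1 $ 1 * k $ 2 $ 2)
    ((k $ 3 $ 3)\<^sup>2 * k $ 2 $ 2 / 2)
    (k $ 1 $ 1 * k $ 1 $ 2 * k $ 2 $ 3 / 2 - k $ 1 $ 1 * k $ 2 $ 2 * k $ 1 $ 3)
    (- (k $ 1 $ 2 * k $ 1 $ 1 * k $ 3 $ 3 / 2)) (- (k $ 2 $ 3 * k $ 1 $ 1 * k $ 2 $ 2 / 2))"

lemma fst_sig: "fst (sig p k) = (p, rk k *\<^sub>R th p)"
  by (simp add: sig_def ypt_def)

lemma rk_nonzero: "k \<in> borel_group \<Longrightarrow> rk k \<noteq> 0"
  using borel_group_diag by (simp add: rk_def)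

lemma rk_mult: "k \<in> borel_group \<Longrightarrow> h \<in> borel_group \<Longrightarrow> rk (k ** h) = rk h * rk k"
  by (simp add: rk_def matrix_matrix_mult_def sum_3 power2_eq_square borel_group_upper)

lemma sig_in_Y_bundle:
  assumes "k \<in> borel_group"
  shows "sig p k \<in> Y_bundle P"
proof -
  note d = borel_group_diag[OF assms]
  have "rk k = rk k * (k $ 1 $ 1 * k $ 2 $ 2 * k $ 3 $ 3)" using d by simp
  also have "\<dots> = (k $ 1 $ 1)\<^sup>2 * k $ 3 $ 3 * (k $ 1 $ 1 * (k $ 2 $ 2)\<^sup>2)" by (simp add: rk_def power2_eq_square)
  finally have r: "rk k = (k $ 1 $ 1)\<^sup>2 * k $ 3 $ 3 * (k $ 1 $ 1 * (k $ 2 $ 2)\<^sup>2)" .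
  have "2 * rk k * ((k $ 3 $ 3)\<^sup>2 * k $ 2 $ 2 / 2) = (k $ 1 $ 1 * k $ 2 $ 2 * k $ 3 $ 3)\<^sup>2"
    by (simp add: rk_def power2_eq_square)
  then have q: "2 * rk k * ((k $ 3 $ 3)\<^sup>2 * k $ 2 $ 2 / 2) = 1" by (simp add: d)
  show ?thesis
    unfolding sig_def
    by (rule ypt_in_Y_bundle[OF _ _ r q]) (use d in \<open>auto simp: rk_def power2_eq_square\<close>)
qed

text \<open>This certifies \<open>sig p k\<close> as the \<open>k\<close>-image of the coframe
  \<theta>, \<theta>'1, \<theta>'2, dr/2 at r = 1. With the factor \<open>rk k\<close> in front,
  \<rho> is the logarithmic speed of the fibre coordinate and is the same at all points of the
  fibre.\<close>

lemma cof_sig: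
  assumes "k \<in> borel_group" "low X = (th p \<bullet> u, u1 p \<bullet> u, u2 p \<bullet> u, \<rho> / 2)"
  shows "(cof_\<omega> (sig p k) (tE p (rk k) u (rk k * \<rho>)), cof_\<omega>1 (sig p k) (tE p (rk k) u (rk k * \<rho>)),
    cof_\<omega>2 (sig p k) (tE p (rk k) u (rk k * \<rho>)), cof_\<phi> (sig p k) (tE p (rk k) u (rk k * \<rho>))) = low (uinv k ** X ** k)"
proof -
  note d = borel_group_diag[OF assms(1)]
  have X: "th p \<bullet> u = X $ 3 $ 1" "u1 p \<bullet> u = X $ 2 $ 1" "u2 p \<bullet> u = X $ 3 $ 2" "\<rho> = X $ 1 $ 1 - X $ 3 $ 3"
    using assms(2) by (auto simp: low_def)
  have q: "(k $ 3 $ 3)\<^sup>2 * k $ 2 $ 2 / 2 * (rk k * \<rho>) = k $ 1 $ 1 * k $ 2 $ 2 * k $ 3 $ 3 * \<rho> / 2"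
  proof -
    have "(k $ 3 $ 3)\<^sup>2 * k $ 2 $ 2 / 2 * (rk k * \<rho>) = (k $ 1 $ 1 * k $ 2 $ 2 * k $ 3 $ 3)\<^sup>2 * \<rho> / 2"
      by (simp add: rk_def power2_eq_square)
    then show ?thesis by (simp add: d)
  qed
  show ?thesis
    unfolding sig_def cof_ypt q
    by (simp add: low_def matrix_matrix_mult_def sum_3 uinv_def borel_group_upper[OF assms(1)] X)
      (simp add: rk_def field_simps power2_eq_square)
qed

text \<open>\<open>al1\<close>, \<open>al2\<close>, \<open>be1\<close>, \<open>be2\<close>,
  \<open>mm\<close> read the parameters of \<open>ypt\<close> off by inner products. They are
  defined on the whole ambient space, so that \<open>hf\<close> and \<open>PI\<close> extend beyond
  Y.\<close>

definition al1 :: "ypoint \<Rightarrow> real" where "al1 y = fst (snd y) \<bullet> e1 (fst (fst y))"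
definition al2 :: "ypoint \<Rightarrow> real" where "al2 y = fst (snd (snd y)) \<bullet> e2 (fst (fst y))"
definition be1 :: "ypoint \<Rightarrow> real" where "be1 y = fst (snd y) \<bullet> th (fst (fst y))"
definition be2 :: "ypoint \<Rightarrow> real" where "be2 y = fst (snd (snd y)) \<bullet> th (fst (fst y))"
definition mm :: "ypoint \<Rightarrow> real" where "mm y = fst (snd (snd (snd y))) \<bullet> th (fst (fst y))"

lemma coords_ypt:
  "al1 (ypt p r \<alpha>1 \<alpha>2 \<beta>1 \<beta>2 q m x1 x2) = \<alpha>1" "al2 (ypt p r \<alpha>1 \<alpha>2 \<beta>1 \<beta>2 q m x1 x2) = \<alpha>2"
  "be1 (ypt p r \<alpha>1 \<alpha>2 \<beta>1 \<beta>2 q m x1 x2) = \<beta>1" "be2 (ypt p r \<alpha>1 \<alpha>2 \<beta>1 \<beta>2 q m x1 x2) = \<beta>2"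
  "mm (ypt p r \<alpha>1 \<alpha>2 \<beta>1 \<beta>2 q m x1 x2) = m" "fst (fst (ypt p r \<alpha>1 \<alpha>2 \<beta>1 \<beta>2 q m x1 x2)) = p"
  by (simp_all add: al1_def al2_def be1_def be2_def mm_def ypt_def inner_add phi_vec_def Let_def inner_frame)

text \<open>The Borel coordinate, obtained by solving the formulas of \<open>sig\<close> for
  \<open>k\<close>. As k11 k22 k33 = 1, the scale factors of \<omega>1 and \<omega>2 are k11/k22 and
  k22/k33; the second divided by the first is k22^3, whence the cube root.\<close>

definition hf :: "ypoint \<Rightarrow> real^3^3" where
  "hf y = (let k2 = root 3 (al2 y / al1 y); k1 = al1 y * k2; k3 = k2 / al2 y; k12 = be2 y * k3; k23 = - (be1 y / k1\<^sup>2)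
    in vector [vector [k1, k12, (k1 * k12 * k23 / 2 - mm y) * k3], vector [0, k2, k23], vector [0, 0, k3]])"

text \<open>An open neighbourhood of Y in the ambient space on which \<open>hf\<close> is smooth and
  takes values in the Borel group.\<close>

definition Ydom :: "ypoint set" where
  "Ydom = {y. al1 y \<noteq> 0 \<and> al2 y \<noteq> 0}"

lemma hf_in_borel_group:
  assumes "y \<in> Ydom"
  shows "hf y \<in> borel_group"
proof -
  have "al1 y \<noteq> 0" "al2 y \<noteq> 0" using assms by (auto simp: Ydom_def)
  moreover have "root 3 (al2 y / al1 y) ^ 3 = al2 y / al1 y" by (simp add: odd_real_root_pow)
  ultimately show ?thesis
    by (simp add: hf_def Let_def borel_group_iff upper_triangular_def power3_eq_cube field_simps)
qed

lemma sig_hf: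
  assumes "y \<in> Y_bundle P"
  shows "y \<in> Ydom" "sig (fst (fst y)) (hf y) = y"
proof -
  obtain p \<alpha>1 \<alpha>2 \<beta>1 \<beta>2 m where \<alpha>: "\<alpha>1 \<noteq> 0" "\<alpha>2 \<noteq> 0" and
    y: "y = ypt p (\<alpha>1 * \<alpha>2) \<alpha>1 \<alpha>2 \<beta>1 \<beta>2 (1 / (2 * \<alpha>1 * \<alpha>2)) m (- \<beta>2 / (2 * \<alpha>2)) (\<beta>1 / (2 * \<alpha>1))"
    using Y_bundle_cases[OF assms] .
  show "y \<in> Ydom" using \<alpha> by (simp add: Ydom_def y coords_ypt)
  \<comment> \<open>The middle diagonal entry of \<open>k\<close>. Expressing \<alpha>2 as \<alpha>1
    t^3 makes all remaining identities rational in \<alpha>1 and \<open>t\<close>.\<close>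
  define t where "t = root 3 (\<alpha>2 / \<alpha>1)"
  have t: "t \<noteq> 0" using \<alpha> by (simp add: t_def)
  have "t ^ 3 = \<alpha>2 / \<alpha>1" unfolding t_def by (simp add: odd_real_root_pow)
  then have t3: "\<alpha>2 = \<alpha>1 * t ^ 3" using \<alpha> by simp
  define k where "k = hf y"
  have k33: "t / \<alpha>2 = 1 / (\<alpha>1 * t\<^sup>2)"
    using \<alpha>(1) t by (simp add: t3 field_simps power2_eq_square power3_eq_cube)
  have k: "k $ 1 $ 1 = \<alpha>1 * t" "k $ 2 $ 2 = t" "k $ 3 $ 3 = 1 / (\<alpha>1 * t\<^sup>2)" "k $ 1 $ 2 = \<beta>2 * (1 / (\<alpha>1 * t\<^sup>2))"
    "k $ 2 $ 3 = - (\<beta>1 / (\<alpha>1 * t)\<^sup>2)"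
    "k $ 1 $ 3 = ((\<alpha>1 * t) * (\<beta>2 * (1 / (\<alpha>1 * t\<^sup>2))) * (- (\<beta>1 / (\<alpha>1 * t)\<^sup>2)) / 2 - m) * (1 / (\<alpha>1 * t\<^sup>2))"
    unfolding k_def hf_def y coords_ypt Let_def t_def[symmetric] k33 by simp_all
  have "rk k = \<alpha>1 * \<alpha>2" "(k $ 1 $ 1)\<^sup>2 * k $ 3 $ 3 = \<alpha>1" "k $ 1 $ 1 * (k $ 2 $ 2)\<^sup>2 = \<alpha>2"
    using \<alpha>(1) t unfolding rk_def k t3 by (simp_all add: power2_eq_square power3_eq_cube)
  moreover have "- (k $ 2 $ 3 * (k $ 1 $ 1)\<^sup>2) = \<beta>1" "k $ 1 $ 2 * k $ 1 $ 1 * k $ 2 $ 2 = \<beta>2"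
    using \<alpha>(1) t unfolding k by (simp_all add: power2_eq_square)
  moreover have "(k $ 3 $ 3)\<^sup>2 * k $ 2 $ 2 / 2 = 1 / (2 * \<alpha>1 * \<alpha>2)"
    using \<alpha>(1) t unfolding k t3 by (simp add: power2_eq_square power3_eq_cube)
  moreover have "- (k $ 1 $ 2 * k $ 1 $ 1 * k $ 3 $ 3 / 2) = - \<beta>2 / (2 * \<alpha>2)"
    using \<alpha>(1) t unfolding k t3 by (simp add: power2_eq_square power3_eq_cube)
  moreover have "- (k $ 2 $ 3 * k $ 1 $ 1 * k $ 2 $ 2 / 2) = \<beta>1 / (2 * \<alpha>1)"
    using \<alpha>(1) t unfolding k by (simp add: power2_eq_square)
  moreover have "k $ 1 $ 1 * k $ 1 $ 2 * k $ 2 $ 3 / 2 - k $ 1 $ 1 * k $ 2 $ 2 * k $ 1 $ 3 = m"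
  proof -
    have "(\<alpha>1 * t) * t * (z * (1 / (\<alpha>1 * t\<^sup>2))) = z" for z
      using \<alpha>(1) t by (simp add: power2_eq_square)
    then show ?thesis unfolding k by simp
  qed
  ultimately have "sig p k = y" unfolding sig_def y by (simp only:)
  then show "sig (fst (fst y)) (hf y) = y" by (simp add: k_def y coords_ypt)
qed

lemma hf_sig:
  assumes "k \<in> borel_group"
  shows "hf (sig p k) = k"
proof -
  note d = borel_group_diag[OF assms]
  have k33: "k $ 3 $ 3 = 1 / (k $ 1 $ 1 * k $ 2 $ 2)" using d by (simp add: field_simps)
  have "k $ 1 $ 1 * (k $ 2 $ 2)\<^sup>2 / ((k $ 1 $ 1)\<^sup>2 * k $ 3 $ 3) = k $ 2 $ 2 ^ 3"
    using d(2,3) by (simp add: k33 field_simps power2_eq_square power3_eq_cube)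
  then have t: "root 3 (k $ 1 $ 1 * (k $ 2 $ 2)\<^sup>2 / ((k $ 1 $ 1)\<^sup>2 * k $ 3 $ 3)) = k $ 2 $ 2"
    by (simp add: odd_real_root_power_cancel)
  show ?thesis
    unfolding hf_def sig_def coords_ypt t Let_def
    using d(2,3) by (simp add: mat3_eq_iff forall_3 borel_group_upper[OF assms]) (simp add: k33 field_simps power2_eq_square)
qed

lemma smooth_on_sig:
  assumes "open S" "smooth_on S p" "smooth_on S k"
  shows "smooth_on S (\<lambda>x. sig (p x) (k x))"
proof -
  have nz: "1 + (rk (k x))\<^sup>2 * N\<^sup>2 \<noteq> 0" for x
    using add_pos_nonneg[of 1 "(rk (k x))\<^sup>2 * N\<^sup>2"] by force
  have rk: "smooth_on S (\<lambda>x. rk (k x))"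
    unfolding rk_def by (intro smooth_on_intros assms)
  show ?thesis
    unfolding sig_def ypt_def phi_vec_def Let_def
    by (intro smooth_on_Pair smooth_on_add smooth_on_diff smooth_on_minus smooth_on_scaleR smooth_on_divide smooth_on_mult smooth_on_power
      smooth_on_nth smooth_on_frame smooth_on_const rk assms nz) simp_all
qed

lemma smooth_coords: "smooth_on UNIV al1" "smooth_on UNIV al2" "smooth_on UNIV be1" "smooth_on UNIV be2" "smooth_on UNIV mm"
  unfolding al1_def[abs_def] al2_def[abs_def] be1_def[abs_def] be2_def[abs_def] mm_def[abs_def]
  by (intro smooth_on_inner smooth_on_frame smooth_on_fst smooth_on_snd smooth_on_id open_UNIV)+

lemma open_Ydom: "open Ydom"
  unfolding Ydom_def by (intro open_Collect_conj open_Collect_neq continuous_on_const smooth_on_continuous_on smooth_coords)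

lemma smooth_hf: "smooth_on Ydom hf"
proof (rule smooth_on_matrix3[OF open_Ydom])
  note coords = smooth_coords[THEN smooth_on_subset[OF open_Ydom open_UNIV _ subset_UNIV]]
  have "\<forall>i j. smooth_on Ydom (\<lambda>y. hf y $ i $ j)"
    unfolding forall_3 hf_def Let_def
    by (simp, intro conjI smooth_on_minus smooth_on_diff smooth_on_mult smooth_on_divide smooth_on_power smooth_on_root3 smooth_on_const coords open_Ydom)
      (auto simp: Ydom_def)
  then show "smooth_on Ydom (\<lambda>y. hf y $ i $ j)" for i j by blast
qed

lemma hf_has_derivative: "y \<in> Ydom \<Longrightarrow> (hf has_derivative frechet_derivative hf (at y)) (at y)"
  by (rule smooth_on_has_derivative[OF open_Ydom smooth_hf])

section \<open>The action of the Borel group on Y\<close>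

text \<open>In the trivialization the action is right multiplication: the coframe at
  \<open>sig p k\<close> is the lower part of a matrix conjugated by \<open>k\<close>, and
  conjugating further by \<open>h\<close> amounts to conjugating by \<open>k ** h\<close>.\<close>

lemma act_rel_sig:
  assumes k: "k \<in> borel_group" and h: "h \<in> borel_group"
  shows "act_rel P h (sig p k) (sig p (k ** h))"
proof -
  note kh = borel_group_mult[OF k h]
  have cof: "cof_\<omega> (sig p (k ** h)) (u, rk h *\<^sub>R v) = Z $ 3 $ 1 \<and>
             cof_\<omega>1 (sig p (k ** h)) (u, rk h *\<^sub>R v) = Z $ 2 $ 1 \<and>
             cof_\<omega>2 (sig p (k ** h)) (u, rk h *\<^sub>R v) = Z $ 3 $ 2 \<and>
             cof_\<phi> (sig p (k ** h)) (u, rk h *\<^sub>R v) = (Z $ 1 $ 1 - Z $ 3 $ 3) / 2"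
    if uv: "(u, v) \<in> tangent_space (E_bundle P) (fst (sig p k))"
      and X: "X = pi_shape (cof_\<omega> (sig p k) (u, v)) (cof_\<omega>1 (sig p k) (u, v)) (cof_\<omega>2 (sig p k) (u, v)) (cof_\<phi> (sig p k) (u, v)) w \<phi>1 \<phi>2 \<psi>"
      and Z: "Z = matrix_inv h ** X ** h" for u v w \<phi>1 \<phi>2 \<psi> X Z
  proof -
    obtain \<rho>' where "(u, v) = tE p (rk k) u \<rho>'"
      using uv unfolding fst_sig tangent_space_E[OF rk_nonzero[OF k]] by (auto simp: tE_def)
    moreover define \<rho> where "\<rho> = \<rho>' / rk k"
    ultimately have uv': "(u, v) = tE p (rk k) u (rk k * \<rho>)" using rk_nonzero[OF k] by simp
    then have uv'': "(u, rk h *\<^sub>R v) = tE p (rk (k ** h)) u (rk (k ** h) * \<rho>)"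
      by (simp add: tE_def rk_mult[OF k h] scaleR_add_right mult.assoc)
    define X0 where "X0 = pi_shape (th p \<bullet> u) (u1 p \<bullet> u) (u2 p \<bullet> u) (\<rho> / 2) 0 0 0 0"
    have X0: "low X0 = (th p \<bullet> u, u1 p \<bullet> u, u2 p \<bullet> u, \<rho> / 2)" by (simp add: X0_def low_def)
    have "low X = (cof_\<omega> (sig p k) (u, v), cof_\<omega>1 (sig p k) (u, v), cof_\<omega>2 (sig p k) (u, v), cof_\<phi> (sig p k) (u, v))"
      by (simp add: X low_def)
    also have "\<dots> = low (uinv k ** X0 ** k)" unfolding uv' by (rule cof_sig[OF k X0])
    finally have "low Z = low (uinv h ** (uinv k ** X0 ** k) ** h)"
      unfolding Z matrix_inv_borel[OF h] using h by (intro low_conj_cong) (auto simp: borel_group_iff)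
    also have "\<dots> = low (uinv (k ** h) ** X0 ** (k ** h))"
      by (simp add: uinv_mult[OF k h] matrix_mul_assoc)
    also have "\<dots> = (cof_\<omega> (sig p (k ** h)) (u, rk h *\<^sub>R v), cof_\<omega>1 (sig p (k ** h)) (u, rk h *\<^sub>R v),
        cof_\<omega>2 (sig p (k ** h)) (u, rk h *\<^sub>R v), cof_\<phi> (sig p (k ** h)) (u, rk h *\<^sub>R v))"
      unfolding uv'' by (rule cof_sig[OF kh X0, symmetric])
    finally show ?thesis by (simp add: low_def)
  qed
  show ?thesis
    unfolding act_rel_def
  proof (intro conjI exI[of _ "rk h"])
    show "sig p (k ** h) \<in> Y_bundle P" by (rule sig_in_Y_bundle[OF kh])
    show "fst (sig p (k ** h)) = (fst (fst (sig p k)), rk h *\<^sub>R snd (fst (sig p k)))"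
      by (simp add: fst_sig rk_mult[OF k h])
  qed (unfold Let_def, intro allI impI, rule cof[OF _ refl refl])
qed

text \<open>All conditions prescribe values through the same matrices \<open>Z\<close>, which depend
  on the original point only. The value of \<omega> fixes \<open>r\<close>, the values of \<omega>1
  and \<omega>2 fix the two covectors, and a tangent representative of \<phi> is fixed by its inner
  products with the tangent space.\<close>

lemma act_rel_unique:
  assumes k: "k \<in> borel_group" and y: "act_rel P h (sig p k) y" and y': "act_rel P h (sig p k) y'"
  shows "y = y'"
proof -
  have TE: "tE p (rk k) u \<rho> \<in> tangent_space (E_bundle P) (fst (sig p k))" for u \<rho>
    unfolding fst_sig using tangent_space_E[OF rk_nonzero[OF k]] by blast
  define Z where "Z u v = matrix_inv h ** pi_shape (cof_\<omega> (sig p k) (u, v)) (cof_\<omega>1 (sig p k) (u, v))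
      (cof_\<omega>2 (sig p k) (u, v)) (cof_\<phi> (sig p k) (u, v)) 0 0 0 0 ** h" for u v
  have act_props: "\<exists>r. r \<noteq> 0 \<and> fst y = (p, (r * rk k) *\<^sub>R th p) \<and>
      snd (snd (snd y)) \<in> tangent_space (E_bundle P) (p, (r * rk k) *\<^sub>R th p) \<and>
      (\<forall>u. (r * rk k) *\<^sub>R th p \<bullet> u = Z u (snd (tE p (rk k) u 0)) $ 3 $ 1) \<and>
      (\<forall>u. fst (snd y) \<bullet> u = Z u (snd (tE p (rk k) u 0)) $ 2 $ 1) \<and>
      (\<forall>u. fst (snd (snd y)) \<bullet> u = Z u (snd (tE p (rk k) u 0)) $ 3 $ 2) \<and>
      (\<forall>u \<rho>. snd (snd (snd y)) \<bullet> tE p (r * rk k) u (r * \<rho>) =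
        (Z u (snd (tE p (rk k) u \<rho>)) $ 1 $ 1 - Z u (snd (tE p (rk k) u \<rho>)) $ 3 $ 3) / 2)"
    if act: "act_rel P h (sig p k) y" for y
  proof -
    obtain r where Y: "y \<in> Y_bundle P" and r: "fst y = (p, (r * rk k) *\<^sub>R th p)"
      and cof: "\<And>u v. (u, v) \<in> tangent_space (E_bundle P) (fst (sig p k)) \<Longrightarrow>
        cof_\<omega> y (u, r *\<^sub>R v) = Z u v $ 3 $ 1 \<and> cof_\<omega>1 y (u, r *\<^sub>R v) = Z u v $ 2 $ 1 \<and>
        cof_\<omega>2 y (u, r *\<^sub>R v) = Z u v $ 3 $ 2 \<and> cof_\<phi> y (u, r *\<^sub>R v) = (Z u v $ 1 $ 1 - Z u v $ 3 $ 3) / 2"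
      using act unfolding act_rel_def Let_def Z_def fst_sig by fastforce
    have mem: "fst y \<in> E_bundle P" "snd (snd (snd y)) \<in> tangent_space (E_bundle P) (fst y)"
      using Y unfolding Y_bundle_def by auto
    have "r \<noteq> 0"
    proof
      assume "r = 0"
      then have "(p, 0) \<in> E_bundle P" using mem(1) r by simp
      then obtain s where "s \<noteq> 0" "0 = s *\<^sub>R th p" by (auto simp: E_bundle_P)
      then show False using dual_frame(1)[of p] by auto
    qed
    have tE: "(u, snd (tE p (rk k) u \<rho>)) = tE p (rk k) u \<rho>" "(u, r *\<^sub>R snd (tE p (rk k) u \<rho>)) = tE p (r * rk k) u (r * \<rho>)" for u \<rho>
      by (simp_all add: tE_def scaleR_add_right mult.assoc)
    have TE': "(u, snd (tE p (rk k) u \<rho>)) \<in> tangent_space (E_bundle P) (fst (sig p k))" for u \<rho>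
      unfolding tE(1) by (rule TE)
    note cofs = cof[OF TE']
    show ?thesis
    proof (intro exI[of _ r] conjI allI)
      show "snd (snd (snd y)) \<in> tangent_space (E_bundle P) (p, (r * rk k) *\<^sub>R th p)"
        using mem(2) unfolding r .
      fix u \<rho>
      show "(r * rk k) *\<^sub>R th p \<bullet> u = Z u (snd (tE p (rk k) u 0)) $ 3 $ 1"
        using cofs[of u 0, THEN conjunct1] unfolding cof_\<omega>_def tautological_def r fst_conv snd_conv .
      show "fst (snd y) \<bullet> u = Z u (snd (tE p (rk k) u 0)) $ 2 $ 1"
        using cofs[of u 0, THEN conjunct2, THEN conjunct1] unfolding cof_\<omega>1_def fst_conv .
      show "fst (snd (snd y)) \<bullet> u = Z u (snd (tE p (rk k) u 0)) $ 3 $ 2"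
        using cofs[of u 0, THEN conjunct2, THEN conjunct2, THEN conjunct1] unfolding cof_\<omega>2_def fst_conv .
      show "snd (snd (snd y)) \<bullet> tE p (r * rk k) u (r * \<rho>) =
          (Z u (snd (tE p (rk k) u \<rho>)) $ 1 $ 1 - Z u (snd (tE p (rk k) u \<rho>)) $ 3 $ 3) / 2"
        using cofs[of u \<rho>, THEN conjunct2, THEN conjunct2, THEN conjunct2] unfolding cof_\<phi>_def tE(2) .
    qed (fact \<open>r \<noteq> 0\<close> r)+
  qed
  obtain r r' where r: "r \<noteq> 0" "fst y = (p, (r * rk k) *\<^sub>R th p)"
      "snd (snd (snd y)) \<in> tangent_space (E_bundle P) (p, (r * rk k) *\<^sub>R th p)"
      "\<forall>u. (r * rk k) *\<^sub>R th p \<bullet> u = Z u (snd (tE p (rk k) u 0)) $ 3 $ 1"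
      "\<forall>u. fst (snd y) \<bullet> u = Z u (snd (tE p (rk k) u 0)) $ 2 $ 1"
      "\<forall>u. fst (snd (snd y)) \<bullet> u = Z u (snd (tE p (rk k) u 0)) $ 3 $ 2"
      "\<forall>u \<rho>. snd (snd (snd y)) \<bullet> tE p (r * rk k) u (r * \<rho>) =
        (Z u (snd (tE p (rk k) u \<rho>)) $ 1 $ 1 - Z u (snd (tE p (rk k) u \<rho>)) $ 3 $ 3) / 2"
    and r': "fst y' = (p, (r' * rk k) *\<^sub>R th p)"
      "snd (snd (snd y')) \<in> tangent_space (E_bundle P) (p, (r' * rk k) *\<^sub>R th p)"
      "\<forall>u. (r' * rk k) *\<^sub>R th p \<bullet> u = Z u (snd (tE p (rk k) u 0)) $ 3 $ 1"
      "\<forall>u. fst (snd y') \<bullet> u = Z u (snd (tE p (rk k) u 0)) $ 2 $ 1"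
      "\<forall>u. fst (snd (snd y')) \<bullet> u = Z u (snd (tE p (rk k) u 0)) $ 3 $ 2"
      "\<forall>u \<rho>. snd (snd (snd y')) \<bullet> tE p (r' * rk k) u (r' * \<rho>) =
        (Z u (snd (tE p (rk k) u \<rho>)) $ 1 $ 1 - Z u (snd (tE p (rk k) u \<rho>)) $ 3 $ 3) / 2"
    using act_props[OF y] act_props[OF y'] by blast
  have eqI: "x = x'" if "\<forall>u. x \<bullet> u = g u" "\<forall>u. x' \<bullet> u = g u" for x x' :: "real^3" and g
    using that vector_eq_rdot[of x x'] by simp
  have "(r * rk k) *\<^sub>R th p = (r' * rk k) *\<^sub>R th p" by (rule eqI[OF r(4) r'(3)])
  moreover have "th p \<noteq> 0" using dual_frame(1)[of p] by (metis inner_zero_left zero_neq_one)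
  ultimately have rr: "r' = r" using rk_nonzero[OF k] by simp
  have "snd (snd (snd y)) = snd (snd (snd y'))"
  proof (rule tangent_E_inner_eqI)
    show "r * rk k \<noteq> 0" using r(1) rk_nonzero[OF k] by simp
    show "snd (snd (snd y)) \<in> tangent_space (E_bundle P) (p, (r * rk k) *\<^sub>R th p)"
      "snd (snd (snd y')) \<in> tangent_space (E_bundle P) (p, (r * rk k) *\<^sub>R th p)"
      using r(3) r'(2) rr by auto
    show "snd (snd (snd y)) \<bullet> tE p (r * rk k) u \<rho> = snd (snd (snd y')) \<bullet> tE p (r * rk k) u \<rho>" for u \<rho>
      using r(7)[rule_format, of u "\<rho> / r"] r'(6)[rule_format, of u "\<rho> / r"] r(1) rr by simp
  qed
  moreover have "fst (snd y) = fst (snd y')" by (rule eqI[OF r(5) r'(4)])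
  moreover have "fst (snd (snd y)) = fst (snd (snd y'))" by (rule eqI[OF r(6) r'(5)])
  moreover have "fst y = fst y'" using r(2) r'(1) rr by simp
  ultimately show ?thesis by (simp add: prod_eq_iff)
qed

lemma act_sig:
  assumes "k \<in> borel_group" "h \<in> borel_group"
  shows "act P h (sig p k) = sig p (k ** h)"
  unfolding act_def using act_rel_sig[OF assms] act_rel_unique[OF assms(1)] by blast

section \<open>The Cartan connection\<close>

definition PI :: "ypoint \<Rightarrow> ypoint \<Rightarrow> real^3^3" where
  "PI y v = uinv (hf y) ** (A (fst (fst y)) (fst (fst v)) ** hf y + frechet_derivative hf (at y) v)"

definition Apull :: "ypoint \<Rightarrow> ypoint \<Rightarrow> real^3^3" where
  "Apull y v = A (fst (fst y)) (fst (fst v))"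

lemma Apull_eq_pullback: "Apull = pullback (\<lambda>y. fst (fst y)) A"
  and frechet_derivative_base: "frechet_derivative (\<lambda>y. fst (fst y)) (at (y :: ypoint)) v = fst (fst v)"
proof -
  have bl: "bounded_linear (\<lambda>y :: ypoint. fst (fst y))"
    by (intro bounded_linear_compose[OF bounded_linear_fst bounded_linear_fst])
  show *: "frechet_derivative (\<lambda>y. fst (fst y)) (at (y :: ypoint)) v = fst (fst v)" for y v
    by (rule frechet_derivative_eqI[OF bounded_linear_imp_has_derivative[OF bl]])
  show "Apull = pullback (\<lambda>y. fst (fst y)) A"
    by (simp add: fun_eq_iff Apull_def pullback_def *)
qed

lemma smooth_base: "smooth_on UNIV (\<lambda>y :: ypoint. fst (fst y))"
  by (intro smooth_on_fst smooth_on_id open_UNIV)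

lemma smooth_form_Apull: "smooth_form Ydom Apull"
  unfolding Apull_eq_pullback
  by (rule smooth_form_pullback[OF open_Ydom _ open_UNIV smooth_form_A[OF open_UNIV]])
    (auto intro: smooth_on_subset[OF open_Ydom open_UNIV smooth_base])

lemma smooth_form_PI: "smooth_form Ydom PI"
  unfolding smooth_form_def
proof (intro conjI ballI allI)
  fix y assume y: "y \<in> Ydom"
  have lA: "linear (Apull y)" and lh: "linear (frechet_derivative hf (at y))"
    using smooth_form_linear[OF smooth_form_Apull y] frechet_derivative_linear[OF open_Ydom smooth_hf y] by auto
  have "PI y v = uinv (hf y) ** (Apull y v ** hf y + frechet_derivative hf (at y) v)" for v
    by (simp add: PI_def Apull_def)
  then show "linear (PI y)"
    by (intro linearI) (simp_all add: linear_add[OF lA] linear_add[OF lh] linear_scale[OF lA] linear_scale[OF lh]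
      matrix_add_distrib bounded_bilinear.scaleR_left[OF bounded_bilinear_matrix_matrix_mult]
      bounded_bilinear.scaleR_right[OF bounded_bilinear_matrix_matrix_mult] scaleR_add_right algebra_simps)
next
  fix v
  show "smooth_on Ydom (\<lambda>y. PI y v)"
    unfolding PI_def Apull_def[symmetric]
    by (intro smooth_on_matrix_mult smooth_on_add smooth_on_uinv smooth_hf open_Ydom
      smooth_on_frechet_derivative smooth_form_smooth_on[OF smooth_form_Apull])
qed

lemma PI_gauge:
  assumes "y \<in> Ydom"
  shows "hf y ** PI y v = Apull y v ** hf y + frechet_derivative hf (at y) v"
proof -
  have "hf y ** PI y v = (hf y ** uinv (hf y)) ** (Apull y v ** hf y + frechet_derivative hf (at y) v)"
    by (simp only: PI_def Apull_def matrix_mul_assoc)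
  then show ?thesis by (simp add: uinv_inverse[OF hf_in_borel_group[OF assms]])
qed

text \<open>\<open>PI\<close> is the gauge transform of \<open>Apull\<close> by \<open>hf\<close>,
  and curvature commutes with pullback along the base projection.\<close>

lemma curv_PI:
  assumes "y \<in> Ydom"
  shows "curv PI y u v = uinv (hf y) ** curv A (fst (fst y)) (fst (fst u)) (fst (fst v)) ** hf y"
proof -
  note inv = uinv_inverse[OF hf_in_borel_group[OF assms]]
  have "hf y ** curv PI y u v = curv Apull y u v ** hf y"
    by (rule curv_gauge[OF open_Ydom smooth_hf smooth_form_PI smooth_form_Apull PI_gauge assms])
  moreover have "curv Apull y u v = curv A (fst (fst y)) (fst (fst u)) (fst (fst v))"
    unfolding Apull_eq_pullback
    by (subst curv_pullback[OF open_UNIV smooth_base open_UNIV smooth_form_A[OF open_UNIV]]) (simp_all add: frechet_derivative_base)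
  ultimately have "uinv (hf y) ** (hf y ** curv PI y u v) = uinv (hf y) ** (curv A (fst (fst y)) (fst (fst u)) (fst (fst v)) ** hf y)"
    by simp
  then show ?thesis by (simp add: matrix_mul_assoc inv)
qed

text \<open>Evaluates \<open>PI\<close> along a curve given in the trivialization. \<open>F\<close>
  has to agree with \<open>sig\<close> only near 0, since curves in the Borel group, and with them
  the known values of \<open>act\<close>, are controlled only there.\<close>

lemma PI_sig_curve:
  assumes p: "(p has_vector_derivative u) (at 0)" and \<kappa>: "(\<kappa> has_vector_derivative K) (at 0)"
    and e: "e > 0" "\<And>t. t \<in> {-e<..<e} \<Longrightarrow> \<kappa> t \<in> borel_group \<and> F t = sig (p t) (\<kappa> t)"
  obtains w where "(F has_vector_derivative w) (at 0)" "fst (fst w) = u" "frechet_derivative hf (at (F 0)) w = K"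
    "PI (F 0) w = uinv (\<kappa> 0) ** (A (p 0) u ** \<kappa> 0 + K)"
    "w = frechet_derivative (\<lambda>(p, k). sig p k) (at (p 0, \<kappa> 0)) (u, K)"
proof -
  have sm: "smooth_on UNIV (\<lambda>(p, k). sig p k)"
    unfolding split_beta by (intro smooth_on_sig smooth_on_fst smooth_on_snd smooth_on_id open_UNIV)
  define w where "w = frechet_derivative (\<lambda>(p, k). sig p k) (at (p 0, \<kappa> 0)) (u, K)"
  have nb: "open {-e<..<e}" "0 \<in> {-e<..<e}" using e(1) by auto
  have pk: "((\<lambda>t. (p t, \<kappa> t)) has_vector_derivative (u, K)) (at 0)"
    by (rule has_vector_derivative_Pair[OF p \<kappa>])
  have sg: "((\<lambda>t. sig (p t) (\<kappa> t)) has_vector_derivative w) (at 0)"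
    unfolding w_def using has_vector_derivative_compose[OF pk smooth_on_has_derivative[OF open_UNIV sm UNIV_I]] by simp
  have F: "(F has_vector_derivative w) (at 0)"
    by (rule has_vector_derivative_transform_within_open[OF sg nb]) (use e(2) in auto)
  have F0: "F 0 = sig (p 0) (\<kappa> 0)" "\<kappa> 0 \<in> borel_group" using e(2)[of 0] e(1) by auto
  have base: "fst (fst w) = u"
  proof -
    have "((\<lambda>t. fst (fst (F t))) has_vector_derivative fst (fst w)) (at 0)"
      using has_vector_derivative_compose[OF F bounded_linear_imp_has_derivative[OF bounded_linear_compose[OF bounded_linear_fst bounded_linear_fst]]] .
    moreover have "((\<lambda>t. fst (fst (F t))) has_vector_derivative u) (at 0)"
      by (rule has_vector_derivative_transform_within_open[OF p nb]) (use e(2) in \<open>auto simp: fst_sig\<close>)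
    ultimately show ?thesis using vector_derivative_unique_at by blast
  qed
  have Ydom: "F 0 \<in> Ydom" unfolding F0 using sig_hf(1)[OF sig_in_Y_bundle[OF F0(2)]] .
  have Dh: "frechet_derivative hf (at (F 0)) w = K"
  proof -
    have "((\<lambda>t. hf (F t)) has_vector_derivative frechet_derivative hf (at (F 0)) w) (at 0)"
      by (rule has_vector_derivative_compose[OF F hf_has_derivative[OF Ydom]])
    moreover have "((\<lambda>t. hf (F t)) has_vector_derivative K) (at 0)"
      by (rule has_vector_derivative_transform_within_open[OF \<kappa> nb]) (use e(2) hf_sig in auto)
    ultimately show ?thesis using vector_derivative_unique_at by blast
  qed
  have "PI (F 0) w = uinv (\<kappa> 0) ** (A (p 0) u ** \<kappa> 0 + K)"
    by (simp add: PI_def base Dh) (simp add: F0 hf_sig fst_sig)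
  with F base Dh w_def that show ?thesis by blast
qed

lemma Y_curve:
  assumes "curve_at (Y_bundle P) y v \<gamma>"
  obtains e where "e > 0" "\<And>t. t \<in> {-e<..<e} \<Longrightarrow> \<gamma> t \<in> Y_bundle P" "\<gamma> 0 = y" "(\<gamma> has_vector_derivative v) (at 0)"
    "((\<lambda>t. fst (fst (\<gamma> t))) has_vector_derivative fst (fst v)) (at 0)"
    "((\<lambda>t. hf (\<gamma> t)) has_vector_derivative frechet_derivative hf (at y) v) (at 0)"
    "\<And>t. t \<in> {-e<..<e} \<Longrightarrow> hf (\<gamma> t) \<in> borel_group \<and> \<gamma> t = sig (fst (fst (\<gamma> t))) (hf (\<gamma> t))"
proof -
  obtain e where e: "e > 0" "\<And>t. t \<in> {-e<..<e} \<Longrightarrow> \<gamma> t \<in> Y_bundle P" and \<gamma>: "\<gamma> 0 = y" "(\<gamma> has_vector_derivative v) (at 0)"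
    using assms unfolding curve_at_def by blast
  have "y \<in> Ydom" using e(2)[of 0] e(1) \<gamma>(1) sig_hf(1) by auto
  then have hf: "((\<lambda>t. hf (\<gamma> t)) has_vector_derivative frechet_derivative hf (at y) v) (at 0)"
    using has_vector_derivative_compose[OF \<gamma>(2) hf_has_derivative] \<gamma>(1) by simp
  have base: "((\<lambda>t. fst (fst (\<gamma> t))) has_vector_derivative fst (fst v)) (at 0)"
    using has_vector_derivative_compose[OF \<gamma>(2) bounded_linear_imp_has_derivative[OF bounded_linear_compose[OF bounded_linear_fst bounded_linear_fst]]] .
  have sig: "hf (\<gamma> t) \<in> borel_group \<and> \<gamma> t = sig (fst (fst (\<gamma> t))) (hf (\<gamma> t))" if "t \<in> {-e<..<e}" for t
    using sig_hf[OF e(2)[OF that]] hf_in_borel_group by simp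
  show ?thesis by (rule that[OF e \<gamma> base hf sig])
qed

text \<open>\<open>L\<close> is dk k^-1 for the Borel coordinate k and lies in the Lie algebra of
  the Borel group. Base velocity and dk determine the vector, as the curve is the
  \<open>sig\<close>-image of its coordinates; the fibre coordinate is \<open>rk\<close>, equal to
  k11/k33, whose logarithmic derivative is L11 - L33.\<close>

lemma tangent_space_Y:
  assumes "y \<in> Y_bundle P" "v \<in> tangent_space (Y_bundle P) y"
  defines "L \<equiv> frechet_derivative hf (at y) v ** uinv (hf y)"
  shows "upper_triangular L" "trace L = 0"
    and "fst v = tE (fst (fst y)) (rk (hf y)) (fst (fst v)) (rk (hf y) * (L $ 1 $ 1 - L $ 3 $ 3))"
    and "fst v \<in> tangent_space (E_bundle P) (fst y)"
    and "v = frechet_derivative (\<lambda>(p, k). sig p k) (at (fst (fst y), hf y)) (fst (fst v), frechet_derivative hf (at y) v)"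
    and "PI y v = uinv (hf y) ** (A (fst (fst y)) (fst (fst v)) + L) ** hf y"
proof -
  obtain \<gamma> where \<gamma>: "curve_at (Y_bundle P) y v \<gamma>" using assms(2) unfolding tangent_space_def by blast
  define p k K where "p = fst (fst y)" "k = hf y" "K = frechet_derivative hf (at y) v"
  obtain e where e: "e > 0" "\<And>t. t \<in> {-e<..<e} \<Longrightarrow> \<gamma> t \<in> Y_bundle P" and \<gamma>0: "\<gamma> 0 = y" and \<gamma>': "(\<gamma> has_vector_derivative v) (at 0)"
    and dp: "((\<lambda>t. fst (fst (\<gamma> t))) has_vector_derivative fst (fst v)) (at 0)"
    and dk0: "((\<lambda>t. hf (\<gamma> t)) has_vector_derivative frechet_derivative hf (at y) v) (at 0)"
    and sig: "\<And>t. t \<in> {-e<..<e} \<Longrightarrow> hf (\<gamma> t) \<in> borel_group \<and> \<gamma> t = sig (fst (fst (\<gamma> t))) (hf (\<gamma> t))"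
    by (rule Y_curve[OF \<gamma>]) blast
  have dk: "((\<lambda>t. hf (\<gamma> t)) has_vector_derivative K) (at 0)" unfolding p_k_K_def(3) by (rule dk0)
  have k: "k \<in> borel_group" unfolding p_k_K_def using sig[of 0] e(1) \<gamma>0 by simp
  note d = borel_group_diag[OF k]
  have y: "y = sig p k" unfolding p_k_K_def using sig_hf(2)[OF assms(1)] by simp
  have K: "upper_triangular K"
    "K $ 1 $ 1 * (k $ 2 $ 2 * k $ 3 $ 3) + K $ 2 $ 2 * (k $ 1 $ 1 * k $ 3 $ 3) + K $ 3 $ 3 * (k $ 1 $ 1 * k $ 2 $ 2) = 0"
    using borel_curve_derivative[OF dk e(1)] sig by (auto simp: \<gamma>0 p_k_K_def(2))
  have L: "L = K ** uinv k" by (simp add: L_def p_k_K_def)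
  show "upper_triangular L" unfolding L by (rule upper_triangular_mult[OF K(1) upper_triangular_uinv])
  have Ld: "L $ 1 $ 1 = K $ 1 $ 1 * (k $ 2 $ 2 * k $ 3 $ 3)" "L $ 2 $ 2 = K $ 2 $ 2 * (k $ 1 $ 1 * k $ 3 $ 3)"
    "L $ 3 $ 3 = K $ 3 $ 3 * (k $ 1 $ 1 * k $ 2 $ 2)"
    using K(1) by (simp_all add: L matrix_matrix_mult_def sum_3 uinv_def upper_triangular_def)
  then show "trace L = 0" using K(2) by (simp add: trace_def sum_3)
  have E: "curve_at (E_bundle P) (p, rk k *\<^sub>R th p) (fst v) (\<lambda>t. fst (\<gamma> t))"
  proof -
    have "smooth_on {-e'<..<e'} (\<lambda>t. fst (\<gamma> t))" if "smooth_on {-e'<..<e'} \<gamma>" for e'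
      by (intro smooth_on_fst that open_greaterThanLessThan)
    moreover have "fst z \<in> E_bundle P" if "z \<in> Y_bundle P" for z
      using that unfolding Y_bundle_def by auto
    moreover have "((\<lambda>t. fst (\<gamma> t)) has_vector_derivative fst v) (at 0)"
      using has_vector_derivative_compose[OF \<gamma>' bounded_linear_imp_has_derivative[OF bounded_linear_fst]] .
    ultimately show ?thesis
      using \<gamma> unfolding curve_at_def \<gamma>0 y fst_sig by blast
  qed
  then show "fst v \<in> tangent_space (E_bundle P) (fst y)"
    unfolding y fst_sig by (rule tangent_spaceI)
  obtain \<rho> where \<rho>: "fst v = tE p (rk k) (fst (fst v)) \<rho>"
    "((\<lambda>t. th (fst (fst (\<gamma> t))) \<bullet> snd (fst (\<gamma> t))) has_vector_derivative \<rho>) (at 0)"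
    using E_curve_derivative[OF E] by blast
  have "((\<lambda>t. rk (hf (\<gamma> t))) has_vector_derivative \<rho>) (at 0)"
  proof (rule has_vector_derivative_transform_within_open[OF \<rho>(2)])
    fix t assume "t \<in> {-e<..<e}"
    then have "fst (\<gamma> t) = (fst (fst (\<gamma> t)), rk (hf (\<gamma> t)) *\<^sub>R th (fst (fst (\<gamma> t))))" using sig fst_sig by metis
    then have "snd (fst (\<gamma> t)) = rk (hf (\<gamma> t)) *\<^sub>R th (fst (fst (\<gamma> t)))" by (metis snd_conv)
    then show "th (fst (fst (\<gamma> t))) \<bullet> snd (fst (\<gamma> t)) = rk (hf (\<gamma> t))" by simp
  qed (use e(1) in auto)
  then have "((\<lambda>t. rk (hf (\<gamma> t))) has_real_derivative \<rho>) (at 0)"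
    by (simp add: has_real_derivative_iff_has_vector_derivative)
  moreover have "((\<lambda>t. rk (hf (\<gamma> t))) has_real_derivative 2 * k $ 1 $ 1 * K $ 1 $ 1 * k $ 2 $ 2 + (k $ 1 $ 1)\<^sup>2 * K $ 2 $ 2) (at 0)"
    unfolding rk_def using has_vector_derivative_nth[OF dk]
    by (auto intro!: derivative_eq_intros simp: \<gamma>0 p_k_K_def(2))
  ultimately have "\<rho> = 2 * k $ 1 $ 1 * K $ 1 $ 1 * k $ 2 $ 2 + (k $ 1 $ 1)\<^sup>2 * K $ 2 $ 2" using DERIV_unique by blast
  also have "\<dots> = rk k * (L $ 1 $ 1 - L $ 3 $ 3)"
  proof -
    have "L $ 1 $ 1 - L $ 3 $ 3 = 2 * (K $ 1 $ 1 * (k $ 2 $ 2 * k $ 3 $ 3)) + K $ 2 $ 2 * (k $ 1 $ 1 * k $ 3 $ 3)"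
      using K(2) unfolding Ld by linarith
    then have "rk k * (L $ 1 $ 1 - L $ 3 $ 3) =
        (2 * k $ 1 $ 1 * K $ 1 $ 1 * k $ 2 $ 2 + (k $ 1 $ 1)\<^sup>2 * K $ 2 $ 2) * (k $ 1 $ 1 * k $ 2 $ 2 * k $ 3 $ 3)"
      by (simp add: rk_def power2_eq_square algebra_simps)
    then show ?thesis by (simp add: d)
  qed
  finally show "fst v = tE (fst (fst y)) (rk (hf y)) (fst (fst v)) (rk (hf y) * (L $ 1 $ 1 - L $ 3 $ 3))"
    using \<rho>(1) by (simp add: p_k_K_def)
  obtain w where w: "(\<gamma> has_vector_derivative w) (at 0)"
    "w = frechet_derivative (\<lambda>(p, k). sig p k) (at (fst (fst (\<gamma> 0)), hf (\<gamma> 0))) (fst (fst v), K)"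
    by (rule PI_sig_curve[OF dp dk e(1) sig])
  have "w = v" by (rule vector_derivative_unique_at[OF w(1) \<gamma>'])
  show "v = frechet_derivative (\<lambda>(p, k). sig p k) (at (fst (fst y), hf y)) (fst (fst v), frechet_derivative hf (at y) v)"
    using w(2) unfolding \<open>w = v\<close> \<gamma>0 p_k_K_def(3) .
  have "K = L ** k" unfolding L by (simp add: matrix_mul_assoc[symmetric] uinv_inverse[OF k])
  then show "PI y v = uinv (hf y) ** (A (fst (fst y)) (fst (fst v)) + L) ** hf y"
    by (simp add: PI_def matrix_add_distrib matrix_mul_assoc flip: p_k_K_def)
qed

lemma trace_A: "trace (A p v) = 0"
  by (simp add: trace_def sum_3 A_def Let_def)

lemma low_A_add:
  assumes "upper_triangular L"
  shows "low (A p u + L) = (th p \<bullet> u, u1 p \<bullet> u, u2 p \<bullet> u, (L $ 1 $ 1 - L $ 3 $ 3) / 2)"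
  using assms by (simp add: low_def A_def Let_def upper_triangular_def)

lemma trace_PI:
  assumes "y \<in> Y_bundle P" "v \<in> tangent_space (Y_bundle P) y"
  shows "trace (PI y v) = 0"
proof -
  note T = tangent_space_Y[OF assms]
  have "hf y \<in> borel_group" using sig_hf(1)[OF assms(1)] hf_in_borel_group by blast
  then show ?thesis unfolding T(6) by (simp add: trace_conj_uinv trace_add trace_A T(2))
qed

lemma low_PI:
  assumes "y \<in> Y_bundle P" "v \<in> tangent_space (Y_bundle P) y"
  shows "low (PI y v) = (cof_\<omega> y (fst v), cof_\<omega>1 y (fst v), cof_\<omega>2 y (fst v), cof_\<phi> y (fst v))"
proof -
  note T = tangent_space_Y[OF assms]
  have k: "hf y \<in> borel_group" using sig_hf(1)[OF assms(1)] hf_in_borel_group by blast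
  show ?thesis
    using cof_sig[OF k low_A_add[OF T(1)], of "fst (fst y)" "fst (fst v)"]
    unfolding T(6) sig_hf(2)[OF assms(1)] T(3)[symmetric] ..
qed

text \<open>Injectivity: after undoing the conjugation, \<open>low\<close> of A + L yields the base
  velocity, then \<open>L\<close> remains, and the two determine the vector. Surjectivity: an
  explicit curve in Y realizes every traceless matrix.\<close>

lemma PI_bij_betw:
  assumes y: "y \<in> Y_bundle P"
  shows "bij_betw (PI y) (tangent_space (Y_bundle P) y) sl3"
proof -
  define p k where "p = fst (fst y)" "k = hf y"
  have k: "k \<in> borel_group" unfolding p_k_def using sig_hf(1)[OF y] hf_in_borel_group by blast
  note inv = uinv_inverse[OF k]
  have sig: "y = sig p k" unfolding p_k_def using sig_hf(2)[OF y] by simp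
  have inj: "v = v'" if v: "v \<in> tangent_space (Y_bundle P) y" and v': "v' \<in> tangent_space (Y_bundle P) y" and eq: "PI y v = PI y v'" for v v'
  proof -
    define L where "L v = frechet_derivative hf (at y) v ** uinv (hf y)" for v
    note T = tangent_space_Y[OF y v, folded L_def] and T' = tangent_space_Y[OF y v', folded L_def]
    have "k ** (uinv k ** (A p (fst (fst v)) + L v) ** k) ** uinv k = k ** (uinv k ** (A p (fst (fst v')) + L v') ** k) ** uinv k"
      using eq unfolding T(6) T'(6) p_k_def by simp
    moreover have "k ** (uinv k ** M ** k) ** uinv k = M" for M
    proof -
      have "k ** (uinv k ** M ** k) ** uinv k = (k ** uinv k) ** M ** (k ** uinv k)" by (simp only: matrix_mul_assoc)
      then show ?thesis by (simp add: inv)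
    qed
    ultimately have AL: "A p (fst (fst v)) + L v = A p (fst (fst v')) + L v'" by simp
    then have "low (A p (fst (fst v)) + L v) = low (A p (fst (fst v')) + L v')" by simp
    then have u: "fst (fst v) = fst (fst v')"
      unfolding low_A_add[OF T(1)] low_A_add[OF T'(1)] using frame_eq_iff[of _ _ p] by simp
    then have "L v = L v'" using AL by simp
    then have "L v ** k = L v' ** k" by simp
    then have "frechet_derivative hf (at y) v = frechet_derivative hf (at y) v'"
      unfolding L_def p_k_def(2)[symmetric] by (simp add: matrix_mul_assoc[symmetric] inv)
    with u show ?thesis using T(5) T'(5) by metis
  qed
  have surj: "X \<in> PI y ` tangent_space (Y_bundle P) y" if "X \<in> sl3" for X
  proof -
    define Z where "Z = k ** X ** uinv k"
    \<comment> \<open>Chosen so that \<open>A p u\<close> has the same entries below the diagonal as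
      \<open>Z\<close>; the rest \<open>D\<close> is then upper triangular and traceless, hence
      tangent to the Borel group.\<close>
    define u where "u = (Z $ 3 $ 1) *\<^sub>R th p + (Z $ 2 $ 1) *\<^sub>R e1 p + (Z $ 3 $ 2) *\<^sub>R e2 p"
    define D where "D = Z - A p u"
    define B where "B = uinv k ** D ** k"
    have "upper_triangular D"
      by (simp add: D_def upper_triangular_def A_def Let_def u_def inner_add)
    moreover have "upper_triangular k" using k by (simp add: borel_group_iff)
    ultimately have upB: "upper_triangular B"
      unfolding B_def by (intro upper_triangular_mult upper_triangular_uinv)
    have "trace Z = trace X"
      unfolding Z_def using trace_mul_sym[of "k ** X" "uinv k"] by (simp add: matrix_mul_assoc inv)
    then have trB: "trace B = 0"
      unfolding B_def using that by (simp add: trace_conj_uinv[OF k] D_def trace_sub trace_A sl3_def)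
    note ex = borel_exp[OF upB trB]
    let ?F = "\<lambda>t. sig (p + t *\<^sub>R u) (k ** borel_exp B t)"
    have p': "((\<lambda>t. p + t *\<^sub>R u) has_vector_derivative u) (at 0)"
      by (auto intro!: derivative_eq_intros)
    have k': "((\<lambda>t. k ** borel_exp B t) has_vector_derivative k ** B) (at 0)"
      by (rule has_vector_derivative_compose[OF ex(4) bounded_linear_imp_has_derivative[OF
            bounded_bilinear.bounded_linear_right[OF bounded_bilinear_matrix_matrix_mult]]])
    have bk: "k ** borel_exp B t \<in> borel_group" for t using borel_group_mult[OF k ex(1)] .
    obtain w where w: "(?F has_vector_derivative w) (at 0)"
      "PI (?F 0) w = uinv (k ** borel_exp B 0) ** (A (p + 0 *\<^sub>R u) u ** (k ** borel_exp B 0) + k ** B)"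
      by (rule PI_sig_curve[OF p' k' zero_less_one, of ?F]) (use bk in auto)
    have F0: "?F 0 = y" by (simp add: ex(2) sig)
    have "curve_at (Y_bundle P) y w ?F"
    proof (rule curve_atI)
      show "smooth_on UNIV ?F"
        by (intro smooth_on_sig smooth_on_add smooth_on_scaleR smooth_on_matrix_mult smooth_on_const smooth_on_id ex(3) open_UNIV)
    qed (use w(1) F0 sig_in_Y_bundle[OF bk] y in auto)
    then have "w \<in> tangent_space (Y_bundle P) y" by (rule tangent_spaceI)
    moreover have "PI y w = X"
    proof -
      have "PI y w = uinv k ** (A p u ** k + k ** B)" using w(2) unfolding F0 by (simp add: ex(2))
      also have "\<dots> = uinv k ** A p u ** k + (uinv k ** k) ** B" by (simp add: matrix_add_distrib matrix_mul_assoc)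
      also have "\<dots> = uinv k ** Z ** k" by (simp add: inv B_def D_def matrix_diff_distrib)
      also have "\<dots> = (uinv k ** k) ** X ** (uinv k ** k)" by (simp only: Z_def matrix_mul_assoc)
      finally show ?thesis by (simp add: inv)
    qed
    ultimately show ?thesis by blast
  qed
  have sub: "PI y v \<in> sl3" if "v \<in> tangent_space (Y_bundle P) y" for v
    using trace_PI[OF y that] by (simp add: sl3_def)
  show ?thesis
    unfolding bij_betw_def inj_on_def using inj surj sub by blast
qed

lemma A_zero: "A p 0 = 0"
  by (simp add: A_eq)

text \<open>The base point stands still, so the term with \<open>A\<close> drops and k^-1 (k X) = X
  is left.\<close>

lemma PI_fundamental:
  assumes y: "y \<in> Y_bundle P" and \<kappa>: "curve_at borel_group (mat 1) X \<kappa>"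
  shows "PI y (vector_derivative (\<lambda>t. act P (\<kappa> t) y) (at 0)) = X"
proof -
  define p k where "p = fst (fst y)" "k = hf y"
  have k: "k \<in> borel_group" unfolding p_k_def using sig_hf(1)[OF y] hf_in_borel_group by blast
  have sig: "y = sig p k" unfolding p_k_def using sig_hf(2)[OF y] by simp
  obtain e where e: "e > 0" "\<And>t. t \<in> {-e<..<e} \<Longrightarrow> \<kappa> t \<in> borel_group" and \<kappa>': "\<kappa> 0 = mat 1" "(\<kappa> has_vector_derivative X) (at 0)"
    using \<kappa> unfolding curve_at_def by blast
  have k': "((\<lambda>t. k ** \<kappa> t) has_vector_derivative k ** X) (at 0)"
    by (rule has_vector_derivative_compose[OF \<kappa>'(2) bounded_linear_imp_has_derivative[OF
          bounded_bilinear.bounded_linear_right[OF bounded_bilinear_matrix_matrix_mult]]])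
  have F: "k ** \<kappa> t \<in> borel_group \<and> act P (\<kappa> t) y = sig p (k ** \<kappa> t)" if "t \<in> {-e<..<e}" for t
    using borel_group_mult[OF k e(2)[OF that]] act_sig[OF k e(2)[OF that]] sig by simp
  have p': "((\<lambda>t. p) has_vector_derivative 0) (at 0)" by simp
  obtain w where w: "((\<lambda>t. act P (\<kappa> t) y) has_vector_derivative w) (at 0)"
    "PI (act P (\<kappa> 0) y) w = uinv (k ** \<kappa> 0) ** (A p 0 ** (k ** \<kappa> 0) + k ** X)"
    by (rule PI_sig_curve[OF p' k' e(1) F])
  have "act P (\<kappa> 0) y = y" using F[of 0] e(1) \<kappa>'(1) sig by simp
  then have "PI y w = (uinv k ** k) ** X"
    using w(2) by (simp add: \<kappa>'(1) A_zero matrix_mul_assoc)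
  then show ?thesis using vector_derivative_at[OF w(1)] by (simp add: uinv_inverse[OF k])
qed

text \<open>The action replaces k by k h with \<open>h\<close> constant, so k^-1 A k + k^-1 dk is
  conjugated by \<open>h\<close>.\<close>

lemma PI_equivariant:
  assumes h: "h \<in> borel_group" and \<gamma>: "curve_at (Y_bundle P) y v \<gamma>"
  shows "PI (act P h y) (vector_derivative (\<lambda>t. act P h (\<gamma> t)) (at 0)) = matrix_inv h ** PI y v ** h"
proof -
  define K where "K = frechet_derivative hf (at y) v"
  obtain e where e: "e > 0" and \<gamma>0: "\<gamma> 0 = y"
    and dp: "((\<lambda>t. fst (fst (\<gamma> t))) has_vector_derivative fst (fst v)) (at 0)"
    and dk: "((\<lambda>t. hf (\<gamma> t)) has_vector_derivative frechet_derivative hf (at y) v) (at 0)"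
    and sig: "\<And>t. t \<in> {-e<..<e} \<Longrightarrow> hf (\<gamma> t) \<in> borel_group \<and> \<gamma> t = sig (fst (fst (\<gamma> t))) (hf (\<gamma> t))"
    by (rule Y_curve[OF \<gamma>]) blast
  have dkh: "((\<lambda>t. hf (\<gamma> t) ** h) has_vector_derivative K ** h) (at 0)"
    unfolding K_def by (rule has_vector_derivative_compose[OF dk bounded_linear_imp_has_derivative[OF
          bounded_bilinear.bounded_linear_left[OF bounded_bilinear_matrix_matrix_mult]]])
  have F: "hf (\<gamma> t) ** h \<in> borel_group \<and> act P h (\<gamma> t) = sig (fst (fst (\<gamma> t))) (hf (\<gamma> t) ** h)" if "t \<in> {-e<..<e}" for t
    using borel_group_mult[OF _ h] act_sig[OF _ h] sig[OF that] by metis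
  obtain w where w: "((\<lambda>t. act P h (\<gamma> t)) has_vector_derivative w) (at 0)"
    "PI (act P h (\<gamma> 0)) w = uinv (hf (\<gamma> 0) ** h) ** (A (fst (fst (\<gamma> 0))) (fst (fst v)) ** (hf (\<gamma> 0) ** h) + K ** h)"
    by (rule PI_sig_curve[OF dp dkh e F])
  have "hf y \<in> borel_group" using sig[of 0] e \<gamma>0 by simp
  then have "PI (act P h y) w = matrix_inv h ** PI y v ** h"
    using w(2) by (simp add: \<gamma>0 uinv_mult h matrix_inv_borel PI_def K_def matrix_add_distrib matrix_mul_assoc)
  then show ?thesis using vector_derivative_at[OF w(1)] by simp
qed

section \<open>Periodicity and normalization of the connection\<close>

lemma Y_translate_eq_plus: "Y_translate k y = y + ((k, 0), 0)"
  by (simp add: Y_translate_def prod_eq_iff zero_prod_def)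

lemma hf_translate:
  assumes "k \<in> lattice"
  shows "hf (Y_translate k y) = hf y"
  by (simp add: hf_def al1_def al2_def be1_def be2_def mm_def Y_translate_def periodic_frame[OF assms])

lemma sig_translate:
  assumes "k \<in> lattice"
  shows "sig (p + k) h = Y_translate k (sig p h)"
  by (simp add: sig_def ypt_def phi_vec_def Y_translate_def periodic_frame[OF assms] Let_def)

lemma PI_translate:
  assumes k: "k \<in> lattice" and y: "y \<in> Y_bundle P"
  shows "PI (Y_translate k y) v = PI y v"
proof -
  have h: "hf y \<in> borel_group" using sig_hf(1)[OF y] hf_in_borel_group by blast
  have "Y_translate k y = sig (fst (fst y) + k) (hf y)"
    using sig_translate[OF k] sig_hf(2)[OF y] by metis
  then have "Y_translate k y \<in> Ydom" using sig_hf(1)[OF sig_in_Y_bundle[OF h]] by simp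
  then have "hf differentiable (at (y + ((k, 0), 0)))"
    using smooth_on_differentiable[OF open_Ydom smooth_hf] Y_translate_eq_plus by metis
  then have "frechet_derivative hf (at (y + ((k, 0), 0))) v = frechet_derivative hf (at y) v"
    by (rule frechet_derivative_periodic) (simp add: hf_translate[OF k] flip: Y_translate_eq_plus)
  then show ?thesis
    by (simp add: PI_def hf_translate[OF k] flip: Y_translate_eq_plus) (simp add: Y_translate_def A_periodic[OF k])
qed

lemma cartan_connection_PI: "cartan_connection P PI"
  unfolding cartan_connection_def
proof (intro conjI ballI allI impI exI[of _ Ydom])
  show "Y_bundle P \<subseteq> Ydom" using sig_hf(1) by blast
qed (simp_all add: open_Ydom smooth_form_PI PI_bij_betw PI_fundamental PI_equivariant PI_translate)

lemma fst_tE: "fst (tE p r u \<rho>) = u"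
  by (simp add: tE_def)

lemma cof_tangent:
  assumes "y \<in> Y_bundle P" "v \<in> tangent_space (Y_bundle P) y"
  shows "cof_\<omega> y (fst v) = rk (hf y) * (th (fst (fst y)) \<bullet> fst (fst v))"
    "cof_\<omega>1 y (fst v) = (hf y $ 1 $ 1)\<^sup>2 * hf y $ 3 $ 3 * (u1 (fst (fst y)) \<bullet> fst (fst v)) + be1 y * (th (fst (fst y)) \<bullet> fst (fst v))"
    "cof_\<omega>2 y (fst v) = hf y $ 1 $ 1 * (hf y $ 2 $ 2)\<^sup>2 * (u2 (fst (fst y)) \<bullet> fst (fst v)) + be2 y * (th (fst (fst y)) \<bullet> fst (fst v))"
proof -
  define p k u where "p = fst (fst y)" "k = hf y" "u = fst (fst v)"
  have y: "y = sig p k" using sig_hf(2)[OF assms(1)] by (simp add: p_k_u_def)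
  obtain \<rho> where \<rho>: "fst v = tE p (rk k) u \<rho>" using tangent_space_Y(3)[OF assms] by (auto simp: p_k_u_def)
  show "cof_\<omega> y (fst v) = rk (hf y) * (th (fst (fst y)) \<bullet> fst (fst v))"
    "cof_\<omega>1 y (fst v) = (hf y $ 1 $ 1)\<^sup>2 * hf y $ 3 $ 3 * (u1 (fst (fst y)) \<bullet> fst (fst v)) + be1 y * (th (fst (fst y)) \<bullet> fst (fst v))"
    "cof_\<omega>2 y (fst v) = hf y $ 1 $ 1 * (hf y $ 2 $ 2)\<^sup>2 * (u2 (fst (fst y)) \<bullet> fst (fst v)) + be2 y * (th (fst (fst y)) \<bullet> fst (fst v))"
    unfolding p_k_u_def[symmetric] \<rho> by (simp_all add: y sig_def cof_ypt coords_ypt fst_tE)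
qed

lemma normal_cartan_connection_PI: "normal_cartan_connection P PI"
  unfolding normal_cartan_connection_def
proof (intro conjI cartan_connection_PI ballI)
  fix y v assume "y \<in> Y_bundle P" "v \<in> tangent_space (Y_bundle P) y"
  then show "\<exists>w \<phi>1 \<phi>2 \<psi>. PI y v = pi_shape (cof_\<omega> y (fst v)) (cof_\<omega>1 y (fst v)) (cof_\<omega>2 y (fst v)) (cof_\<phi> y (fst v)) w \<phi>1 \<phi>2 \<psi>"
    using trace_zero_pi_shape[OF trace_PI] low_PI unfolding low_def by (metis prod.inject)
next
  \<comment> \<open>\<open>?F1\<close> and \<open>?F2\<close> are the factors between \<omega>
    \<and> \<omega>1, \<omega> \<and> \<omega>2 and their counterparts in the adapted coframe; the
    \<theta>-parts of \<omega>1 and \<omega>2 drop out against \<omega>.\<close>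
  let ?F1 = "\<lambda>y. rk (hf y) * ((hf y $ 1 $ 1)\<^sup>2 * hf y $ 3 $ 3)"
  let ?F2 = "\<lambda>y. rk (hf y) * (hf y $ 1 $ 1 * (hf y $ 2 $ 2)\<^sup>2)"
  let ?Q1 = "\<lambda>y. hf y $ 1 $ 1 * (hf y $ 3 $ 3)\<^sup>2 * Q1 / ?F2 y"
  let ?Q2 = "\<lambda>y. (hf y $ 2 $ 2)\<^sup>2 * hf y $ 3 $ 3 * Q2 / ?F1 y"
  \<comment> \<open>Entry (1,3) is zero for \<open>curv A\<close>, but conjugation by
    \<open>k\<close> feeds the entries (1,2) and (2,3) into it through k23 and k12.\<close>
  let ?U1 = "\<lambda>y. - (hf y $ 2 $ 2 * hf y $ 3 $ 3 * hf y $ 2 $ 3 * Q2) / ?F1 y"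
  let ?U2 = "\<lambda>y. hf y $ 1 $ 2 * (hf y $ 3 $ 3)\<^sup>2 * Q1 / ?F2 y"
  have key: "curvature PI y u v = vector [vector [0, ?Q2 y * wedge (\<lambda>v. cof_\<omega> y (fst v)) (\<lambda>v. cof_\<omega>1 y (fst v)) u v,
          wedge (\<lambda>v. ?U1 y * cof_\<omega>1 y (fst v) + ?U2 y * cof_\<omega>2 y (fst v)) (\<lambda>v. cof_\<omega> y (fst v)) u v],
        vector [0, 0, ?Q1 y * wedge (\<lambda>v. cof_\<omega> y (fst v)) (\<lambda>v. cof_\<omega>2 y (fst v)) u v], vector [0, 0, 0]]"
    if y: "y \<in> Y_bundle P" and u: "u \<in> tangent_space (Y_bundle P) y" and v: "v \<in> tangent_space (Y_bundle P) y" for y u v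
  proof -
    define p k where "p = fst (fst y)" "k = hf y"
    have k: "k \<in> borel_group" unfolding p_k_def using sig_hf(1)[OF y] hf_in_borel_group by blast
    define W1 W2 where "W1 = wedge ((\<bullet>) (th p)) ((\<bullet>) (u1 p)) (fst (fst u)) (fst (fst v))"
      "W2 = wedge ((\<bullet>) (th p)) ((\<bullet>) (u2 p)) (fst (fst u)) (fst (fst v))"
    have F: "?F1 y \<noteq> 0" "?F2 y \<noteq> 0"
      using borel_group_diag[OF k] rk_nonzero[OF k] unfolding p_k_def by simp_all
    have w1: "wedge (\<lambda>v. cof_\<omega> y (fst v)) (\<lambda>v. cof_\<omega>1 y (fst v)) u v = ?F1 y * W1"
      and w2: "wedge (\<lambda>v. cof_\<omega> y (fst v)) (\<lambda>v. cof_\<omega>2 y (fst v)) u v = ?F2 y * W2"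
      unfolding wedge_def cof_tangent[OF y u] cof_tangent[OF y v] W1_W2_def p_k_def by (simp_all add: algebra_simps)
    have lin: "wedge (\<lambda>v. s * f1 v + t * f2 v) g u v = - s * wedge g f1 u v - t * wedge g f2 u v"
      for s t and f1 f2 g :: "ypoint \<Rightarrow> real"
      by (simp add: wedge_def algebra_simps)
    have "wedge (\<lambda>v. ?U1 y * cof_\<omega>1 y (fst v) + ?U2 y * cof_\<omega>2 y (fst v)) (\<lambda>v. cof_\<omega> y (fst v)) u v =
        - ?U1 y * wedge (\<lambda>v. cof_\<omega> y (fst v)) (\<lambda>v. cof_\<omega>1 y (fst v)) u v
        - ?U2 y * wedge (\<lambda>v. cof_\<omega> y (fst v)) (\<lambda>v. cof_\<omega>2 y (fst v)) u v"
      by (rule lin[of "?U1 y" "\<lambda>v. cof_\<omega>1 y (fst v)" "?U2 y" "\<lambda>v. cof_\<omega>2 y (fst v)" "\<lambda>v. cof_\<omega> y (fst v)"])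
    also have "\<dots> = k $ 2 $ 2 * k $ 3 $ 3 * k $ 2 $ 3 * Q2 * W1 - k $ 1 $ 2 * (k $ 3 $ 3)\<^sup>2 * Q1 * W2"
      unfolding w1 w2 p_k_def(2) using F by simp
    finally have w3: "wedge (\<lambda>v. ?U1 y * cof_\<omega>1 y (fst v) + ?U2 y * cof_\<omega>2 y (fst v)) (\<lambda>v. cof_\<omega> y (fst v)) u v =
      k $ 2 $ 2 * k $ 3 $ 3 * k $ 2 $ 3 * Q2 * W1 - k $ 1 $ 2 * (k $ 3 $ 3)\<^sup>2 * Q1 * W2" .
    have w1': "?Q2 y * (?F1 y * W1) = (k $ 2 $ 2)\<^sup>2 * k $ 3 $ 3 * Q2 * W1"
      and w2': "?Q1 y * (?F2 y * W2) = k $ 1 $ 1 * (k $ 3 $ 3)\<^sup>2 * Q1 * W2"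
      using F unfolding p_k_def(2) by simp_all
    have "curvature PI y u v = uinv k ** curv A p (fst (fst u)) (fst (fst v)) ** k"
      using curv_PI[OF sig_hf(1)[OF y], of u v] by (simp add: curvature_def curv_def p_k_def)
    also have "\<dots> = vector [vector [0, (k $ 2 $ 2)\<^sup>2 * k $ 3 $ 3 * Q2 * W1, k $ 2 $ 2 * k $ 3 $ 3 * k $ 2 $ 3 * Q2 * W1 - k $ 1 $ 2 * (k $ 3 $ 3)\<^sup>2 * Q1 * W2],
        vector [0, 0, k $ 1 $ 1 * (k $ 3 $ 3)\<^sup>2 * Q1 * W2], vector [0, 0, 0]]"
      unfolding curv_A W1_W2_def[symmetric]
      by (simp add: mat3_eq_iff forall_3 matrix_matrix_mult_def sum_3 uinv_def borel_group_upper[OF k] power2_eq_square)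
    finally show ?thesis unfolding w3 w1 w2 w1' w2' .
  qed
  show "\<exists>Q1 Q2 U1 U2. \<forall>y\<in>Y_bundle P. \<forall>u\<in>tangent_space (Y_bundle P) y. \<forall>v\<in>tangent_space (Y_bundle P) y.
      let \<omega> = \<lambda>v. cof_\<omega> y (fst v); \<omega>1 = \<lambda>v. cof_\<omega>1 y (fst v); \<omega>2 = \<lambda>v. cof_\<omega>2 y (fst v)
      in curvature PI y u v = vector [vector [0, Q2 y * wedge \<omega> \<omega>1 u v, wedge (\<lambda>v. U1 y * \<omega>1 v + U2 y * \<omega>2 v) \<omega> u v],
              vector [0, 0, Q1 y * wedge \<omega> \<omega>2 u v], vector [0, 0, 0]]"
    unfolding Let_def
    by (rule exI[of _ ?Q1], rule exI[of _ ?Q2], rule exI[of _ ?U1], rule exI[of _ ?U2], intro ballI, rule key)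
qed

lemma global_section_sig: "global_section P (\<lambda>p. sig p (mat 1))"
  unfolding global_section_def
  by (auto intro!: smooth_on_sig smooth_on_id smooth_on_const sig_in_Y_bundle mat1_in_borel_group
    simp: fst_sig sig_translate)

end

section \<open>Uniqueness of the pulled back connection\<close>

context torus_path
begin

lemma A_frame: "A p (th p) = A0" "A p (e1 p) = A1" "A p (e2 p) = A2"
  by (simp_all add: A_eq)

text \<open>Cartan's uniqueness argument in the adapted frame. The difference \<open>\<delta> = \<beta> - A\<close> has only the components
  \<open>w, \<phi>1, \<phi>2, \<psi>\<close>; the entries \<open>(2,1), (3,2), (2,2), (1,1), (3,3), (1,2)\<close> of the curvature kill them in this order.
  A derivative of \<open>\<delta>\<close> enters only through \<open>d(w \<theta>) = w d\<theta>\<close> on the contact plane.\<close>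

lemma normal_potential_unique:
  assumes \<beta>: "smooth_form UNIV \<beta>" and low: "\<And>p v. low (\<beta> p v) = low (A p v)" and tr: "\<And>p v. trace (\<beta> p v) = 0"
    and curv: "\<And>p u v. strictly_upper (curv \<beta> p u v)" and curv12: "\<And>p. curv \<beta> p (th p) (e2 p) $ 1 $ 2 = 0"
  shows "\<beta> p v = A p v"
proof -
  define \<delta> where "\<delta> p v = \<beta> p v - A p v" for p v
  note sA = smooth_form_A[OF open_UNIV]
  have s\<delta>: "smooth_form UNIV \<delta>"
    unfolding smooth_form_def
  proof (intro conjI ballI allI)
    show "linear (\<delta> p)" for p
      unfolding \<delta>_def by (intro linear_compose_sub smooth_form_linear[OF \<beta>] smooth_form_linear[OF sA]) auto
    show "smooth_on UNIV (\<lambda>p. \<delta> p v)" for v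
      unfolding \<delta>_def by (intro smooth_on_diff smooth_form_smooth_on[OF \<beta>] smooth_form_smooth_on[OF sA] open_UNIV)
  qed
  have \<delta>_low: "\<delta> p v $ 2 $ 1 = 0" "\<delta> p v $ 3 $ 1 = 0" "\<delta> p v $ 3 $ 2 = 0" "\<delta> p v $ 3 $ 3 = \<delta> p v $ 1 $ 1"
    "\<delta> p v $ 2 $ 2 = - 2 * \<delta> p v $ 1 $ 1" for p v
  proof -
    have lowd: "\<delta> p v $ 2 $ 1 = 0" "\<delta> p v $ 3 $ 1 = 0" "\<delta> p v $ 3 $ 2 = 0" "\<delta> p v $ 3 $ 3 = \<delta> p v $ 1 $ 1"
      using low[of p v] by (auto simp: low_def \<delta>_def)
    have "trace (\<delta> p v) = 0" by (simp add: \<delta>_def trace_sub tr trace_A)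
    then show "\<delta> p v $ 2 $ 2 = - 2 * \<delta> p v $ 1 $ 1" using lowd by (simp add: trace_def sum_3)
    show "\<delta> p v $ 2 $ 1 = 0" "\<delta> p v $ 3 $ 1 = 0" "\<delta> p v $ 3 $ 2 = 0" "\<delta> p v $ 3 $ 3 = \<delta> p v $ 1 $ 1" by (fact lowd)+
  qed
  define C where "C p X Y = A p X ** \<delta> p Y + \<delta> p X ** A p Y + \<delta> p X ** \<delta> p Y - (A p Y ** \<delta> p X + \<delta> p Y ** A p X + \<delta> p Y ** \<delta> p X)"
    for p X Y
  have curv_eq: "curv \<beta> p X Y = curv A p X Y + ext_d \<delta> p X Y + C p X Y" for p X Y
  proof -
    have "frechet_derivative (\<lambda>p. \<delta> p v) (at p) u = frechet_derivative (\<lambda>p. \<beta> p v) (at p) u - frechet_derivative (\<lambda>p. A p v) (at p) u" for p u v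
      unfolding \<delta>_def
      by (rule frechet_derivative_eqI, intro has_derivative_diff smooth_on_has_derivative[OF open_UNIV _ UNIV_I]
        smooth_form_smooth_on[OF \<beta>] smooth_form_smooth_on[OF sA])
    then have "ext_d \<beta> p X Y = ext_d A p X Y + ext_d \<delta> p X Y" by (simp add: ext_d_def)
    moreover have "\<beta> p Z = A p Z + \<delta> p Z" for Z by (simp add: \<delta>_def)
    ultimately show ?thesis
      by (simp add: curv_def mwedge_def C_def matrix_add_distrib)
  qed
  have nth: "frechet_derivative (\<lambda>p. \<delta> p v) (at p) u $ i $ j = frechet_derivative (\<lambda>p. \<delta> p v $ i $ j) (at p) u" for p u v i j
    using frechet_derivative_bounded_linear[OF open_UNIV smooth_form_smooth_on[OF s\<delta>] UNIV_I
      bounded_linear_compose[OF bounded_linear_vec_nth[of j] bounded_linear_vec_nth[of i]]] by simp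
  have d_zero: "ext_d \<delta> p X Y $ i $ j = 0" if "\<And>p v. \<delta> p v $ i $ j = 0" for p X Y i j
    by (simp add: ext_d_def nth that)
  define D0 D1 D2 where "D0 p = \<delta> p (th p)" "D1 p = \<delta> p (e1 p)" "D2 p = \<delta> p (e2 p)" for p
  have D_low: "D0 p $ 2 $ 1 = 0" "D0 p $ 3 $ 1 = 0" "D0 p $ 3 $ 2 = 0" "D0 p $ 3 $ 3 = D0 p $ 1 $ 1" "D0 p $ 2 $ 2 = - 2 * D0 p $ 1 $ 1"
    "D1 p $ 2 $ 1 = 0" "D1 p $ 3 $ 1 = 0" "D1 p $ 3 $ 2 = 0" "D1 p $ 3 $ 3 = D1 p $ 1 $ 1" "D1 p $ 2 $ 2 = - 2 * D1 p $ 1 $ 1"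
    "D2 p $ 2 $ 1 = 0" "D2 p $ 3 $ 1 = 0" "D2 p $ 3 $ 2 = 0" "D2 p $ 3 $ 3 = D2 p $ 1 $ 1" "D2 p $ 2 $ 2 = - 2 * D2 p $ 1 $ 1" for p
    unfolding D0_D1_D2_def by (simp_all only: \<delta>_low)
  have C: "C p (th p) (e1 p) = A0 ** D1 p + D0 p ** A1 + D0 p ** D1 p - (A1 ** D0 p + D1 p ** A0 + D1 p ** D0 p)"
    "C p (th p) (e2 p) = A0 ** D2 p + D0 p ** A2 + D0 p ** D2 p - (A2 ** D0 p + D2 p ** A0 + D2 p ** D0 p)"
    "C p (e1 p) (e2 p) = A1 ** D2 p + D1 p ** A2 + D1 p ** D2 p - (A2 ** D1 p + D2 p ** A1 + D2 p ** D1 p)" for p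
    by (simp_all add: C_def A_frame D0_D1_D2_def)
  have zero: "(ext_d \<delta> p X Y + C p X Y) $ i $ j = 0" if "(i, j) \<in> {(2,1), (3,1), (3,2), (1,1), (2,2), (3,3)}" for p X Y and i j :: 3
    using curv[of p X Y] strictly_upper_curv_A[of p X Y] that unfolding curv_eq
    by (auto simp: strictly_upper_def upper_triangular_def)
  \<comment> \<open>Where an entry of \<delta> vanishes identically, so does that of d\<delta>, and
    the condition on the curvature becomes algebraic.\<close>
  have C_zero: "C p X Y $ i $ j = 0" if "(i, j) \<in> {(2,1), (3,1), (3,2), (1,1), (2,2), (3,3)}" "\<And>p v. \<delta> p v $ i $ j = 0" for p X Y and i j :: 3
    using zero[OF that(1), of p X Y] d_zero[OF that(2)] by simp
  note expand = matrix_matrix_mult_def sum_3 A0_def A1_def A2_def D_low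
  have w12: "D1 p $ 1 $ 1 = 0" "D2 p $ 1 $ 1 = 0" and pq: "D1 p $ 2 $ 3 = - 3 * D0 p $ 1 $ 1" "D2 p $ 1 $ 2 = - 3 * D0 p $ 1 $ 1" for p
  proof -
    \<comment> \<open>Products of two values of \<delta> have no entries below the diagonal, so only
      the brackets with \<open>A0\<close>, \<open>A1\<close>, \<open>A2\<close> count here.\<close>
    have "C p (e1 p) (e2 p) $ 2 $ 1 = 0" "C p (e1 p) (e2 p) $ 3 $ 2 = 0" "C p (th p) (e1 p) $ 2 $ 1 = 0" "C p (th p) (e2 p) $ 3 $ 2 = 0"
      by (rule C_zero; simp add: \<delta>_low)+
    then show "D1 p $ 1 $ 1 = 0" "D2 p $ 1 $ 1 = 0" "D1 p $ 2 $ 3 = - 3 * D0 p $ 1 $ 1" "D2 p $ 1 $ 2 = - 3 * D0 p $ 1 $ 1"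
      unfolding C by (simp_all add: expand)
  qed
  have \<delta>_frame: "\<delta> p v = (th p \<bullet> v) *\<^sub>R D0 p + (u1 p \<bullet> v) *\<^sub>R D1 p + (u2 p \<bullet> v) *\<^sub>R D2 p" for p v
  proof -
    have l: "linear (\<delta> p)" by (rule smooth_form_linear[OF s\<delta>]) simp
    show ?thesis
      by (subst frame_expansion[of v p]) (simp add: linear_add[OF l] linear_scale[OF l] D0_D1_D2_def)
  qed
  have \<delta>11: "\<delta> p v $ 1 $ 1 = (th p \<bullet> v) * D0 p $ 1 $ 1" for p v
    by (simp add: \<delta>_frame w12)
  \<comment> \<open>The derivative \<open>w'\<close> of the coefficient comes multiplied by
    \<theta>, which vanishes on \<open>e1\<close> and \<open>e2\<close>; what remains is
    d\<theta>(e1, e2) = 1.\<close>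
  have d11: "ext_d \<delta> p (e1 p) (e2 p) $ 1 $ 1 = D0 p $ 1 $ 1" for p
  proof -
    have "((\<lambda>q. \<delta> q (th q)) has_derivative (\<lambda>u. frechet_derivative (\<lambda>y. \<delta> y (th p)) (at p) u + \<delta> p ((t1 \<bullet> u) *\<^sub>R t2 p))) (at p)"
      by (rule smooth_form_apply_has_derivative[where f = "\<lambda>q. q" and T = UNIV]) (auto intro: s\<delta> th_has_derivative)
    from bounded_linear.has_derivative[OF bounded_linear_compose[OF bounded_linear_vec_nth[of 1] bounded_linear_vec_nth[of 1]] this]
    obtain w' where w': "((\<lambda>q. D0 q $ 1 $ 1) has_derivative w') (at p)" unfolding D0_D1_D2_def by blast
    have fd11: "frechet_derivative (\<lambda>q. \<delta> q v $ 1 $ 1) (at p) u =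
        (th p \<bullet> v) * w' u + (f * (u1 p \<bullet> u) - b * (u2 p \<bullet> u)) * (a * (u2 p \<bullet> v) - c * (u1 p \<bullet> v)) * D0 p $ 1 $ 1" for u v
      unfolding \<delta>11 by (rule frechet_derivative_eqI) (intro has_derivative_mult coframe_has_derivative w')
    have "ext_d \<delta> p (e1 p) (e2 p) $ 1 $ 1 = (a * f - b * c) * D0 p $ 1 $ 1"
      by (simp add: ext_d_def nth fd11) (simp add: algebra_simps)
    then show ?thesis by (simp add: det_one)
  qed
  \<comment> \<open>In entry (2,2) the exterior derivative contributes -2 and the bracket -6 times
    this unknown, so the two cannot cancel.\<close>
  have w0: "D0 p $ 1 $ 1 = 0" for p
  proof -
    have "frechet_derivative (\<lambda>q. \<delta> q v $ 2 $ 2) (at p) u = - 2 * frechet_derivative (\<lambda>q. \<delta> q v $ 1 $ 1) (at p) u" for u v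
    proof -
      have s: "smooth_on UNIV (\<lambda>q. \<delta> q v $ 1 $ 1)"
        by (intro smooth_on_nth smooth_form_smooth_on[OF s\<delta>] open_UNIV)
      show ?thesis unfolding \<delta>_low(5)
        by (rule frechet_derivative_bounded_linear[OF open_UNIV s UNIV_I bounded_linear_mult_right])
    qed
    then have "ext_d \<delta> p (e1 p) (e2 p) $ 2 $ 2 = - 2 * ext_d \<delta> p (e1 p) (e2 p) $ 1 $ 1"
      by (simp add: ext_d_def nth)
    moreover have "C p (e1 p) (e2 p) $ 2 $ 2 = - 6 * D0 p $ 1 $ 1"
      unfolding C by (simp add: expand w12 pq)
    ultimately show ?thesis using zero[of 2 2 p "e1 p" "e2 p"] by (simp add: d11)
  qed
  have \<delta>11_zero: "\<delta> p v $ 1 $ 1 = 0" for p v by (simp add: \<delta>11 w0)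
  note expand' = expand w12 pq w0
  have q1: "D1 p $ 1 $ 2 = 0" and p2: "D2 p $ 2 $ 3 = 0" for p
  proof -
    have "C p (th p) (e1 p) $ 3 $ 2 = 0" "C p (th p) (e2 p) $ 2 $ 1 = 0"
      by (rule C_zero; simp add: \<delta>_low)+
    then show "D1 p $ 1 $ 2 = 0" "D2 p $ 2 $ 3 = 0"
      unfolding C by (simp_all add: expand')
  qed
  have rest: "D1 p $ 1 $ 3 = 0" "D2 p $ 1 $ 3 = 0" "D0 p $ 1 $ 2 = 0" "D0 p $ 2 $ 3 = 0" for p
  proof -
    have "C p (th p) (e1 p) $ 3 $ 3 = 0" "C p (th p) (e2 p) $ 1 $ 1 = 0" "C p (th p) (e1 p) $ 1 $ 1 = 0" "C p (th p) (e2 p) $ 3 $ 3 = 0"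
      by (rule C_zero; simp add: \<delta>_low \<delta>11_zero)+
    then show "D1 p $ 1 $ 3 = 0" "D2 p $ 1 $ 3 = 0" "D0 p $ 1 $ 2 = 0" "D0 p $ 2 $ 3 = 0"
      unfolding C by (simp_all add: expand' q1 p2)
  qed
  have \<delta>12: "\<delta> p v $ 1 $ 2 = 0" for p v
    by (simp add: \<delta>_frame rest q1 pq w0)
  have s0: "D0 p $ 1 $ 3 = 0" for p
  proof -
    \<comment> \<open>Entries on and below the diagonal do not see \<psi> on \<open>th\<close>; the
      absence of \<theta> \<and> \<theta>'2 from entry (1,2) settles it.\<close>
    have "curv A p (th p) (e2 p) $ 1 $ 2 = 0" by (simp add: curv_A wedge_def)
    then have "C p (th p) (e2 p) $ 1 $ 2 = 0"
      using curv12[of p] d_zero[OF \<delta>12] unfolding curv_eq by simp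
    then show ?thesis unfolding C by (simp add: expand' q1 p2 rest)
  qed
  have "D0 p = 0" "D1 p = 0" "D2 p = 0"
    by (simp_all add: mat3_eq_iff forall_3 D_low w12 pq w0 q1 p2 rest s0)
  then have "\<delta> p v = 0" by (simp add: \<delta>_frame)
  then show ?thesis by (simp add: \<delta>_def)
qed

section \<open>Comparison with an arbitrary normal connection and section\<close>

lemma low_diff: "low (X - Y) = low X - low Y"
  by (simp add: low_def field_simps)

lemma uinv_in_borel_group:
  assumes "k \<in> borel_group"
  shows "uinv k \<in> borel_group"
proof -
  have "det (uinv k) * det k = 1" using arg_cong[OF uinv_inverse(1)[OF assms], of det] by (simp add: det_mul)
  moreover have "det k = 1" using assms by (simp add: borel_group_def)
  ultimately show ?thesis using upper_triangular_uinv[of k] by (simp add: borel_group_def upper_triangular_def)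
qed

lemma uinv_uinv: "k \<in> borel_group \<Longrightarrow> uinv (uinv k) = k"
proof -
  assume k: "k \<in> borel_group"
  have "uinv (uinv k) = uinv (uinv k) ** (uinv k ** k)" by (simp add: uinv_inverse[OF k])
  also have "\<dots> = k" by (simp add: matrix_mul_assoc uinv_inverse[OF uinv_in_borel_group[OF k]])
  finally show ?thesis .
qed

text \<open>The right-hand side involves neither the connection nor the section. The form \<beta> is
  the pulled back connection transported to the section with Borel coordinate 1, and the uniqueness
  lemma applies to it.\<close>

lemma torus_integral_normal_connection:
  assumes \<pi>': "normal_cartan_connection P \<pi>'" and s: "global_section P s"
  shows "torus_integral (TC2 (pullback s \<pi>')) = torus_integral (TC2 A)"
proof -
  have sm: "smooth_on UNIV s" and sY: "\<And>p. s p \<in> Y_bundle P" and base: "\<And>p. fst (fst (s p)) = p"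
    and per: "\<And>p k. k \<in> lattice \<Longrightarrow> s (p + k) = Y_translate k (s p)"
    using s unfolding global_section_def by blast+
  obtain U where U: "open U" "Y_bundle P \<subseteq> U" "smooth_form U \<pi>'"
    using \<pi>' unfolding normal_cartan_connection_def cartan_connection_def by blast
  have sU: "s ` UNIV \<subseteq> U" and sD: "s ` UNIV \<subseteq> Ydom" using sY U(2) sig_hf(1) by blast+
  define \<alpha> where "\<alpha> = pullback s \<pi>'"
  define g where "g p = hf (s p)" for p
  define gi where "gi p = uinv (g p)" for p
  define V where "V p v = frechet_derivative s (at p) v" for p v
  let ?G = "\<lambda>p v. frechet_derivative g (at p) v"
  have V: "V p v \<in> tangent_space (Y_bundle P) (s p)" for p v
    unfolding V_def by (rule section_tangent[OF sm sY])
  have V_base: "fst (fst (V p v)) = v" for p v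
  proof -
    have "frechet_derivative (\<lambda>p. fst (fst (s p))) (at p) v = fst (fst (V p v))"
      unfolding V_def using frechet_derivative_bounded_linear[OF open_UNIV sm UNIV_I
        bounded_linear_compose[OF bounded_linear_fst bounded_linear_fst]] by simp
    then show ?thesis by (simp add: base)
  qed
  have gB: "g p \<in> borel_group" for p
    unfolding g_def using sig_hf(1)[OF sY] hf_in_borel_group by blast
  note inv = uinv_inverse[OF gB, folded gi_def]
  have smg: "smooth_on UNIV g"
    unfolding g_def[abs_def] by (rule smooth_on_compose[OF open_UNIV open_Ydom smooth_hf sm sD])
  have smgi: "smooth_on UNIV gi"
    unfolding gi_def[abs_def] by (rule smooth_on_uinv[OF open_UNIV smg])
  have sm\<alpha>: "smooth_form UNIV \<alpha>"
    unfolding \<alpha>_def by (rule smooth_form_pullback[OF open_UNIV sm U(1,3) sU])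
  have DG: "frechet_derivative hf (at (s p)) (V p v) = ?G p v" for p v
  proof -
    have "s p \<in> Ydom" using sD by blast
    from diff_chain_at[OF smooth_on_has_derivative[OF open_UNIV sm UNIV_I, of p] hf_has_derivative[OF this]]
    have "(g has_derivative (\<lambda>v. frechet_derivative hf (at (s p)) (V p v))) (at p)"
      by (simp add: o_def g_def[abs_def] V_def)
    then show ?thesis by (rule frechet_derivative_eqI[symmetric])
  qed
  define L where "L p v = ?G p v ** gi p" for p v
  have L: "upper_triangular (L p v)" "trace (L p v) = 0" and PI: "PI (s p) (V p v) = gi p ** (A p v + L p v) ** g p" for p v
    using tangent_space_Y(1,2,6)[OF sY V, of p v] by (simp_all add: DG V_base base L_def gi_def g_def)
  define \<beta> where "\<beta> p v = g p ** \<alpha> p v ** gi p - L p v" for p v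
  have \<beta>_gauge: "g p ** \<alpha> p v = \<beta> p v ** g p + ?G p v" for p v
    by (simp add: \<beta>_def L_def matrix_diff_distrib matrix_mul_assoc[symmetric] inv)
  have sm\<beta>: "smooth_form UNIV \<beta>"
    unfolding smooth_form_def
  proof (intro conjI ballI allI)
    fix p
    have l\<alpha>: "linear (\<alpha> p)" and lG: "linear (?G p)"
      using smooth_form_linear[OF sm\<alpha>] frechet_derivative_linear[OF open_UNIV smg] by auto
    show "linear (\<beta> p)"
      by (intro linearI) (simp_all add: \<beta>_def L_def linear_add[OF l\<alpha>] linear_add[OF lG] linear_scale[OF l\<alpha>] linear_scale[OF lG]
        matrix_add_distrib bounded_bilinear.scaleR_left[OF bounded_bilinear_matrix_matrix_mult]
        bounded_bilinear.scaleR_right[OF bounded_bilinear_matrix_matrix_mult] scaleR_diff_right)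
  next
    show "smooth_on UNIV (\<lambda>p. \<beta> p v)" for v
      unfolding \<beta>_def L_def by (intro smooth_on_diff smooth_on_matrix_mult smooth_form_smooth_on[OF sm\<alpha>]
        smooth_on_frechet_derivative smg smgi open_UNIV)
  qed
  \<comment> \<open>Normality gives the pulled back connection the lower part of \<open>PI\<close>,
    which enters this proof as a form whose lower part is known.\<close>
  have \<alpha>_shape: "trace (\<alpha> p v) = 0" "low (\<alpha> p v) = low (PI (s p) (V p v))" for p v
  proof -
    have "\<forall>y\<in>Y_bundle P. \<forall>v\<in>tangent_space (Y_bundle P) y. \<exists>w \<phi>1 \<phi>2 \<psi>.
        \<pi>' y v = pi_shape (cof_\<omega> y (fst v)) (cof_\<omega>1 y (fst v)) (cof_\<omega>2 y (fst v)) (cof_\<phi> y (fst v)) w \<phi>1 \<phi>2 \<psi>"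
      using \<pi>' unfolding normal_cartan_connection_def by blast
    then obtain w \<phi>1 \<phi>2 \<psi> where "\<alpha> p v = pi_shape (cof_\<omega> (s p) (fst (V p v))) (cof_\<omega>1 (s p) (fst (V p v)))
        (cof_\<omega>2 (s p) (fst (V p v))) (cof_\<phi> (s p) (fst (V p v))) w \<phi>1 \<phi>2 \<psi>"
      using sY V unfolding \<alpha>_def pullback_def V_def[symmetric] by blast
    then show "trace (\<alpha> p v) = 0" "low (\<alpha> p v) = low (PI (s p) (V p v))"
      unfolding low_PI[OF sY V] by (simp_all add: trace_def sum_3 low_def)
  qed
  have upgi: "upper_triangular (gi p)" and giB: "gi p \<in> borel_group" and uinv_gi: "uinv (gi p) = g p" for p
    using upper_triangular_uinv uinv_in_borel_group[OF gB] uinv_uinv[OF gB] by (auto simp: gi_def)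
  \<comment> \<open>Conjugation by the inverse of \<open>g\<close> respects equality of lower parts
    and turns the value of \<open>PI\<close> into A + L; subtracting \<open>L\<close> leaves
    \<open>A\<close>.\<close>
  have low\<beta>: "low (\<beta> p v) = low (A p v)" for p v
  proof -
    have "low (g p ** \<alpha> p v ** gi p) = low (g p ** PI (s p) (V p v) ** gi p)"
      using low_conj_cong[OF upgi \<alpha>_shape(2), of p p v] by (simp add: uinv_gi)
    also have "g p ** PI (s p) (V p v) ** gi p = (g p ** gi p) ** (A p v + L p v) ** (g p ** gi p)"
      unfolding PI by (simp only: matrix_mul_assoc)
    finally show ?thesis unfolding \<beta>_def low_diff by (simp add: inv flip: low_diff)
  qed
  have tr\<beta>: "trace (\<beta> p v) = 0" for p v
    using trace_conj_uinv[OF giB, of p "\<alpha> p v"] by (simp add: \<beta>_def trace_sub L uinv_gi \<alpha>_shape)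
  have curv\<beta>: "strictly_upper (curv \<beta> p u v)" "curv \<beta> p (th p) (e2 p) $ 1 $ 2 = 0" for p u v
  proof -
    obtain Q1 Q2 U1 U2 where Q: "\<And>y u v. y \<in> Y_bundle P \<Longrightarrow> u \<in> tangent_space (Y_bundle P) y \<Longrightarrow> v \<in> tangent_space (Y_bundle P) y \<Longrightarrow>
        curvature \<pi>' y u v = vector [vector [0, Q2 y * wedge (\<lambda>v. cof_\<omega> y (fst v)) (\<lambda>v. cof_\<omega>1 y (fst v)) u v,
              wedge (\<lambda>v. U1 y * cof_\<omega>1 y (fst v) + U2 y * cof_\<omega>2 y (fst v)) (\<lambda>v. cof_\<omega> y (fst v)) u v],
            vector [0, 0, Q1 y * wedge (\<lambda>v. cof_\<omega> y (fst v)) (\<lambda>v. cof_\<omega>2 y (fst v)) u v],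
            vector [0, 0, 0 :: real]]"
      using \<pi>' unfolding normal_cartan_connection_def Let_def by blast
    have c: "curv \<beta> p u v = g p ** curvature \<pi>' (s p) (V p u) (V p v) ** gi p" for u v
    proof -
      have "curv \<beta> p u v ** g p = g p ** curv \<alpha> p u v"
        using curv_gauge[OF open_UNIV smg sm\<alpha> sm\<beta> \<beta>_gauge UNIV_I, of p u v] by simp
      moreover have "curv \<alpha> p u v = curvature \<pi>' (s p) (V p u) (V p v)"
        unfolding \<alpha>_def curv_pullback[OF open_UNIV sm U(1,3) sU UNIV_I] by (simp add: V_def curv_def curvature_def)
      ultimately have "curv \<beta> p u v ** g p ** gi p = g p ** curvature \<pi>' (s p) (V p u) (V p v) ** gi p" by simp
      then show ?thesis by (simp add: matrix_mul_assoc[symmetric] inv)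
    qed
    note upper = borel_group_upper[OF gB[of p]] borel_group_upper[OF giB[of p]]
    show "strictly_upper (curv \<beta> p u v)"
      unfolding c Q[OF sY V V]
      by (simp add: strictly_upper_def upper_triangular_def matrix_matrix_mult_def sum_3 upper)
    \<comment> \<open>\<omega> and \<omega>1 are combinations of \<theta> and \<theta>'1, both of
      which vanish on \<open>e2\<close>. Conjugating a strictly upper triangular matrix by an upper
      triangular one merely rescales entry (1,2), so its vanishing carries over to \<beta>.\<close>
    have "wedge (\<lambda>v. cof_\<omega> (s p) (fst v)) (\<lambda>v. cof_\<omega>1 (s p) (fst v)) (V p (th p)) (V p (e2 p)) = 0"
      unfolding wedge_def cof_tangent[OF sY V] V_base base by simp
    then show "curv \<beta> p (th p) (e2 p) $ 1 $ 2 = 0"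
      unfolding c Q[OF sY V V] by (simp add: matrix_matrix_mult_def sum_3 upper)
  qed
  have \<beta>A: "\<beta> p v = A p v" for p v
    by (rule normal_potential_unique[OF sm\<beta> low\<beta> tr\<beta> curv\<beta>])
  have g_per: "g (p + k) = g p" if "k \<in> lattice" for p k
    by (simp add: g_def per[OF that] hf_translate[OF that])
  show ?thesis
    unfolding \<alpha>_def[symmetric]
  proof (rule torus_integral_TC2_gauge[OF smooth_form_A[OF open_UNIV] smg smgi inv(2) inv(1)])
    show "\<alpha> p v = gi p ** (A p v ** g p + ?G p v)" for p v
    proof -
      have "gi p ** (g p ** \<alpha> p v) = gi p ** (A p v ** g p + ?G p v)" unfolding \<beta>_gauge \<beta>A ..
      then show ?thesis by (simp add: matrix_mul_assoc inv)
    qed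
    show "upper_triangular (g p)" for p using gB by (simp add: borel_group_iff)
  qed (simp_all add: upgi strictly_upper_curv_A g_per gi_def A_periodic upper_triangular_uinv)
qed

text \<open>Every admissible pair of connection and section yields the integral for
  \<open>A\<close>, which is the uniqueness half; \<open>PI\<close> with the section of Borel
  coordinate 1 supplies existence.\<close>

lemma global_invariant_P: "global_invariant P = 3 * of_int n / (8 * pi) * (b * f)\<^sup>2"
  unfolding global_invariant_def torus_integral_TC2_A[symmetric]
proof (rule the_equality)
  show "\<exists>\<pi> s. normal_cartan_connection P \<pi> \<and> global_section P s \<and> torus_integral (TC2 A) = torus_integral (TC2 (pullback s \<pi>))"
    by (rule exI[of _ PI], rule exI[of _ "\<lambda>p. sig p (mat 1)"])
      (simp add: normal_cartan_connection_PI global_section_sig torus_integral_normal_connection)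
qed (auto simp: torus_integral_normal_connection)

end

text \<open>The first conjunct certifies that the invariant is taken of a genuine path structure.
  Rewriting the three forms as inner products with \<open>th\<close>, \<open>u1\<close>,
  \<open>u2\<close> identifies this structure with \<open>P\<close>.\<close>

theorem proposition5p3:
  fixes n :: int and a b c f :: real
    and \<theta> \<theta>1 \<theta>2 \<theta>1' \<theta>2' :: "real^3 \<Rightarrow> real^3 \<Rightarrow> real"
  assumes "n \<noteq> 0" and "a * f - b * c = 1"
    and "\<And>p v. \<theta> p v = cos (2 * pi * of_int n * p $ 3) * v $ 1 - sin (2 * pi * of_int n * p $ 3) * v $ 2"
    and "\<And>p v. \<theta>1 p v = - 2 * pi * of_int n * v $ 3"
    and "\<And>p v. \<theta>2 p v = sin (2 * pi * of_int n * p $ 3) * v $ 1 + cos (2 * pi * of_int n * p $ 3) * v $ 2"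
    and "\<And>p v. \<theta>1' p v = a * \<theta>1 p v + b * \<theta>2 p v"
    and "\<And>p v. \<theta>2' p v = c * \<theta>1 p v + f * \<theta>2 p v"
  shows "path_structure (path_structure_of_forms \<theta> \<theta>1' \<theta>2') \<and>
    global_invariant (path_structure_of_forms \<theta> \<theta>1' \<theta>2') = 3 * of_int n / (8 * pi) * (b * f)\<^sup>2"
proof -
  interpret torus_path n a b c f by unfold_locales (fact assms(1,2))+
  have "\<theta> p v = th p \<bullet> v" "\<theta>1' p v = u1 p \<bullet> v" "\<theta>2' p v = u2 p \<bullet> v" for p v
    by (simp_all add: assms(3-7) th_def u1_def u2_def t1_def t2_def N_def inner_vec_def sum_3 algebra_simps)
  then have "path_structure_of_forms \<theta> \<theta>1' \<theta>2' = P"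
    by (simp add: path_structure_of_forms_def P_def)
  then show ?thesis using path_structure_P global_invariant_P by simp
qed

end
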